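(* Assume (A1), (A2) and the local alternatives $K_{(n)}: H\beta=h_n+n^{-1/2}\xi$ (model, estimators, statistics and assumptions as in the context), and suppose $C$ is nonsingular and $\lambda_n/\sqrt n\to\lambda_0\ge0$. Let $W\sim N_p(0,\sigma^2C)$, $$V(u)=-2u^TW+u^TCu+\lambda_0\sum_{j=1}^p\left[u_j\,\mathrm{sgn}(\beta_j)I(\beta_j\ne0)+|u_j|I(\beta_j=0)\right],\qquad u\in\mathbb{R}^p,$$ $v^*=\operatorname{argmin}_uV(u)$, $M=C^{-1}H^T(HC^{-1}H^T)^{-1}$, $k=q-2$, $$\mathcal{L}=\sigma^{-2}(HC^{-1}W+\xi)^T(HC^{-1}H^T)^{-1}(HC^{-1}W+\xi)$$ (with the same $W$ as in $V$), $\Delta^2=\sigma^{-2}\xi^T(HC^{-1}H^T)^{-1}\xi$, and let $\mathcal{L}_\alpha$ be the upper $\alpha$-level critical value of the chi-squared distribution with $q$ degrees of freedom. Then, as $n\to\infty$: (i) $\sqrt n(\tilde\beta_n-\beta)\to N_p(0,\sigma^2C^{-1})$ in distribution. (ii) $\sqrt n(\hat\beta_n^L-\beta)\to v^*$ in distribution. (iii) $\sqrt n(\hat\beta_n^{RL}-\beta)\to v^*-M(Hv^*+\xi)$ in distribution. (iv) $\sqrt n(\hat\beta_n^L-\hat\beta_n^{RL})\to M(Hv^*+\xi)$ in distribution. (v) $\lim_{n\to\infty}P(\mathcal{L}_n\le x)=H_q(x;\Delta^2)$. (vi) $\sqrt n(\hat\beta_n^{PTL}-\beta)\to v^*-M(Hv^*+\xi)I(\mathcal{L}\le\mathcal{L}_\alpha)$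 in distribution. (vii) $\sqrt n(\hat\beta_n^{SSL}-\beta)\to v^*-k\,M(Hv^*+\xi)\mathcal{L}^{-1}$ in distribution. (viii) $\sqrt n(\hat\beta_n^{PRSSL}-\beta)\to v^*-\left\{k\mathcal{L}^{-1}+(1-k\mathcal{L}^{-1})I(\mathcal{L}<k)\right\}M(Hv^*+\xi)$ in distribution.
   Context: Model: $Y_n=X_n\beta+\epsilon_n$, where $p$ is fixed, $\beta\in\mathbb{R}^p$ is a fixed unknown vector, $X_n$ is a non-random $n\times p$ matrix of rank $p$ with rows $x_1^T,\dots,x_n^T$, and $\epsilon_n=(\epsilon_1,\dots,\epsilon_n)^T$ has i.i.d. components with mean $0$ and variance $\sigma^2\in(0,\infty)$. Put $C_n=X_n^TX_n$. Regularity assumptions: (A1) $\max_{1\le i\le n}x_i^TC_n^{-1}x_i\to0$; (A2) $n^{-1}C_n\to C$, a finite positive-definite matrix. Restriction and local alternatives: $H$ is a known $q\times p$ matrix of rank $q\le p$, and the hypothesis is $\mathcal{H}_o: H\beta=h_n$. Under the local alternatives $K_{(n)}$ one has $H\beta=h_n+n^{-1/2}\xi$ with $\xi\in\mathbb{R}^q$ fixed (so $h_n=H\beta-n^{-1/2}\xi$). OLS: $\tilde\beta_n=C_n^{-1}X_n^TY_n$, $m=n-p>0$, $s_e^2=m^{-1}(Y_n-X_n\tilde\beta_n)^T(Y_n-X_n\tilde\beta_n)$. LASSO: $\hat\beta_n^L=\operatorname{argmin}_{b\in\mathbb{R}^p}\{\|Y_n-X_nb\|_2^2+\lambda_n\sum_{j=1}^p|b_j|\}$,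 with non-random $\lambda_n\ge0$. Restricted LASSO: $\hat\beta_n^{RL}=\hat\beta_n^L-C_n^{-1}H^T(HC_n^{-1}H^T)^{-1}(H\hat\beta_n^L-h_n)$. Test statistic: $\mathcal{L}_n=s_e^{-2}(H\tilde\beta_n-h_n)^T(HC_n^{-1}H^T)^{-1}(H\tilde\beta_n-h_n)$. For a fixed level $\alpha\in(0,1)$, $\mathcal{L}_{n,\alpha}$ is the upper $\alpha$-level critical value of the exact distribution of $\mathcal{L}_n$ under $\mathcal{H}_o$. Preliminary test LASSO: $\hat\beta_n^{PTL}=\hat\beta_n^L-(\hat\beta_n^L-\hat\beta_n^{RL})I(\mathcal{L}_n\le\mathcal{L}_{n,\alpha})$. Stein-type shrinkage LASSO: $\hat\beta_n^{SSL}=\hat\beta_n^L-k_n(\hat\beta_n^L-\hat\beta_n^{RL})\mathcal{L}_n^{-1}$, with $k_n=m(q-2)/(m+2)$. Positive-rule Stein-type shrinkage LASSO: $\hat\beta_n^{PRSSL}=\hat\beta_n^{RL}+(1-k_n\mathcal{L}_n^{-1})I(\mathcal{L}_n>k_n)(\hat\beta_n^L-\hat\beta_n^{RL})$. $I(\cdot)$ is the indicator function; values on the asymptotically negligible events $s_e^2=0$ or $\mathcal{L}_n=0$ are arbitrary. $H_\nu(\cdot;\Delta^2)$ is the c.d.f. of the noncentral chi-squared distribution with $\nu$ degrees of freedom and noncentrality $\Delta^2/2$ in the Poisson-mixture sense, i.e. the law of $\|N_\nu(\mu,I_\nu)\|^2$ with $\|\mu\|^2=\Delta^2$. *)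

theory Defs
  imports "HOL-Probability.Probability"
begin

section \<open>Probabilistic notions\<close>

definition pos_def :: "real^'n^'n \<Rightarrow> bool" where
  "pos_def A \<longleftrightarrow> transpose A = A \<and> (\<forall>u. u \<noteq> 0 \<longrightarrow> 0 < u \<bullet> (A *v u))"

text \<open>
  The limit may live on a different probability space. Measurability is only required eventually,
  because for small sample sizes the estimators need not be well defined.
\<close>

definition converges_in_distribution ::
  "'a measure \<Rightarrow> (nat \<Rightarrow> 'a \<Rightarrow> 'c::{metric_space}) \<Rightarrow> 'b measure \<Rightarrow> ('b \<Rightarrow> 'c) \<Rightarrow> bool" where
  "converges_in_distribution M X N Z \<longleftrightarrow>
     (\<forall>\<^sub>F n in sequentially. X n \<in> borel_measurable M) \<and> Z \<in> borel_measurable N \<and>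
     (\<forall>f :: 'c \<Rightarrow> real. continuous_on UNIV f \<and> bounded (range f) \<longrightarrow>
        (\<lambda>n. \<integral>\<omega>. f (X n \<omega>) \<partial>M) \<longlonglongrightarrow> (\<integral>\<omega>. f (Z \<omega>) \<partial>N))"

text \<open>The density of the normal distribution; meaningful for positive definite \<open>S\<close> only.\<close>

definition mvn_density :: "real^'n \<Rightarrow> real^'n^'n \<Rightarrow> real^'n \<Rightarrow> real" where
  "mvn_density mu S z =
     exp (- ((z - mu) \<bullet> (matrix_inv S *v (z - mu))) / 2) / sqrt ((2 * pi) ^ CARD('n) * det S)"

definition mvn :: "real^'n \<Rightarrow> real^'n^'n \<Rightarrow> (real^'n) measure" where
  "mvn mu S = density lborel (\<lambda>z. ennreal (mvn_density mu S z))"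

text \<open>
  The noncentral chi-squared distribution with \<open>CARD('n)\<close> degrees of freedom, as the law of the squared norm of
  a normal vector with mean \<open>mu\<close> and identity covariance. It depends on \<open>mu\<close> only through
  \<open>(norm mu)\<^sup>2\<close>; \<open>mu = 0\<close> gives the central distribution.
\<close>

definition noncentral_chi_square :: "real^'n \<Rightarrow> real measure" where
  "noncentral_chi_square mu = distr (mvn mu (mat 1)) borel (\<lambda>z. (norm z)\<^sup>2)"

text \<open>For laws with atoms, the critical value is the smallest \<open>t\<close> exceeded with probability at most
  \<open>alpha\<close>.\<close>

definition upper_critical_value :: "real \<Rightarrow> real measure \<Rightarrow> real" where
  "upper_critical_value alpha D = Inf {t. measure D {t<..} \<le> alpha}"

section \<open>Linear regression and the restriction\<close>

text \<open>
  A design matrix with \<open>n\<close> rows is given by its rows \<open>x 0, \<dots>, x (n - 1)\<close>, and a response vector by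
  \<open>y 0, \<dots>, y (n - 1)\<close>. Thus \<open>gram n x\<close> is the product of the transposed design matrix with the
  design matrix.
\<close>

definition gram :: "nat \<Rightarrow> (nat \<Rightarrow> real^'p) \<Rightarrow> real^'p^'p" where
  "gram n x = (\<chi> j k. \<Sum>i<n. x i $ j * x i $ k)"

definition response :: "(nat \<Rightarrow> real^'p) \<Rightarrow> real^'p \<Rightarrow> (nat \<Rightarrow> real) \<Rightarrow> nat \<Rightarrow> real" where
  "response x b e i = x i \<bullet> b + e i"

definition rss :: "nat \<Rightarrow> (nat \<Rightarrow> real^'p) \<Rightarrow> (nat \<Rightarrow> real) \<Rightarrow> real^'p \<Rightarrow> real" where
  "rss n x y b = (\<Sum>i<n. (y i - x i \<bullet> b)\<^sup>2)"

text \<open>For a positive definite \<open>A\<close>: the matrix \<open>A\<^sup>-\<^sup>1 H\<^sup>T (H A\<^sup>-\<^sup>1 H\<^sup>T)\<^sup>-\<^sup>1\<close> and the quadratic form of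
  \<open>(H A\<^sup>-\<^sup>1 H\<^sup>T)\<^sup>-\<^sup>1\<close>.\<close>

definition correction :: "real^'p^'p \<Rightarrow> real^'p^'q \<Rightarrow> real^'q^'p" where
  "correction A H =
     matrix_inv A ** transpose H ** matrix_inv (H ** matrix_inv A ** transpose H)"

definition restriction_form :: "real^'p^'p \<Rightarrow> real^'p^'q \<Rightarrow> real^'q \<Rightarrow> real" where
  "restriction_form A H r = r \<bullet> (matrix_inv (H ** matrix_inv A ** transpose H) *v r)"

section \<open>Estimators and test statistic\<close>

definition ols :: "nat \<Rightarrow> (nat \<Rightarrow> real^'p) \<Rightarrow> (nat \<Rightarrow> real) \<Rightarrow> real^'p" where
  "ols n x y = matrix_inv (gram n x) *v (\<Sum>i<n. y i *\<^sub>R x i)"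

definition residual_variance :: "nat \<Rightarrow> (nat \<Rightarrow> real^'p) \<Rightarrow> (nat \<Rightarrow> real) \<Rightarrow> real" where
  "residual_variance n x y = rss n x y (ols n x y) / (real n - real CARD('p))"

definition test_statistic ::
  "nat \<Rightarrow> (nat \<Rightarrow> real^'p) \<Rightarrow> real^'p^'q \<Rightarrow> real^'q \<Rightarrow> (nat \<Rightarrow> real) \<Rightarrow> real" where
  "test_statistic n x H h y =
     restriction_form (gram n x) H (H *v ols n x y - h) / residual_variance n x y"

definition lasso :: "nat \<Rightarrow> (nat \<Rightarrow> real^'p) \<Rightarrow> real \<Rightarrow> (nat \<Rightarrow> real) \<Rightarrow> real^'p" where
  "lasso n x lam y = (ARG_MIN (\<lambda>b. rss n x y b + lam * (\<Sum>j\<in>UNIV. \<bar>b $ j\<bar>)) b. True)"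

definition restricted_lasso ::
  "nat \<Rightarrow> (nat \<Rightarrow> real^'p) \<Rightarrow> real \<Rightarrow> real^'p^'q \<Rightarrow> real^'q \<Rightarrow> (nat \<Rightarrow> real) \<Rightarrow> real^'p" where
  "restricted_lasso n x lam H h y =
     lasso n x lam y - correction (gram n x) H *v (H *v lasso n x lam y - h)"

definition pt_lasso ::
  "nat \<Rightarrow> (nat \<Rightarrow> real^'p) \<Rightarrow> real \<Rightarrow> real^'p^'q \<Rightarrow> real^'q \<Rightarrow> real \<Rightarrow> (nat \<Rightarrow> real) \<Rightarrow> real^'p" where
  "pt_lasso n x lam H h crit y =
     lasso n x lam y -
     of_bool (test_statistic n x H h y \<le> crit) *\<^sub>R (lasso n x lam y - restricted_lasso n x lam H h y)"

definition shrinkage_const :: "nat \<Rightarrow> nat \<Rightarrow> nat \<Rightarrow> real" where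
  "shrinkage_const n p q = (real n - real p) * (real q - 2) / (real n - real p + 2)"

definition stein_lasso ::
  "nat \<Rightarrow> (nat \<Rightarrow> real^'p) \<Rightarrow> real \<Rightarrow> real^'p^'q \<Rightarrow> real^'q \<Rightarrow> (nat \<Rightarrow> real) \<Rightarrow> real^'p" where
  "stein_lasso n x lam H h y =
     lasso n x lam y -
     (shrinkage_const n CARD('p) CARD('q) / test_statistic n x H h y) *\<^sub>R
       (lasso n x lam y - restricted_lasso n x lam H h y)"

definition positive_stein_lasso ::
  "nat \<Rightarrow> (nat \<Rightarrow> real^'p) \<Rightarrow> real \<Rightarrow> real^'p^'q \<Rightarrow> real^'q \<Rightarrow> (nat \<Rightarrow> real) \<Rightarrow> real^'p" where
  "positive_stein_lasso n x lam H h y =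
     restricted_lasso n x lam H h y +
     ((1 - shrinkage_const n CARD('p) CARD('q) / test_statistic n x H h y) *
        of_bool (test_statistic n x H h y > shrinkage_const n CARD('p) CARD('q))) *\<^sub>R
       (lasso n x lam y - restricted_lasso n x lam H h y)"

section \<open>The limiting criterion\<close>

definition limit_criterion ::
  "real^'p^'p \<Rightarrow> real \<Rightarrow> real^'p \<Rightarrow> real^'p \<Rightarrow> real^'p \<Rightarrow> real" where
  "limit_criterion C lam0 beta w u =
     - 2 * (u \<bullet> w) + u \<bullet> (C *v u) +
     lam0 * (\<Sum>j\<in>UNIV. u $ j * sgn (beta $ j) * of_bool (beta $ j \<noteq> 0)
                       + \<bar>u $ j\<bar> * of_bool (beta $ j = 0))"

end

theory Submission
  imports Defs
begin

text \<open>
  With \<open>w = X\<^sup>T \<epsilon> / \<surd>n\<close> (the score), \<open>q = n\<^sup>-\<^sup>1 \<Sum> \<epsilon>\<^sub>i\<^sup>2\<close> and \<open>A = n\<^sup>-\<^sup>1 X\<^sup>T X\<close>, every quantity of the theorem is, for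
  large \<open>n\<close>, a deterministic function of the pair \<open>(w, q)\<close>. The rescaled least squares error is \<open>A\<^sup>-\<^sup>1 w\<close>,
  the residual sum of squares is \<open>n q - w \<bullet> A\<^sup>-\<^sup>1 w\<close>, and substituting \<open>b = \<beta> + u / \<surd>n\<close> in the lasso
  criterion leaves, up to a constant, a strictly convex function of \<open>u\<close> that depends on the errors only
  through the linear term \<open>-2 u \<bullet> w\<close>. Thus the rescaled lasso error is a function \<open>v\<^sub>n(w)\<close>. The
  rescaled difference of lasso and restricted lasso is \<open>D\<^sub>n = M\<^sub>n (H v\<^sub>n + \<xi>)\<close>, with \<open>M\<^sub>n\<close> the correction matrix, and the
  restricted, preliminary test and Stein-type estimators all have the rescaled form \<open>v\<^sub>n - c\<^sub>n(T\<^sub>n) D\<^sub>n\<close>,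
  where \<open>T\<^sub>n\<close> is the test statistic and \<open>c\<^sub>n\<close> a real function.

  Three facts then give all eight limits.

  First, \<open>(w, q)\<close> converges in distribution to \<open>(W, \<sigma>\<^sup>2)\<close> (\<open>score_pair_converges\<close>). By
  Cauchy--Schwarz for the Gram matrix, the vanishing leverages bound the weights of the single errors in
  \<open>t \<bullet> w\<close>, which is Lindeberg's condition, so the characteristic functions of \<open>w\<close> converge
  (\<open>weighted_sum_clt\<close>). The Levy continuity theorem on Euclidean spaces (\<open>levy_continuity_euclidean\<close>)
  turns this into convergence in distribution. It is proved by adding a small Gaussian noise: the smoothed
  densities converge pointwise, hence in mean by Scheffe's lemma.

  Second, the maps converge continuously: \<open>g\<^sub>n(y\<^sub>n)\<close> tends to \<open>g(y)\<close> whenever \<open>y\<^sub>n\<close> tends to \<open>y\<close>, for all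
  \<open>y\<close> outside a null set of the limit law. For the lasso this is stability of minimisers under strong
  convexity (\<open>penalized_argmin_tendsto\<close>); the other maps are built from matrix inverses and quotients.
  Discontinuities occur only where the limit \<open>L\<close> of the test statistic equals \<open>0\<close>, \<open>k\<close> or the critical value. These
  are null events because \<open>L\<close> has a noncentral chi-squared law (\<open>restriction_form_law\<close>), which has no
  atoms. The critical values converge because the limiting distribution function increases strictly on the
  positive half-line (\<open>upper_critical_value_tendsto\<close>).

  Third, an extended continuous mapping theorem for maps that vary with \<open>n\<close>
  (\<open>extended_mapping_theorem\<close>) combines the two. It is obtained from Lipschitz envelopes, without a
  coupling of the random variables.
\<close>

section \<open>Convergence in distribution and continuous mapping\<close>

text \<open>The envelope \<open>chi k\<close> is the least \<open>k\<close>-Lipschitz function above all \<open>phi n\<close> with \<open>n \<ge> k\<close>. It converges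
  wherever the \<open>phi n\<close> converge continuously: points near \<open>y\<close> have values close to the limit, and
  distant points lose at least the oscillation of \<open>phi\<close> to the distance penalty once \<open>k\<close> is large.\<close>

lemma sup_envelope:
  fixes phi :: "nat \<Rightarrow> 'c::metric_space \<Rightarrow> real"
  assumes bnd: "\<And>n y. \<bar>phi n y\<bar> \<le> B"
  defines "chi \<equiv> \<lambda>k y. SUP p\<in>{k..} \<times> UNIV. phi (fst p) (snd p) - real k * dist y (snd p)"
  shows "n \<ge> k \<Longrightarrow> phi n y \<le> chi k y"
    and "\<bar>chi k y\<bar> \<le> B"
    and "(real k)-lipschitz_on UNIV (chi k)"
    and "((\<lambda>(n, y). phi n y) \<longlongrightarrow> l) (sequentially \<times>\<^sub>F nhds y) \<Longrightarrow> (\<lambda>k. chi k y) \<longlonglongrightarrow> l"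
proof -
  have bdd: "bdd_above ((\<lambda>p. phi (fst p) (snd p) - real k * dist y (snd p)) ` ({k..} \<times> UNIV))" for k y
    using bnd by (intro bdd_aboveI[of _ B]) (auto simp: abs_le_iff intro!: add_mono order_trans[OF diff_mono[OF _ zero_le_mult_iff[THEN iffD2]], of _ B] )
  have ge: "phi n y' - real k * dist y y' \<le> chi k y" if "n \<ge> k" for n k y y'
    unfolding chi_def using that by (intro cSUP_upper2[OF bdd, of "(n, y')"]) auto
  have le: "chi k y \<le> u" if "\<And>n y'. n \<ge> k \<Longrightarrow> phi n y' - real k * dist y y' \<le> u" for k y u
    unfolding chi_def using that by (intro cSUP_least) auto
  show 1: "phi n y \<le> chi k y" if "n \<ge> k" for n k y
    using ge[OF that, of y y] by simp
  have leB: "chi k y \<le> B" for k y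
  proof (rule le)
    fix n y' show "phi n y' - real k * dist y y' \<le> B"
      using bnd[of n y'] by (smt (verit) mult_nonneg_nonneg of_nat_0_le_iff zero_le_dist)
  qed
  show "\<bar>chi k y\<bar> \<le> B" for k y
    using leB[of k y] 1[of k k y] bnd[of k y] by linarith
  have half: "chi k y - chi k z \<le> real k * dist y z" for k y z
  proof -
    have "chi k y \<le> chi k z + real k * dist y z"
    proof (rule le)
      fix n y' assume n: "k \<le> n"
      have "real k * dist z y' \<le> real k * (dist y y' + dist y z)"
        by (intro mult_left_mono) (use dist_triangle[of z y' y] in \<open>auto simp: dist_commute\<close>)
      then show "phi n y' - real k * dist y y' \<le> chi k z + real k * dist y z"
        using ge[OF n, of y' z] by (simp add: distrib_left)
    qed
    then show ?thesis by simp
  qed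
  show "(real k)-lipschitz_on UNIV (chi k)" for k
  proof (rule lipschitz_onI)
    fix y z show "dist (chi k y) (chi k z) \<le> real k * dist y z"
      using half[of k y z] half[of k z y] by (auto simp: dist_real_def dist_commute abs_le_iff)
  qed simp
  show "(\<lambda>k. chi k y) \<longlonglongrightarrow> l" if lim: "((\<lambda>(n, y). phi n y) \<longlongrightarrow> l) (sequentially \<times>\<^sub>F nhds y)" for y l
  proof (rule LIMSEQ_I)
    fix e :: real assume e: "e > 0"
    from tendstoD[OF lim, of "e/2"] e
    have "\<forall>\<^sub>F p in sequentially \<times>\<^sub>F nhds y. dist (phi (fst p) (snd p)) l < e/2" by (simp add: case_prod_beta)
    then obtain P Q where P: "eventually P sequentially" and Q: "eventually Q (nhds y)"
      and PQ: "\<And>n y'. P n \<Longrightarrow> Q y' \<Longrightarrow> dist (phi n y') l < e/2"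
      unfolding eventually_prod_filter by auto
    from P obtain K where K: "\<And>n. n \<ge> K \<Longrightarrow> P n" by (auto simp: eventually_sequentially)
    from Q obtain d where d: "d > 0" "\<And>y'. dist y' y < d \<Longrightarrow> Q y'"
      by (auto simp: eventually_nhds_metric)
    have near: "\<bar>phi n y' - l\<bar> < e/2" if "n \<ge> K" "dist y y' < d" for n y'
      using PQ[OF K[OF that(1)], of y'] d(2) that(2) dist_commute[of y y'] by (simp add: dist_real_def)
    (* from distance d on, the penalty outweighs the oscillation 2 * B of phi *)
    obtain K' :: nat where K': "real K' * d \<ge> 2 * B"
      using reals_Archimedean3[OF d(1)] by (meson less_imp_le)
    have "\<bar>chi k y - l\<bar> < e" if k: "k \<ge> max K K'" for k
    proof -
      have "\<bar>phi K y - l\<bar> < e/2" using near[of K y] d(1) by simp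
      then have l: "l \<ge> - B - e/2" using bnd[of K y] by linarith
      have up: "chi k y \<le> l + e/2"
      proof (rule le)
        fix n y' assume n: "k \<le> n"
        show "phi n y' - real k * dist y y' \<le> l + e/2"
        proof (cases "dist y y' < d")
          case True
          have "\<bar>phi n y' - l\<bar> < e/2" using near[OF _ True, of n] n k by simp
          moreover have "0 \<le> real k * dist y y'" by simp
          ultimately show ?thesis by linarith
        next
          case False
          have "2 * B \<le> real k * dist y y'"
            using K' k False d(1) by (intro order_trans[OF K']) (auto intro!: mult_mono)
          with bnd[of n y'] l show ?thesis by linarith
        qed
      qed
      have "phi k y \<le> chi k y" by (rule 1) simp
      moreover have "\<bar>phi k y - l\<bar> < e/2" using near[of k y] d(1) k by simp
      ultimately show ?thesis using up e by linarith
    qed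
    then show "\<exists>no. \<forall>k\<ge>no. norm (chi k y - l) < e" by (auto intro!: exI[of _ "max K K'"])
  qed
qed

lemma bounded_integrable:
  assumes "prob_space M" "f \<in> borel_measurable M" "\<And>x. \<bar>f x\<bar> \<le> (B::real)"
  shows "integrable M f"
proof -
  interpret prob_space M by fact
  show ?thesis by (rule integrable_const_bound[of _ B]) (use assms in auto)
qed

text \<open>The expectation of \<open>phi n (X n)\<close> is at most that of \<open>chi k (X n)\<close>, which converges because
  \<open>chi k\<close> is Lipschitz; the limit is close to the expectation of \<open>phi0 Z\<close> for large \<open>k\<close> by dominated
  convergence.\<close>

lemma expectation_limsup_le:
  fixes X :: "nat \<Rightarrow> 'a \<Rightarrow> 'c::metric_space" and phi :: "nat \<Rightarrow> 'c \<Rightarrow> real"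
  assumes M: "prob_space M" and N: "prob_space N"
    and X: "\<forall>\<^sub>F n in sequentially. X n \<in> borel_measurable M" and Z: "Z \<in> borel_measurable N"
    and conv: "\<And>(f :: 'c \<Rightarrow> real) K. K-lipschitz_on UNIV f \<Longrightarrow> bounded (range f) \<Longrightarrow>
      (\<lambda>n. \<integral>\<omega>. f (X n \<omega>) \<partial>M) \<longlonglongrightarrow> (\<integral>\<omega>. f (Z \<omega>) \<partial>N)"
    and phi: "\<forall>\<^sub>F n in sequentially. (\<lambda>\<omega>. phi n (X n \<omega>)) \<in> borel_measurable M"
    and phi0: "(\<lambda>\<omega>. phi0 (Z \<omega>)) \<in> borel_measurable N"
    and bnd: "\<And>n y. \<bar>phi n y\<bar> \<le> B"
    and cont: "AE \<omega> in N. ((\<lambda>(n, y). phi n y) \<longlongrightarrow> phi0 (Z \<omega>)) (sequentially \<times>\<^sub>F nhds (Z \<omega>))"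
    and e: "e > 0"
  shows "\<forall>\<^sub>F n in sequentially. (\<integral>\<omega>. phi n (X n \<omega>) \<partial>M) < (\<integral>\<omega>. phi0 (Z \<omega>) \<partial>N) + e"
proof -
  interpret M: prob_space M by fact
  interpret N: prob_space N by fact
  define chi where "chi k y = (SUP p\<in>{k..} \<times> UNIV. phi (fst p) (snd p) - real k * dist y (snd p))" for k y
  note env = sup_envelope[of phi B, OF bnd, folded chi_def]
  have chi_cont: "continuous_on UNIV (chi k)" for k
    by (rule lipschitz_on_continuous_on[OF env(3)])
  note chi_meas = borel_measurable_continuous_onI[OF chi_cont]
  have "(\<lambda>k. \<integral>\<omega>. chi k (Z \<omega>) \<partial>N) \<longlonglongrightarrow> (\<integral>\<omega>. phi0 (Z \<omega>) \<partial>N)"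
  proof (rule integral_dominated_convergence[where w="\<lambda>_. B"])
    show "AE \<omega> in N. (\<lambda>k. chi k (Z \<omega>)) \<longlonglongrightarrow> phi0 (Z \<omega>)"
      using cont by eventually_elim (rule env(4))
  qed (use phi0 env(2) measurable_compose[OF Z chi_meas] in auto)
  then have "\<forall>\<^sub>F k in sequentially. (\<integral>\<omega>. chi k (Z \<omega>) \<partial>N) < (\<integral>\<omega>. phi0 (Z \<omega>) \<partial>N) + e"
    using e by (intro order_tendstoD) auto
  then obtain k where k: "(\<integral>\<omega>. chi k (Z \<omega>) \<partial>N) < (\<integral>\<omega>. phi0 (Z \<omega>) \<partial>N) + e"
    by (auto simp: eventually_sequentially)
  have "bounded (range (chi k))" using env(2)[of k] by (auto simp: bounded_iff intro!: exI[of _ B])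
  from order_tendstoD(2)[OF conv[OF env(3) this] k]
  have "\<forall>\<^sub>F n in sequentially. (\<integral>\<omega>. chi k (X n \<omega>) \<partial>M) < (\<integral>\<omega>. phi0 (Z \<omega>) \<partial>N) + e" .
  then show ?thesis using X phi eventually_ge_at_top[of k]
  proof eventually_elim
    case (elim n)
    have "(\<integral>\<omega>. phi n (X n \<omega>) \<partial>M) \<le> (\<integral>\<omega>. chi k (X n \<omega>) \<partial>M)"
      using env(1)[OF elim(4)] elim env(2) bnd measurable_compose[OF elim(2) chi_meas]
      by (intro integral_mono bounded_integrable[OF M, of _ B]) auto
    with elim show ?case by simp
  qed
qed

text \<open>The lower bound is the upper bound for \<open>- phi\<close>.\<close>

lemma expectation_tendsto:
  fixes X :: "nat \<Rightarrow> 'a \<Rightarrow> 'c::metric_space" and phi :: "nat \<Rightarrow> 'c \<Rightarrow> real"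
  assumes M: "prob_space M" and N: "prob_space N"
    and X: "\<forall>\<^sub>F n in sequentially. X n \<in> borel_measurable M" and Z: "Z \<in> borel_measurable N"
    and conv: "\<And>(f :: 'c \<Rightarrow> real) K. K-lipschitz_on UNIV f \<Longrightarrow> bounded (range f) \<Longrightarrow>
      (\<lambda>n. \<integral>\<omega>. f (X n \<omega>) \<partial>M) \<longlonglongrightarrow> (\<integral>\<omega>. f (Z \<omega>) \<partial>N)"
    and phi: "\<forall>\<^sub>F n in sequentially. (\<lambda>\<omega>. phi n (X n \<omega>)) \<in> borel_measurable M"
    and phi0: "(\<lambda>\<omega>. phi0 (Z \<omega>)) \<in> borel_measurable N"
    and bnd: "\<And>n y. \<bar>phi n y\<bar> \<le> B"
    and cont: "AE \<omega> in N. ((\<lambda>(n, y). phi n y) \<longlongrightarrow> phi0 (Z \<omega>)) (sequentially \<times>\<^sub>F nhds (Z \<omega>))"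
  shows "(\<lambda>n. \<integral>\<omega>. phi n (X n \<omega>) \<partial>M) \<longlonglongrightarrow> (\<integral>\<omega>. phi0 (Z \<omega>) \<partial>N)"
proof (rule tendstoI)
  fix e :: real assume e: "e > 0"
  have cont': "AE \<omega> in N. ((\<lambda>(n, y). - phi n y) \<longlongrightarrow> - phi0 (Z \<omega>)) (sequentially \<times>\<^sub>F nhds (Z \<omega>))"
    using cont by eventually_elim (auto simp: case_prod_unfold dest: tendsto_minus)
  have phi': "\<forall>\<^sub>F n in sequentially. (\<lambda>\<omega>. - phi n (X n \<omega>)) \<in> borel_measurable M"
    using phi by eventually_elim auto
  have "\<forall>\<^sub>F n in sequentially. (\<integral>\<omega>. - phi n (X n \<omega>) \<partial>M) < (\<integral>\<omega>. - phi0 (Z \<omega>) \<partial>N) + e"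
    by (rule expectation_limsup_le[where B=B, OF M N X Z conv phi' _ _ cont' e]) (use phi0 bnd in auto)
  moreover have "\<forall>\<^sub>F n in sequentially. (\<integral>\<omega>. phi n (X n \<omega>) \<partial>M) < (\<integral>\<omega>. phi0 (Z \<omega>) \<partial>N) + e"
    by (rule expectation_limsup_le[where B=B, OF M N X Z conv phi phi0 bnd cont e])
  ultimately show "\<forall>\<^sub>F n in sequentially. dist (\<integral>\<omega>. phi n (X n \<omega>) \<partial>M) (\<integral>\<omega>. phi0 (Z \<omega>) \<partial>N) < e"
    by eventually_elim (auto simp: dist_real_def abs_less_iff)
qed

text \<open>Bounded Lipschitz test functions determine convergence in distribution: a bounded continuous function is
  a constant sequence that converges continuously.\<close>

lemma converges_in_distributionI_lipschitz:
  fixes X :: "nat \<Rightarrow> 'a \<Rightarrow> 'c::metric_space"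
  assumes "prob_space M" "prob_space N"
    "\<forall>\<^sub>F n in sequentially. X n \<in> borel_measurable M" "Z \<in> borel_measurable N"
    and "\<And>(f :: 'c \<Rightarrow> real) K. K-lipschitz_on UNIV f \<Longrightarrow> bounded (range f) \<Longrightarrow>
      (\<lambda>n. \<integral>\<omega>. f (X n \<omega>) \<partial>M) \<longlonglongrightarrow> (\<integral>\<omega>. f (Z \<omega>) \<partial>N)"
  shows "converges_in_distribution M X N Z"
  unfolding converges_in_distribution_def
proof (intro conjI allI impI)
  fix f :: "'c \<Rightarrow> real" assume f: "continuous_on UNIV f \<and> bounded (range f)"
  then obtain B where B: "\<And>y. \<bar>f y\<bar> \<le> B" by (auto simp: bounded_iff)
  have fm: "f \<in> borel_measurable borel" using f by (intro borel_measurable_continuous_onI) auto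
  show "(\<lambda>n. \<integral>\<omega>. f (X n \<omega>) \<partial>M) \<longlonglongrightarrow> (\<integral>\<omega>. f (Z \<omega>) \<partial>N)"
  proof (rule expectation_tendsto[where phi="\<lambda>_. f" and B=B, OF assms])
    show "\<forall>\<^sub>F n in sequentially. (\<lambda>\<omega>. f (X n \<omega>)) \<in> borel_measurable M"
      using assms(3) by eventually_elim (rule measurable_compose[OF _ fm])
    have "((\<lambda>(n, y). f y) \<longlongrightarrow> f z) (sequentially \<times>\<^sub>F nhds z)" for z
    proof -
      have "(f \<longlongrightarrow> f z) (nhds z)" using f by (simp add: continuous_on_def tendsto_at_iff_tendsto_nhds)
      then show ?thesis unfolding case_prod_beta by (rule filterlim_compose[OF _ filterlim_snd])
    qed
    then show "AE \<omega> in N. ((\<lambda>(n, y). f y) \<longlongrightarrow> f (Z \<omega>)) (sequentially \<times>\<^sub>F nhds (Z \<omega>))" by simp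
  qed (use B measurable_compose[OF assms(4) fm] in auto)
qed (use assms in auto)

text \<open>This form admits test functions that depend on \<open>n\<close> and are discontinuous on a null set of the limit.
  With indicators it gives convergence of distribution functions.\<close>

lemma converges_in_distribution_expectation:
  fixes X :: "nat \<Rightarrow> 'a \<Rightarrow> 'c::metric_space" and phi :: "nat \<Rightarrow> 'c \<Rightarrow> real"
  assumes M: "prob_space M" and N: "prob_space N" and XZ: "converges_in_distribution M X N Z"
    and "\<forall>\<^sub>F n in sequentially. (\<lambda>\<omega>. phi n (X n \<omega>)) \<in> borel_measurable M"
    and "(\<lambda>\<omega>. phi0 (Z \<omega>)) \<in> borel_measurable N"
    and "\<And>n y. \<bar>phi n y\<bar> \<le> B"
    and "AE \<omega> in N. ((\<lambda>(n, y). phi n y) \<longlongrightarrow> phi0 (Z \<omega>)) (sequentially \<times>\<^sub>F nhds (Z \<omega>))"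
  shows "(\<lambda>n. \<integral>\<omega>. phi n (X n \<omega>) \<partial>M) \<longlonglongrightarrow> (\<integral>\<omega>. phi0 (Z \<omega>) \<partial>N)"
  using XZ lipschitz_on_continuous_on
  by (intro expectation_tendsto[OF M N _ _ _ assms(4-)]) (auto simp: converges_in_distribution_def)

text \<open>The maps may depend on \<open>n\<close>, as the estimators do through the design and the critical values, and they
  may jump on a null set of the limit law.\<close>

lemma extended_mapping_theorem:
  fixes X :: "nat \<Rightarrow> 'a \<Rightarrow> 'c::metric_space" and g :: "nat \<Rightarrow> 'c \<Rightarrow> 'd::metric_space"
  assumes M: "prob_space M" and N: "prob_space N" and XZ: "converges_in_distribution M X N Z"
    and g: "\<forall>\<^sub>F n in sequentially. (\<lambda>\<omega>. g n (X n \<omega>)) \<in> borel_measurable M"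
    and g0: "(\<lambda>\<omega>. g0 (Z \<omega>)) \<in> borel_measurable N"
    and cont: "AE \<omega> in N. ((\<lambda>(n, y). g n y) \<longlongrightarrow> g0 (Z \<omega>)) (sequentially \<times>\<^sub>F nhds (Z \<omega>))"
  shows "converges_in_distribution M (\<lambda>n \<omega>. g n (X n \<omega>)) N (\<lambda>\<omega>. g0 (Z \<omega>))"
  unfolding converges_in_distribution_def
proof (intro conjI allI impI g g0)
  fix f :: "'d \<Rightarrow> real" assume f: "continuous_on UNIV f \<and> bounded (range f)"
  then obtain B where B: "\<And>y. \<bar>f y\<bar> \<le> B" by (auto simp: bounded_iff)
  have fm: "f \<in> borel_measurable borel" using f by (intro borel_measurable_continuous_onI) auto
  show "(\<lambda>n. \<integral>\<omega>. f (g n (X n \<omega>)) \<partial>M) \<longlonglongrightarrow> (\<integral>\<omega>. f (g0 (Z \<omega>)) \<partial>N)"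
  proof (rule converges_in_distribution_expectation[where phi="\<lambda>n y. f (g n y)" and B=B, OF M N XZ])
    show "\<forall>\<^sub>F n in sequentially. (\<lambda>\<omega>. f (g n (X n \<omega>))) \<in> borel_measurable M"
      using g by eventually_elim (rule measurable_compose[OF _ fm])
    show "AE \<omega> in N. ((\<lambda>(n, y). f (g n y)) \<longlongrightarrow> f (g0 (Z \<omega>))) (sequentially \<times>\<^sub>F nhds (Z \<omega>))"
      using cont
    proof eventually_elim
      case (elim \<omega>)
      have "(f \<longlongrightarrow> f (g0 (Z \<omega>))) (nhds (g0 (Z \<omega>)))"
        using f by (simp add: continuous_on_def tendsto_at_iff_tendsto_nhds)
      from filterlim_compose[OF this elim] show ?case by (simp add: case_prod_unfold)
    qed
  qed (use B measurable_compose[OF g0 fm] in auto)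
qed

section \<open>Characteristic functions on Euclidean spaces\<close>

text \<open>The standard normal density. In product form its Fourier transform factorises over the coordinates.\<close>

definition gauss_density :: "'a::euclidean_space \<Rightarrow> real" where
  "gauss_density z = (\<Prod>b\<in>Basis. std_normal_density (z \<bullet> b))"

definition char_fun :: "'a measure \<Rightarrow> ('a \<Rightarrow> 'b::euclidean_space) \<Rightarrow> 'b \<Rightarrow> complex" where
  "char_fun M X t = (CLINT \<omega>|M. iexp (t \<bullet> X \<omega>))"

lemma gauss_density_nonneg: "gauss_density z \<ge> 0"
  by (auto simp: gauss_density_def intro!: prod_nonneg)

lemma gauss_density_measurable [measurable]: "gauss_density \<in> borel_measurable borel"
  unfolding gauss_density_def[abs_def] by measurable

lemma norm_power2_sum_Basis: "(norm z)\<^sup>2 = (\<Sum>b\<in>Basis. (z \<bullet> b)\<^sup>2)"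
  by (subst power2_norm_eq_inner, subst euclidean_inner) (simp add: power2_eq_square)

lemma gauss_density_eq:
  "gauss_density (z::'a::euclidean_space) = (1 / sqrt (2 * pi)) ^ DIM('a) * exp (- (norm z)\<^sup>2 / 2)"
proof -
  have "gauss_density z = (1 / sqrt (2 * pi)) ^ DIM('a) * (\<Prod>b\<in>Basis. exp (- (z \<bullet> b)\<^sup>2 / 2))"
    unfolding gauss_density_def std_normal_density_def by (simp only: prod.distrib prod_constant)
  also have "(\<Prod>b\<in>Basis. exp (- (z \<bullet> b)\<^sup>2 / 2)) = exp (- (\<Sum>b\<in>Basis. (z \<bullet> b)\<^sup>2) / 2)"
    by (simp add: exp_sum[symmetric] sum_negf sum_divide_distrib)
  also have "(\<Sum>b\<in>Basis. (z \<bullet> b)\<^sup>2) = (norm z)\<^sup>2"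
    by (rule norm_power2_sum_Basis[symmetric])
  finally show ?thesis .
qed

lemma std_normal_iexp:
  "integrable lborel (\<lambda>x. std_normal_density x *\<^sub>R iexp (t * x))"
  "(\<integral>x. std_normal_density x *\<^sub>R iexp (t * x) \<partial>lborel) = complex_of_real (exp (- t\<^sup>2 / 2))"
proof -
  show "integrable lborel (\<lambda>x. std_normal_density x *\<^sub>R iexp (t * x))"
    by (rule Bochner_Integration.integrable_bound[where f="std_normal_density"]) auto
  have "(\<integral>x. std_normal_density x *\<^sub>R iexp (t * x) \<partial>lborel) = char std_normal_distribution t"
    unfolding char_def by (subst integral_density) auto
  then show "(\<integral>x. std_normal_density x *\<^sub>R iexp (t * x) \<partial>lborel) = complex_of_real (exp (- t\<^sup>2 / 2))"
    by (simp add: char_std_normal_distribution)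
qed

lemma gauss_fourier:
  fixes t :: "'a::euclidean_space"
  shows "integrable lborel (\<lambda>z. gauss_density z *\<^sub>R iexp (t \<bullet> z))"
    and "(\<integral>z. gauss_density z *\<^sub>R iexp (t \<bullet> z) \<partial>lborel) = complex_of_real (exp (- (norm t)\<^sup>2 / 2))"
proof -
  interpret product_sigma_finite "\<lambda>_::'a. lborel :: real measure" ..
  let ?P = "Pi\<^sub>M (Basis::'a set) (\<lambda>_. lborel :: real measure)"
  let ?T = "\<lambda>f. \<Sum>b\<in>(Basis::'a set). f b *\<^sub>R b"
  let ?F = "\<lambda>z::'a. gauss_density z *\<^sub>R iexp (t \<bullet> z)"
  let ?h = "\<lambda>b x. std_normal_density x *\<^sub>R iexp ((t \<bullet> b) * x)"
  have T[measurable]: "?T \<in> measurable ?P borel" by measurable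
  have F[measurable]: "?F \<in> borel_measurable borel" by measurable
  have FT: "?F (?T f) = (\<Prod>b\<in>Basis. ?h b (f b))" for f
  proof -
    have "iexp (t \<bullet> ?T f) = (\<Prod>b\<in>Basis. iexp ((t \<bullet> b) * f b))"
      by (simp add: inner_sum_right sum_distrib_left exp_sum[symmetric] mult_ac)
    moreover have "gauss_density (?T f) = (\<Prod>b\<in>Basis. std_normal_density (f b))"
      unfolding gauss_density_def by (intro prod.cong) (auto simp: inner_sum_left inner_Basis if_distrib sum.If_cases cong: if_cong)
    ultimately show ?thesis by (simp add: scaleR_conv_of_real prod.distrib)
  qed
  have "integrable ?P (\<lambda>f. \<Prod>b\<in>Basis. ?h b (f b))"
    by (intro product_integrable_prod std_normal_iexp finite_Basis)
  then show "integrable lborel ?F"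
    by (subst lborel_eq) (simp add: integrable_distr_eq FT del: scaleR_conv_of_real)
  have "(\<integral>z. ?F z \<partial>lborel) = (\<integral>f. (\<Prod>b\<in>Basis. ?h b (f b)) \<partial>?P)"
    by (subst lborel_eq) (simp add: integral_distr FT)
  also have "\<dots> = (\<Prod>b\<in>Basis. \<integral>x. ?h b x \<partial>lborel)"
    by (intro product_integral_prod std_normal_iexp finite_Basis)
  also have "\<dots> = (\<Prod>b\<in>Basis. complex_of_real (exp (- (t \<bullet> b)\<^sup>2 / 2)))"
    by (simp only: std_normal_iexp)
  also have "\<dots> = complex_of_real (exp (- (\<Sum>b\<in>Basis. (t \<bullet> b)\<^sup>2) / 2))"
    by (simp add: exp_sum[symmetric] sum_negf sum_divide_distrib flip: of_real_prod)
  also have "(\<Sum>b\<in>Basis. (t \<bullet> b)\<^sup>2) = (norm t)\<^sup>2"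
    by (rule norm_power2_sum_Basis[symmetric])
  finally show "(\<integral>z. ?F z \<partial>lborel) = complex_of_real (exp (- (norm t)\<^sup>2 / 2))" .
qed

lemma gauss_density_integral:
  "integrable lborel (gauss_density :: 'a::euclidean_space \<Rightarrow> real)"
  "(\<integral>z. gauss_density (z::'a::euclidean_space) \<partial>lborel) = 1"
proof -
  show i: "integrable lborel (gauss_density :: 'a::euclidean_space \<Rightarrow> real)"
    using integrable_norm[OF gauss_fourier(1)[of "0::'a"]] by (simp add: gauss_density_nonneg)
  have "complex_of_real (\<integral>z. gauss_density (z::'a) \<partial>lborel) = 1"
    using gauss_fourier(2)[of "0::'a"] by (simp add: scaleR_conv_of_real)
  then show "(\<integral>z. gauss_density (z::'a) \<partial>lborel) = 1" by simp
qed

text \<open>The left-hand side is the density at \<open>y\<close> of \<open>X\<close> plus independent standard normal noise. Since the Gaussian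
  is its own Fourier transform up to a constant, Fubini's theorem expresses this density by the
  characteristic function of \<open>X\<close>.\<close>

lemma gauss_smoothed_density:
  fixes X :: "'a \<Rightarrow> 'b::euclidean_space"
  assumes M: "prob_space M" and X[measurable]: "X \<in> borel_measurable M"
  shows "complex_of_real (\<integral>\<omega>. gauss_density (y - X \<omega>) \<partial>M) =
    complex_of_real ((1 / sqrt (2 * pi)) ^ DIM('b)) *
      (\<integral>t. (gauss_density t *\<^sub>R iexp (t \<bullet> y)) * char_fun M X (- t) \<partial>lborel)"
proof -
  interpret M: prob_space M by fact
  interpret P: pair_sigma_finite M "lborel :: 'b measure" ..
  let ?c = "(1 / sqrt (2 * pi)) ^ DIM('b)"
  let ?G = "\<lambda>\<omega> t. gauss_density t *\<^sub>R iexp (t \<bullet> (y - X \<omega>))"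
  have nG: "norm (?G \<omega> t) = gauss_density t" for \<omega> t by (simp add: gauss_density_nonneg)
  have "integrable (M \<Otimes>\<^sub>M lborel) (\<lambda>(\<omega>, t). ?G \<omega> t)"
  proof (rule P.Fubini_integrable)
    show "(\<lambda>(\<omega>, t). ?G \<omega> t) \<in> borel_measurable (M \<Otimes>\<^sub>M lborel)" by measurable
    show "integrable M (\<lambda>\<omega>. \<integral>t. norm (case (\<omega>, t) of (\<omega>, t) \<Rightarrow> ?G \<omega> t) \<partial>lborel)"
      unfolding split nG by simp
    show "AE \<omega> in M. integrable lborel (\<lambda>t. case (\<omega>, t) of (\<omega>, t) \<Rightarrow> ?G \<omega> t)"
      using gauss_fourier(1)[of "y - X _"] by (simp add: inner_commute)
  qed
  from P.Fubini_integral[OF this]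
  have fub: "(CLINT \<omega>|M. \<integral>t. ?G \<omega> t \<partial>lborel) = (\<integral>t. (CLINT \<omega>|M. ?G \<omega> t) \<partial>lborel)" by simp
  have "complex_of_real (\<integral>\<omega>. gauss_density (y - X \<omega>) \<partial>M) = (CLINT \<omega>|M. complex_of_real (gauss_density (y - X \<omega>)))"
    by simp
  also have "\<dots> = (CLINT \<omega>|M. complex_of_real ?c * (\<integral>t. ?G \<omega> t \<partial>lborel))"
    using gauss_fourier(2)[of "y - X _"]
    by (intro Bochner_Integration.integral_cong refl) (simp add: gauss_density_eq inner_commute)
  also have "\<dots> = complex_of_real ?c * (\<integral>t. (CLINT \<omega>|M. ?G \<omega> t) \<partial>lborel)"
    by (simp add: fub)
  also have "(\<lambda>t. CLINT \<omega>|M. ?G \<omega> t) = (\<lambda>t. (gauss_density t *\<^sub>R iexp (t \<bullet> y)) * char_fun M X (- t))"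
  proof
    fix t
    have "?G \<omega> t = (gauss_density t *\<^sub>R iexp (t \<bullet> y)) * iexp (- t \<bullet> X \<omega>)" for \<omega>
      by (simp add: inner_diff_right exp_add[symmetric] algebra_simps)
    then show "(CLINT \<omega>|M. ?G \<omega> t) = (gauss_density t *\<^sub>R iexp (t \<bullet> y)) * char_fun M X (- t)"
      unfolding char_fun_def by (simp only: integral_mult_right_zero)
  qed
  finally show ?thesis .
qed

lemma char_fun_bound:
  assumes "prob_space M" and [measurable]: "X \<in> borel_measurable M"
  shows "norm (char_fun M X t) \<le> 1"
proof -
  interpret M: prob_space M by fact
  have "norm (char_fun M X t) \<le> (\<integral>\<omega>. norm (iexp (t \<bullet> X \<omega>)) \<partial>M)"
    unfolding char_fun_def by (rule integral_norm_bound)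
  also have "\<dots> = 1" by (simp add: M.prob_space)
  finally show ?thesis .
qed

lemma char_fun_scaleR: "char_fun P (\<lambda>\<omega>. c *\<^sub>R Y \<omega>) t = char_fun P Y (c *\<^sub>R t)"
  by (simp add: char_fun_def)

lemma char_fun_measurable:
  assumes "prob_space M" and [measurable]: "X \<in> borel_measurable M"
  shows "char_fun M X \<in> borel_measurable borel"
proof -
  interpret M: prob_space M by fact
  show ?thesis unfolding char_fun_def[abs_def] by measurable
qed

text \<open>The Gaussian weight dominates the integrand in the Fourier representation.\<close>

lemma gauss_smoothed_density_tendsto:
  fixes X :: "nat \<Rightarrow> 'a \<Rightarrow> 'c::euclidean_space"
  assumes M: "prob_space M" and N: "prob_space N"
    and X: "\<And>n. X n \<in> borel_measurable M" and Z: "Z \<in> borel_measurable N"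
    and conv: "\<And>t. (\<lambda>n. char_fun M (X n) t) \<longlonglongrightarrow> char_fun N Z t"
  shows "(\<lambda>n. \<integral>\<omega>. gauss_density (y - X n \<omega>) \<partial>M) \<longlonglongrightarrow> (\<integral>\<omega>. gauss_density (y - Z \<omega>) \<partial>N)"
proof -
  note [measurable] = char_fun_measurable[OF M X] char_fun_measurable[OF N Z]
  have "(\<lambda>n. complex_of_real (\<integral>\<omega>. gauss_density (y - X n \<omega>) \<partial>M)) \<longlonglongrightarrow>
      complex_of_real (\<integral>\<omega>. gauss_density (y - Z \<omega>) \<partial>N)"
    unfolding gauss_smoothed_density[OF M X] gauss_smoothed_density[OF N Z]
  proof (intro tendsto_mult tendsto_const integral_dominated_convergence[where w=gauss_density])
    show "AE t in lborel. (\<lambda>n. gauss_density t *\<^sub>R iexp (t \<bullet> y) * char_fun M (X n) (- t))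
        \<longlonglongrightarrow> gauss_density t *\<^sub>R iexp (t \<bullet> y) * char_fun N Z (- t)"
      by (intro AE_I2 tendsto_mult tendsto_const conv)
    show "AE t in lborel. norm (gauss_density t *\<^sub>R iexp (t \<bullet> y) * char_fun M (X n) (- t)) \<le> gauss_density t" for n
      using char_fun_bound[OF M X] by (auto simp: norm_mult gauss_density_nonneg intro!: mult_left_le)
  qed (auto intro: gauss_density_integral)
  then show ?thesis by (simp only: tendsto_of_real_iff)
qed

lemma integral_gauss_translate:
  fixes f :: "'c::euclidean_space \<Rightarrow> real"
  assumes [measurable]: "f \<in> borel_measurable borel"
  shows "(\<integral>z. f (x + z) * gauss_density z \<partial>lborel) = (\<integral>y. f y * gauss_density (y - x) \<partial>lborel)"
proof -
  have "(\<integral>y. f y * gauss_density (y - x) \<partial>lborel) = (\<integral>y. f y * gauss_density (y - x) \<partial>distr lborel borel ((+) x))"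
    by (simp add: lborel_distr_plus)
  also have "\<dots> = (\<integral>z. f (x + z) * gauss_density z \<partial>lborel)"
    by (subst integral_distr) auto
  finally show ?thesis by simp
qed

text \<open>\<open>d\<close> is the Lebesgue density of \<open>X\<close> plus independent standard normal noise.\<close>

lemma smoothed_density:
  fixes X :: "'a \<Rightarrow> 'c::euclidean_space" and f :: "'c \<Rightarrow> real"
  assumes M: "prob_space M" and X[measurable]: "X \<in> borel_measurable M"
  defines "d \<equiv> \<lambda>y. \<integral>\<omega>. gauss_density (y - X \<omega>) \<partial>M"
  shows "d y \<ge> 0" and "d \<in> borel_measurable borel"
    and "integrable lborel d" and "(\<integral>y. d y \<partial>lborel) = 1"
    and "f \<in> borel_measurable borel \<Longrightarrow> (\<And>y. \<bar>f y\<bar> \<le> B) \<Longrightarrow>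
      (\<integral>\<omega>. (\<integral>z. f (X \<omega> + z) * gauss_density z \<partial>lborel) \<partial>M) = (\<integral>y. f y * d y \<partial>lborel)"
proof -
  interpret M: prob_space M by fact
  interpret P: pair_sigma_finite M "lborel :: 'c measure" ..
  have gt: "integrable lborel (\<lambda>y. gauss_density (y - x))" "(\<integral>y. gauss_density (y - x) \<partial>lborel) = 1" for x :: 'c
  proof -
    have "integrable (distr lborel borel ((+) x)) (\<lambda>y. gauss_density (y - x))"
      by (subst integrable_distr_eq) (auto intro: gauss_density_integral)
    then show "integrable lborel (\<lambda>y. gauss_density (y - x))" by (simp add: lborel_distr_plus)
    show "(\<integral>y. gauss_density (y - x) \<partial>lborel) = 1"
      using integral_gauss_translate[of "\<lambda>_. 1" x, symmetric] gauss_density_integral(2)[where 'a='c] by simp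
  qed
  have int: "integrable (M \<Otimes>\<^sub>M lborel) (\<lambda>(\<omega>, y). f y * gauss_density (y - X \<omega>))"
    if [measurable]: "f \<in> borel_measurable borel" and f: "\<And>y. \<bar>f y\<bar> \<le> B" for f :: "'c \<Rightarrow> real" and B
  proof (rule Bochner_Integration.integrable_bound)
    show "integrable (M \<Otimes>\<^sub>M lborel) (\<lambda>(\<omega>, y). B * gauss_density (y - X \<omega>))"
    proof (rule P.Fubini_integrable)
      show "(\<lambda>(\<omega>, y). B * gauss_density (y - X \<omega>)) \<in> borel_measurable (M \<Otimes>\<^sub>M lborel)" by measurable
      show "integrable M (\<lambda>\<omega>. \<integral>y. norm (case (\<omega>, y) of (\<omega>, y) \<Rightarrow> B * gauss_density (y - X \<omega>)) \<partial>lborel)"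
        by (simp add: abs_mult gauss_density_nonneg gt)
    qed (simp add: gt)
    show "(\<lambda>(\<omega>, y). f y * gauss_density (y - X \<omega>)) \<in> borel_measurable (M \<Otimes>\<^sub>M lborel)" by measurable
    have "B \<ge> 0" using f[of 0] by linarith
    then show "AE p in M \<Otimes>\<^sub>M lborel. norm (case p of (\<omega>, y) \<Rightarrow> f y * gauss_density (y - X \<omega>))
        \<le> norm (case p of (\<omega>, y) \<Rightarrow> B * gauss_density (y - X \<omega>))"
      using f by (intro AE_I2) (auto simp: split_beta abs_mult gauss_density_nonneg intro!: mult_right_mono)
  qed
  have fub: "(\<integral>\<omega>. (\<integral>z. f (X \<omega> + z) * gauss_density z \<partial>lborel) \<partial>M) = (\<integral>y. f y * d y \<partial>lborel)"
    "integrable lborel (\<lambda>y. f y * d y)"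
    if f[measurable]: "f \<in> borel_measurable borel" and B: "\<And>y. \<bar>f y\<bar> \<le> B" for f :: "'c \<Rightarrow> real" and B
  proof -
    note i = int[OF f B]
    show "(\<integral>\<omega>. (\<integral>z. f (X \<omega> + z) * gauss_density z \<partial>lborel) \<partial>M) = (\<integral>y. f y * d y \<partial>lborel)"
      unfolding integral_gauss_translate[OF f] using P.Fubini_integral[OF i] by (simp add: d_def)
    show "integrable lborel (\<lambda>y. f y * d y)"
      using P.integrable_snd[OF i] by (simp add: d_def)
  qed
  show "d y \<ge> 0" unfolding d_def by (simp add: gauss_density_nonneg)
  show "d \<in> borel_measurable borel" unfolding d_def by measurable
  show "integrable lborel d" using fub(2)[of "\<lambda>_. 1" 1] by simp
  show "(\<integral>y. d y \<partial>lborel) = 1"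
    using fub(1)[of "\<lambda>_. 1" 1] by (simp add: gauss_density_integral M.prob_space)
  show "f \<in> borel_measurable borel \<Longrightarrow> (\<And>y. \<bar>f y\<bar> \<le> B) \<Longrightarrow>
      (\<integral>\<omega>. (\<integral>z. f (X \<omega> + z) * gauss_density z \<partial>lborel) \<partial>M) = (\<integral>y. f y * d y \<partial>lborel)"
    by (rule fub(1))
qed

text \<open>Pointwise convergence of probability densities is convergence in mean by Scheffe's lemma. Hence the
  expectations converge for every bounded measurable function, and no tightness has to be shown.\<close>

lemma smoothed_expectation_tendsto:
  fixes X :: "nat \<Rightarrow> 'a \<Rightarrow> 'c::euclidean_space" and f :: "'c \<Rightarrow> real"
  assumes M: "prob_space M" and N: "prob_space N"
    and X: "\<And>n. X n \<in> borel_measurable M" and Z: "Z \<in> borel_measurable N"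
    and conv: "\<And>t. (\<lambda>n. char_fun M (X n) t) \<longlonglongrightarrow> char_fun N Z t"
    and f[measurable]: "f \<in> borel_measurable borel" and B: "\<And>y. \<bar>f y\<bar> \<le> B"
  shows "(\<lambda>n. \<integral>\<omega>. (\<integral>z. f (X n \<omega> + z) * gauss_density z \<partial>lborel) \<partial>M) \<longlonglongrightarrow>
    (\<integral>\<omega>. (\<integral>z. f (Z \<omega> + z) * gauss_density z \<partial>lborel) \<partial>N)"
proof -
  define d where "d n y = (\<integral>\<omega>. gauss_density (y - X n \<omega>) \<partial>M)" for n y
  define d0 where "d0 y = (\<integral>\<omega>. gauss_density (y - Z \<omega>) \<partial>N)" for y
  note d = smoothed_density[OF M X, folded d_def] and d0 = smoothed_density[OF N Z, folded d0_def]
  note [measurable] = d(2) d0(2)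
  have "(\<lambda>n. \<integral>\<^sup>+ y. ennreal (norm (d n y - d0 y)) \<partial>lborel) \<longlonglongrightarrow> 0"
  proof (rule Scheffe_lemma2)
    show "AE y in lborel. (\<lambda>n. d n y) \<longlonglongrightarrow> d0 y"
      unfolding d_def d0_def by (intro AE_I2 gauss_smoothed_density_tendsto[OF M N X Z conv])
    show "(\<integral>\<^sup>+ y. ennreal (norm (d n y)) \<partial>lborel) \<le> (\<integral>\<^sup>+ y. ennreal (norm (d0 y)) \<partial>lborel)" for n
      using d0(1) d(1) by (simp add: nn_integral_eq_integral d d0)
  qed (auto simp: d0)
  moreover have "(\<integral>\<^sup>+ y. ennreal (norm (d n y - d0 y)) \<partial>lborel) = ennreal (\<integral>y. \<bar>d n y - d0 y\<bar> \<partial>lborel)" for n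
    by (subst nn_integral_eq_integral) (auto simp: d d0)
  ultimately have L1: "(\<lambda>n. \<integral>y. \<bar>d n y - d0 y\<bar> \<partial>lborel) \<longlonglongrightarrow> 0"
    by (simp add: tendsto_ennreal_iff flip: ennreal_0)
  have fi: "integrable lborel (\<lambda>y. f y * e y)" if "integrable lborel e" for e
  proof (rule Bochner_Integration.integrable_bound[where f="\<lambda>y. B * e y"])
    show "(\<lambda>y. f y * e y) \<in> borel_measurable lborel" using borel_measurable_integrable[OF that] by measurable
    show "AE y in lborel. norm (f y * e y) \<le> norm (B * e y)"
      using B by (auto simp: abs_mult intro!: AE_I2 mult_right_mono order_trans[OF B])
  qed (use that in auto)
  have "(\<lambda>n. (\<integral>y. f y * d n y \<partial>lborel) - (\<integral>y. f y * d0 y \<partial>lborel)) \<longlonglongrightarrow> 0"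
  proof (rule Lim_null_comparison[OF _ tendsto_mult_right_zero[OF L1, of B]], intro always_eventually allI)
    fix n
    have "norm ((\<integral>y. f y * d n y \<partial>lborel) - (\<integral>y. f y * d0 y \<partial>lborel)) = norm (\<integral>y. f y * (d n y - d0 y) \<partial>lborel)"
      by (subst Bochner_Integration.integral_diff[symmetric]) (auto simp: fi d d0 right_diff_distrib)
    also have "\<dots> \<le> (\<integral>y. norm (f y * (d n y - d0 y)) \<partial>lborel)" by (rule integral_norm_bound)
    also have "\<dots> \<le> (\<integral>y. B * \<bar>d n y - d0 y\<bar> \<partial>lborel)"
      using B by (intro integral_mono integrable_norm fi) (auto simp: abs_mult d d0 intro!: mult_right_mono)
    finally show "norm ((\<integral>y. f y * d n y \<partial>lborel) - (\<integral>y. f y * d0 y \<partial>lborel)) \<le> B * (\<integral>y. \<bar>d n y - d0 y\<bar> \<partial>lborel)"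
      by simp
  qed
  then show ?thesis
    unfolding d(5)[OF f B] d0(5)[OF f B] by (simp add: LIM_zero_iff)
qed

lemma smoothing_error_tendsto_0:
  "((\<lambda>n. \<integral>z. min (2 * B) (K * (1 / real (Suc n)) * norm (z::'c::euclidean_space)) * gauss_density z \<partial>lborel) \<longlongrightarrow> 0) sequentially"
  if "B \<ge> 0" "K \<ge> 0"
proof -
  have "(\<lambda>n. \<integral>z. min (2 * B) (K * (1 / real (Suc n)) * norm (z::'c)) * gauss_density z \<partial>lborel) \<longlonglongrightarrow>
     integral\<^sup>L (lborel :: 'c measure) (\<lambda>_. 0)"
  proof (rule integral_dominated_convergence[where w="\<lambda>z. 2 * B * gauss_density z"])
    show "AE z in lborel. (\<lambda>n. min (2 * B) (K * (1 / real (Suc n)) * norm (z::'c)) * gauss_density z) \<longlonglongrightarrow> 0"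
    proof (rule AE_I2)
      fix z :: 'c
      have "(\<lambda>n. K * (1 / real (Suc n)) * norm z) \<longlonglongrightarrow> K * 0 * norm z"
        by (intro tendsto_intros LIMSEQ_Suc lim_1_over_n)
      from tendsto_mult[OF tendsto_min[OF tendsto_const[of "2*B"] this] tendsto_const[of "gauss_density z"]]
      show "(\<lambda>n. min (2 * B) (K * (1 / real (Suc n)) * norm z) * gauss_density z) \<longlonglongrightarrow> 0"
        using that by (simp add: min_absorb2)
    qed
    show "AE z in lborel. norm (min (2 * B) (K * (1 / real (Suc n)) * norm (z::'c)) * gauss_density z) \<le> 2 * B * gauss_density z" for n
    proof (rule AE_I2)
      fix z :: 'c
      have "0 \<le> min (2 * B) (K * (1 / real (Suc n)) * norm z)" using that by simp
      then show "norm (min (2 * B) (K * (1 / real (Suc n)) * norm z) * gauss_density z) \<le> 2 * B * gauss_density z"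
        by (simp add: abs_mult gauss_density_nonneg mult_right_mono del: min_less_iff_conj min.bounded_iff)
    qed
  qed (use that gauss_density_integral in auto)
  then show ?thesis by simp
qed

text \<open>The bound does not depend on \<open>x\<close>, so the error of smoothing is uniform over all laws.\<close>

lemma smoothing_error:
  fixes f :: "'c::euclidean_space \<Rightarrow> real"
  assumes f: "K-lipschitz_on UNIV f" and B: "\<And>y. \<bar>f y\<bar> \<le> B" and d: "\<delta> \<ge> 0"
  shows "\<bar>(\<integral>z. f (x + \<delta> *\<^sub>R z) * gauss_density z \<partial>lborel) - f x\<bar> \<le>
    (\<integral>z. min (2 * B) (K * \<delta> * norm z) * gauss_density (z::'c) \<partial>lborel)"
proof -
  have [measurable]: "f \<in> borel_measurable borel"
    by (rule borel_measurable_continuous_onI[OF lipschitz_on_continuous_on[OF f]])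
  have K: "K \<ge> 0" using f by (rule lipschitz_on_nonneg)
  have B0: "B \<ge> 0" using B[of 0] by linarith
  have i: "integrable lborel (\<lambda>z. f (x + \<delta> *\<^sub>R z) * gauss_density z)"
    by (rule Bochner_Integration.integrable_bound[where f="\<lambda>y. B * gauss_density y"])
       (use B B0 gauss_density_integral in \<open>auto simp: abs_mult gauss_density_nonneg intro!: mult_right_mono\<close>)
  have i2: "integrable lborel (\<lambda>z. min (2 * B) (K * \<delta> * norm z) * gauss_density (z::'c))"
  proof (rule Bochner_Integration.integrable_bound[where f="\<lambda>y. 2 * B * gauss_density y"])
    show "AE z in lborel. norm (min (2 * B) (K * \<delta> * norm z) * gauss_density (z::'c)) \<le> norm (2 * B * gauss_density z)"
    proof (rule AE_I2)
      fix z :: 'c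
      have "0 \<le> min (2 * B) (K * \<delta> * norm z)" using B0 K d by simp
      then show "norm (min (2 * B) (K * \<delta> * norm z) * gauss_density z) \<le> norm (2 * B * gauss_density z)"
        using B0 by (simp add: abs_mult gauss_density_nonneg mult_right_mono del: min_less_iff_conj min.bounded_iff)
    qed
  qed (use gauss_density_integral in auto)
  have "(\<integral>z. f (x + \<delta> *\<^sub>R z) * gauss_density z \<partial>lborel) - f x =
      (\<integral>z. f (x + \<delta> *\<^sub>R z) * gauss_density z \<partial>lborel) - (\<integral>z. f x * gauss_density (z::'c) \<partial>lborel)"
    by (simp add: gauss_density_integral)
  also have "\<dots> = (\<integral>z. (f (x + \<delta> *\<^sub>R z) - f x) * gauss_density z \<partial>lborel)"
    by (subst Bochner_Integration.integral_diff[symmetric]) (use i gauss_density_integral(1)[where 'a='c] in \<open>auto simp: left_diff_distrib\<close>)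
  also have "\<bar>\<dots>\<bar> \<le> (\<integral>z. \<bar>(f (x + \<delta> *\<^sub>R z) - f x) * gauss_density z\<bar> \<partial>lborel)"
    by (rule integral_abs_bound)
  also have "\<dots> \<le> (\<integral>z. min (2 * B) (K * \<delta> * norm z) * gauss_density (z::'c) \<partial>lborel)"
  proof (rule integral_mono)
    show "integrable lborel (\<lambda>z. \<bar>(f (x + \<delta> *\<^sub>R z) - f x) * gauss_density z\<bar>)"
      using i gauss_density_integral(1)[where 'a='c] by (auto simp: left_diff_distrib)
    show "\<bar>(f (x + \<delta> *\<^sub>R z) - f x) * gauss_density z\<bar> \<le> min (2 * B) (K * \<delta> * norm z) * gauss_density z" for z
    proof -
      have "\<bar>f (x + \<delta> *\<^sub>R z) - f x\<bar> \<le> K * \<delta> * norm z"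
        using lipschitz_onD[OF f, of "x + \<delta> *\<^sub>R z" x] d by (simp add: dist_norm mult.assoc)
      moreover have "\<bar>f (x + \<delta> *\<^sub>R z) - f x\<bar> \<le> 2 * B" using B[of x] B[of "x + \<delta> *\<^sub>R z"] by linarith
      ultimately show ?thesis by (simp add: abs_mult gauss_density_nonneg mult_right_mono)
    qed
  qed (rule i2)
  finally show ?thesis .
qed

lemma expectation_diff_le:
  fixes f g :: "'a \<Rightarrow> real"
  assumes P: "prob_space P" and [measurable]: "f \<in> borel_measurable P" "g \<in> borel_measurable P"
    and bd: "\<And>\<omega>. \<bar>f \<omega>\<bar> \<le> B" "\<And>\<omega>. \<bar>g \<omega>\<bar> \<le> C" and le: "\<And>\<omega>. \<bar>f \<omega> - g \<omega>\<bar> \<le> r"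
  shows "\<bar>integral\<^sup>L P f - integral\<^sup>L P g\<bar> \<le> r"
proof -
  interpret P: prob_space P by fact
  have i: "integrable P f" "integrable P g"
    by (rule bounded_integrable[OF P _ bd(1)], measurable, rule bounded_integrable[OF P _ bd(2)], measurable)
  then have "\<bar>integral\<^sup>L P f - integral\<^sup>L P g\<bar> = \<bar>\<integral>\<omega>. f \<omega> - g \<omega> \<partial>P\<bar>" by simp
  also have "\<dots> \<le> (\<integral>\<omega>. \<bar>f \<omega> - g \<omega>\<bar> \<partial>P)" by (rule integral_abs_bound)
  also have "\<dots> \<le> (\<integral>\<omega>. r \<partial>P)" using i le by (intro integral_mono) auto
  finally show ?thesis by (simp add: P.prob_space)
qed

text \<open>Noise of size \<open>1 / (k + 1)\<close> changes the expectation of a bounded Lipschitz function by an amount that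
  is small uniformly in \<open>n\<close>, and the expectations with noise converge.\<close>

theorem levy_continuity_euclidean:
  fixes X :: "nat \<Rightarrow> 'a \<Rightarrow> 'c::euclidean_space"
  assumes M: "prob_space M" and N: "prob_space N"
    and X[measurable]: "\<And>n. X n \<in> borel_measurable M" and Z[measurable]: "Z \<in> borel_measurable N"
    and conv: "\<And>t. (\<lambda>n. char_fun M (X n) t) \<longlonglongrightarrow> char_fun N Z t"
  shows "converges_in_distribution M X N Z"
proof (rule converges_in_distributionI_lipschitz[OF M N _ Z])
  interpret M: prob_space M by fact
  interpret N: prob_space N by fact
  show "\<forall>\<^sub>F n in sequentially. X n \<in> borel_measurable M" by (simp add: X)
  fix f :: "'c \<Rightarrow> real" and K assume f: "K-lipschitz_on UNIV f" and "bounded (range f)"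
  then obtain B where B: "\<And>y. \<bar>f y\<bar> \<le> B" by (auto simp: bounded_iff)
  have K: "K \<ge> 0" using f by (rule lipschitz_on_nonneg)
  have B0: "B \<ge> 0" using B[of 0] by linarith
  have fm[measurable]: "f \<in> borel_measurable borel"
    by (rule borel_measurable_continuous_onI[OF lipschitz_on_continuous_on[OF f]])
  define h where "h k x = (\<integral>z. f (x + (1 / real (Suc k)) *\<^sub>R z) * gauss_density z \<partial>lborel)" for k x
  define \<rho> where "\<rho> k = (\<integral>z. min (2 * B) (K * (1 / real (Suc k)) * norm (z::'c)) * gauss_density z \<partial>lborel)" for k
  have hm[measurable]: "h k \<in> borel_measurable borel" for k
    unfolding h_def[abs_def] by measurable
  have err: "\<bar>h k x - f x\<bar> \<le> \<rho> k" for k x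
    unfolding h_def \<rho>_def using smoothing_error[OF f B, of "1 / real (Suc k)"] by simp
  have \<rho>: "\<rho> \<longlonglongrightarrow> 0"
    unfolding \<rho>_def[abs_def] by (rule smoothing_error_tendsto_0[OF B0 K])
  have hB: "\<bar>h k x\<bar> \<le> B + \<rho> k" for k x using err[of k x] B[of x] by linarith
  have hconv: "(\<lambda>n. \<integral>\<omega>. h k (X n \<omega>) \<partial>M) \<longlonglongrightarrow> (\<integral>\<omega>. h k (Z \<omega>) \<partial>N)" for k
  proof -
    let ?s = "real (Suc k)"
    (* noise of size 1 / ?s on X is unit noise on ?s X *)
    have eq: "h k x = (\<integral>z. f ((1 / ?s) *\<^sub>R (?s *\<^sub>R x + z)) * gauss_density z \<partial>lborel)" for x
      unfolding h_def by (simp add: scaleR_right_distrib del: of_nat_Suc)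
    show ?thesis unfolding eq
      by (rule smoothed_expectation_tendsto[OF M N, where B=B and f="\<lambda>y. f ((1 / ?s) *\<^sub>R y)"])
         (use B conv in \<open>auto simp: char_fun_scaleR simp del: of_nat_Suc\<close>)
  qed
  show "(\<lambda>n. \<integral>\<omega>. f (X n \<omega>) \<partial>M) \<longlonglongrightarrow> (\<integral>\<omega>. f (Z \<omega>) \<partial>N)"
  proof (rule LIMSEQ_I)
    fix e :: real assume e: "e > 0"
    then have "e / 3 > 0" by simp
    from order_tendstoD(2)[OF \<rho> this] obtain k where k: "\<rho> k < e / 3"
      by (auto simp: eventually_sequentially)
    have closeM: "\<bar>(\<integral>\<omega>. h k (X n \<omega>) \<partial>M) - (\<integral>\<omega>. f (X n \<omega>) \<partial>M)\<bar> \<le> \<rho> k" for n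
      by (rule expectation_diff_le[where f="\<lambda>\<omega>. h k (X n \<omega>)" and g="\<lambda>\<omega>. f (X n \<omega>)", OF M _ _ hB B err]) measurable
    have closeN: "\<bar>(\<integral>\<omega>. h k (Z \<omega>) \<partial>N) - (\<integral>\<omega>. f (Z \<omega>) \<partial>N)\<bar> \<le> \<rho> k"
      by (rule expectation_diff_le[where f="\<lambda>\<omega>. h k (Z \<omega>)" and g="\<lambda>\<omega>. f (Z \<omega>)", OF N _ _ hB B err]) measurable
    from LIMSEQ_D[OF hconv[of k] \<open>e/3 > 0\<close>] obtain n0 where
      n0: "\<And>n. n \<ge> n0 \<Longrightarrow> \<bar>(\<integral>\<omega>. h k (X n \<omega>) \<partial>M) - (\<integral>\<omega>. h k (Z \<omega>) \<partial>N)\<bar> < e / 3" by auto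
    have "\<bar>(\<integral>\<omega>. f (X n \<omega>) \<partial>M) - (\<integral>\<omega>. f (Z \<omega>) \<partial>N)\<bar> < e" if "n \<ge> n0" for n
      using n0[OF that] closeM[of n] closeN k by linarith
    then show "\<exists>no. \<forall>n\<ge>no. norm ((\<integral>\<omega>. f (X n \<omega>) \<partial>M) - (\<integral>\<omega>. f (Z \<omega>) \<partial>N)) < e" by auto
  qed
qed

text \<open>The indicator of a nonempty closed set \<open>F\<close> is the limit of the continuous functions
  \<open>max 0 (1 - n dist(\<cdot>, F))\<close>, and closed sets generate the Borel sets.\<close>

lemma measure_eqI_bounded_continuous:
  fixes P Q :: "'c::metric_space measure"
  assumes P: "prob_space P" and Q: "prob_space Q" and sP: "sets P = sets borel" and sQ: "sets Q = sets borel"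
    and eq: "\<And>f :: 'c \<Rightarrow> real. continuous_on UNIV f \<Longrightarrow> bounded (range f) \<Longrightarrow> integral\<^sup>L P f = integral\<^sup>L Q f"
  shows "P = Q"
proof -
  interpret P: prob_space P by fact
  interpret Q: prob_space Q by fact
  have closed: "measure P F = measure Q F" if F: "closed F" for F :: "'c set"
  proof (cases "F = {}")
    case False
    define g where "g n y = max 0 (1 - real n * infdist y F)" for n y
    have g_cont: "continuous_on UNIV (g n)" for n unfolding g_def[abs_def] by (intro continuous_intros)
    have g_bd: "0 \<le> g n y" "g n y \<le> 1" for n y
      unfolding g_def by (auto simp: infdist_nonneg)
    have lim: "(\<lambda>n. integral\<^sup>L R (g n)) \<longlonglongrightarrow> measure R F" if R: "prob_space R" "sets R = sets borel" for R
    proof -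
      interpret R: prob_space R by fact
      have [measurable_cong]: "sets R = sets borel" by fact
      have [measurable]: "g n \<in> borel_measurable borel" for n
        by (rule borel_measurable_continuous_onI[OF g_cont])
      have [measurable]: "F \<in> sets borel" using F by simp
      have "(\<lambda>n. integral\<^sup>L R (g n)) \<longlonglongrightarrow> (\<integral>y. indicator F y \<partial>R)"
      proof (rule integral_dominated_convergence[where w="\<lambda>_. 1"])
        show "AE y in R. (\<lambda>n. g n y) \<longlonglongrightarrow> indicator F y"
        proof (rule AE_I2)
          fix y
          show "(\<lambda>n. g n y) \<longlonglongrightarrow> indicator F y"
          proof (cases "y \<in> F")
            case True then show ?thesis by (simp add: g_def)
          next
            case no: False
            then have d: "infdist y F > 0"
              using in_closed_iff_infdist_zero[OF F False, of y] infdist_nonneg[of y F] by simp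
            then obtain n0 :: nat where n0: "1 < real n0 * infdist y F" using reals_Archimedean3[OF d, THEN spec, of 1] by auto
            have "g n y = 0" if "n \<ge> n0" for n
            proof -
              have "real n0 * infdist y F \<le> real n * infdist y F" using that d by (intro mult_right_mono) auto
              with n0 have "1 - real n * infdist y F \<le> 0" by linarith
              then show ?thesis unfolding g_def by (rule max_absorb1)
            qed
            then have "\<forall>\<^sub>F n in sequentially. g n y = 0" by (auto simp: eventually_sequentially)
            then show ?thesis using no by (simp add: tendsto_eventually)
          qed
        qed
      qed (use g_bd in \<open>auto simp: abs_le_iff\<close>)
      also have "(\<integral>y. indicator F y \<partial>R) = measure R F" by simp
      finally show ?thesis .
    qed
    have "integral\<^sup>L P (g n) = integral\<^sup>L Q (g n)" for n
      using g_bd by (intro eq[OF g_cont] boundedI[of _ 1]) auto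
    then have "(\<lambda>n. integral\<^sup>L P (g n)) \<longlonglongrightarrow> measure Q F" using lim[OF Q sQ] by simp
    then show ?thesis by (rule LIMSEQ_unique[OF lim[OF P sP]])
  qed simp
  show ?thesis
  proof (rule measure_eqI_generator_eq[where E="Collect closed" and \<Omega>=UNIV and A="\<lambda>_. UNIV"])
    show "Int_stable (Collect closed)" by (auto simp: Int_stable_def)
    show "emeasure P F = emeasure Q F" if "F \<in> Collect closed" for F
      using closed[of F] that by (simp add: P.emeasure_eq_measure Q.emeasure_eq_measure)
    have "sets (borel :: 'c measure) = sigma_sets UNIV (Collect closed)"
      by (subst borel_eq_closed) simp
    then show "sets P = sigma_sets UNIV (Collect closed)" "sets Q = sigma_sets UNIV (Collect closed)"
      unfolding sP sQ by this+
  qed auto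
qed

text \<open>The continuity theorem for a constant sequence shows that the two laws have the same integrals of bounded
  continuous functions.\<close>

theorem char_fun_unique:
  fixes X :: "'a \<Rightarrow> 'c::euclidean_space" and Y :: "'b \<Rightarrow> 'c"
  assumes M: "prob_space M" and N: "prob_space N"
    and X[measurable]: "X \<in> borel_measurable M" and Y[measurable]: "Y \<in> borel_measurable N"
    and eq: "\<And>t. char_fun M X t = char_fun N Y t"
  shows "distr M borel X = distr N borel Y"
proof (rule measure_eqI_bounded_continuous)
  interpret M: prob_space M by fact
  interpret N: prob_space N by fact
  show "prob_space (distr M borel X)" "prob_space (distr N borel Y)"
    by (auto intro: M.prob_space_distr N.prob_space_distr)
  fix f :: "'c \<Rightarrow> real" assume f: "continuous_on UNIV f" "bounded (range f)"
  have [measurable]: "f \<in> borel_measurable borel" by (rule borel_measurable_continuous_onI) fact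
  have "converges_in_distribution M (\<lambda>_. X) N Y"
    by (rule levy_continuity_euclidean[OF M N]) (auto simp: eq)
  then have "(\<lambda>n::nat. \<integral>\<omega>. f (X \<omega>) \<partial>M) \<longlonglongrightarrow> (\<integral>\<omega>. f (Y \<omega>) \<partial>N)"
    using f unfolding converges_in_distribution_def by blast
  then show "integral\<^sup>L (distr M borel X) f = integral\<^sup>L (distr N borel Y) f"
    by (simp add: integral_distr LIMSEQ_const_iff)
qed simp_all

section \<open>Limit theorems for sums of independent errors\<close>

lemma exp_minus_linear_error: "\<bar>exp (- u) - (1 - u)\<bar> \<le> u\<^sup>2" if "u \<ge> 0" for u :: real
proof -
  have "exp (- u) \<le> 1 / (1 + u)"
    using exp_ge_add_one_self[of u] that by (simp add: exp_minus inverse_eq_divide frac_le)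
  also have "\<dots> \<le> 1 - u + u\<^sup>2"
    using that by (simp add: field_simps power2_eq_square)
  finally show ?thesis using exp_ge_add_one_self[of "-u"] by (auto simp: abs_le_iff)
qed

text \<open>Lindeberg's theorem for weighted sums. The characteristic function of the sum is the product of
  \<open>\<phi> (a n i)\<close>; replacing every factor by its Gaussian counterpart \<open>exp (- a\<^sup>2 v / 2)\<close> costs at most
  \<open>a\<^sup>2 (G m / 6 + m\<^sup>2 v\<^sup>2 / 4)\<close> when \<open>\<bar>a\<bar> \<le> m\<close>, where \<open>G m\<close> vanishes as \<open>m \<rightarrow> 0\<close> by
  dominated convergence. The sum of these errors tends to zero because the sum of the \<open>a\<^sup>2\<close>
  stays bounded.\<close>

theorem weighted_sum_clt:
  fixes eps :: "nat \<Rightarrow> 'a \<Rightarrow> real" and a :: "nat \<Rightarrow> nat \<Rightarrow> real"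
  assumes M: "prob_space M" and indep: "prob_space.indep_vars M (\<lambda>_. borel) eps UNIV"
    and ident: "\<And>i. distr M borel (eps i) = distr M borel (eps 0)"
    and int: "integrable M (eps 0)" and mean: "(\<integral>\<omega>. eps 0 \<omega> \<partial>M) = 0"
    and int2: "integrable M (\<lambda>\<omega>. (eps 0 \<omega>)\<^sup>2)" and var: "(\<integral>\<omega>. (eps 0 \<omega>)\<^sup>2 \<partial>M) = v"
    and s: "(\<lambda>n. \<Sum>i<n. (a n i)\<^sup>2) \<longlonglongrightarrow> s"
    and m: "m \<longlonglongrightarrow> 0" "\<forall>\<^sub>F n in sequentially. \<forall>i<n. \<bar>a n i\<bar> \<le> m n"
  shows "(\<lambda>n. CLINT \<omega>|M. iexp (\<Sum>i<n. a n i * eps i \<omega>)) \<longlonglongrightarrow> complex_of_real (exp (- (v * s) / 2))"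
proof -
  interpret prob_space M by fact
  have rv[measurable]: "eps i \<in> borel_measurable M" for i
    using indep unfolding indep_vars_def2 by simp
  have v: "v \<ge> 0" using var by (metis integral_nonneg_AE AE_I2 zero_le_power2)
  define \<phi> where "\<phi> = char (distr M borel (eps 0))"
  define G where "G t = (\<integral>\<omega>. min (6 * (eps 0 \<omega>)\<^sup>2) (\<bar>t\<bar> * \<bar>eps 0 \<omega>\<bar> ^ 3) \<partial>M)" for t
  have intG: "integrable M (\<lambda>\<omega>. min (6 * (eps 0 \<omega>)\<^sup>2) (\<bar>t\<bar> * \<bar>eps 0 \<omega>\<bar> ^ 3))" for t
    by (rule Bochner_Integration.integrable_bound[where f="\<lambda>\<omega>. 6 * (eps 0 \<omega>)\<^sup>2"]) (use int2 in auto)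
  have prod: "(CLINT \<omega>|M. iexp (\<Sum>i<n. a n i * eps i \<omega>)) = (\<Prod>i<n. \<phi> (a n i))" for n
  proof -
    have "(CLINT \<omega>|M. iexp (\<Sum>i<n. a n i * eps i \<omega>)) = char (distr M borel (\<lambda>\<omega>. \<Sum>i<n. a n i * eps i \<omega>)) 1"
      by (simp add: char_def integral_distr)
    also have "\<dots> = (\<Prod>i<n. char (distr M borel (\<lambda>\<omega>. a n i * eps i \<omega>)) 1)"
    proof (rule char_distr_sum)
      have "indep_vars (\<lambda>_. borel) (\<lambda>i \<omega>. a n i * eps i \<omega>) UNIV"
        by (rule indep_vars_compose2[where X=eps, OF indep]) auto
      then show "indep_vars (\<lambda>_. borel) (\<lambda>i \<omega>. a n i * eps i \<omega>) {..<n}"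
        by (rule indep_vars_subset) auto
    qed
    also have "\<dots> = (\<Prod>i<n. \<phi> (a n i))"
    proof (rule prod.cong)
      fix i
      have "char (distr M borel (\<lambda>\<omega>. a n i * eps i \<omega>)) 1 = char (distr M borel (eps i)) (a n i)"
        by (simp add: char_def integral_distr)
      then show "char (distr M borel (\<lambda>\<omega>. a n i * eps i \<omega>)) 1 = \<phi> (a n i)"
        by (simp add: \<phi>_def ident[of i])
    qed simp
    finally show ?thesis .
  qed
  have \<phi>1: "norm (\<phi> t) \<le> 1" for t
    unfolding \<phi>_def by (intro real_distribution.cmod_char_le_1 real_distribution_distr rv)
  have approx: "norm (\<phi> t - complex_of_real (exp (- (t\<^sup>2 * v / 2)))) \<le> t\<^sup>2 * (G b / 6 + b\<^sup>2 * v\<^sup>2 / 4)"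
    if b: "\<bar>t\<bar> \<le> b" for t b
  proof -
    have "norm (\<phi> t - complex_of_real (1 - t\<^sup>2 * v / 2)) \<le> t\<^sup>2 / 6 * G t"
      unfolding \<phi>_def G_def by (rule char_approx3') (use int int2 mean var in auto)
    also have "\<dots> \<le> t\<^sup>2 / 6 * G b"
      unfolding G_def using b by (intro mult_left_mono integral_mono intG min.mono mult_right_mono) auto
    finally have 1: "norm (\<phi> t - complex_of_real (1 - t\<^sup>2 * v / 2)) \<le> t\<^sup>2 / 6 * G b" .
    have "norm (complex_of_real (1 - t\<^sup>2 * v / 2) - complex_of_real (exp (- (t\<^sup>2 * v / 2)))) =
        \<bar>exp (- (t\<^sup>2 * v / 2)) - (1 - t\<^sup>2 * v / 2)\<bar>"
      by (simp only: norm_of_real abs_minus_commute flip: of_real_diff)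
    also have "\<dots> \<le> (t\<^sup>2 * v / 2)\<^sup>2" using v by (intro exp_minus_linear_error) auto
    also have "\<dots> = t\<^sup>2 * (t\<^sup>2 * v\<^sup>2 / 4)" by (simp add: power2_eq_square)
    also have "\<dots> \<le> t\<^sup>2 * (b\<^sup>2 * v\<^sup>2 / 4)"
      using b by (intro mult_left_mono divide_right_mono mult_right_mono) (use power_mono[OF b, of 2] in auto)
    finally have 2: "norm (complex_of_real (1 - t\<^sup>2 * v / 2) - complex_of_real (exp (- (t\<^sup>2 * v / 2)))) \<le> t\<^sup>2 * (b\<^sup>2 * v\<^sup>2 / 4)" .
    have "norm (\<phi> t - complex_of_real (exp (- (t\<^sup>2 * v / 2)))) \<le> t\<^sup>2 / 6 * G b + t\<^sup>2 * (b\<^sup>2 * v\<^sup>2 / 4)"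
      by (rule norm_diff_triangle_le[OF 1 2])
    then show ?thesis by (simp add: algebra_simps)
  qed
  have G0: "(\<lambda>n. G (m n)) \<longlonglongrightarrow> 0"
  proof -
    have "(\<lambda>n. G (m n)) \<longlonglongrightarrow> (\<integral>\<omega>. 0 \<partial>M)"
      unfolding G_def
    proof (rule integral_dominated_convergence[where w="\<lambda>\<omega>. 6 * (eps 0 \<omega>)\<^sup>2"])
      show "AE \<omega> in M. (\<lambda>n. min (6 * (eps 0 \<omega>)\<^sup>2) (\<bar>m n\<bar> * \<bar>eps 0 \<omega>\<bar> ^ 3)) \<longlonglongrightarrow> 0"
      proof (rule AE_I2)
        fix \<omega>
        have "(\<lambda>n. min (6 * (eps 0 \<omega>)\<^sup>2) (\<bar>m n\<bar> * \<bar>eps 0 \<omega>\<bar> ^ 3)) \<longlonglongrightarrow> min (6 * (eps 0 \<omega>)\<^sup>2) (\<bar>0\<bar> * \<bar>eps 0 \<omega>\<bar> ^ 3)"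
          by (intro tendsto_intros m)
        then show "(\<lambda>n. min (6 * (eps 0 \<omega>)\<^sup>2) (\<bar>m n\<bar> * \<bar>eps 0 \<omega>\<bar> ^ 3)) \<longlonglongrightarrow> 0"
          by (simp add: min_absorb2)
      qed
    qed (use int2 in auto)
    then show ?thesis by simp
  qed
  let ?S = "\<lambda>n. \<Sum>i<n. (a n i)\<^sup>2"
  have "(\<lambda>n. (\<Prod>i<n. \<phi> (a n i)) - complex_of_real (exp (- (v * ?S n) / 2))) \<longlonglongrightarrow> 0"
  proof (rule Lim_null_comparison)
    show "(\<lambda>n. ?S n * (G (m n) / 6 + (m n)\<^sup>2 * v\<^sup>2 / 4)) \<longlonglongrightarrow> 0"
      using tendsto_mult[OF s tendsto_add[OF tendsto_divide[OF G0 tendsto_const[of 6]]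
        tendsto_divide[OF tendsto_mult[OF tendsto_power[OF m(1), of 2] tendsto_const[of "v\<^sup>2"]] tendsto_const[of 4]]]]
      by simp
    show "\<forall>\<^sub>F n in sequentially. norm ((\<Prod>i<n. \<phi> (a n i)) - complex_of_real (exp (- (v * ?S n) / 2))) \<le>
        ?S n * (G (m n) / 6 + (m n)\<^sup>2 * v\<^sup>2 / 4)"
      using m(2)
    proof eventually_elim
      case (elim n)
      have "complex_of_real (exp (- (v * ?S n) / 2)) = (\<Prod>i<n. complex_of_real (exp (- ((a n i)\<^sup>2 * v / 2))))"
        by (simp add: exp_sum[symmetric] sum_negf sum_distrib_left sum_divide_distrib mult.commute flip: of_real_prod)
      then have "norm ((\<Prod>i<n. \<phi> (a n i)) - complex_of_real (exp (- (v * ?S n) / 2))) =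
          norm ((\<Prod>i<n. \<phi> (a n i)) - (\<Prod>i<n. complex_of_real (exp (- ((a n i)\<^sup>2 * v / 2)))))" by simp
      also have "\<dots> \<le> (\<Sum>i<n. norm (\<phi> (a n i) - complex_of_real (exp (- ((a n i)\<^sup>2 * v / 2)))))"
        using v by (intro norm_prod_diff \<phi>1) (simp only: norm_of_real, simp)
      also have "\<dots> \<le> (\<Sum>i<n. (a n i)\<^sup>2 * (G (m n) / 6 + (m n)\<^sup>2 * v\<^sup>2 / 4))"
        using elim by (intro sum_mono approx) auto
      finally show ?case by (simp add: sum_distrib_right)
    qed
  qed
  moreover have "(\<lambda>n. complex_of_real (exp (- (v * ?S n) / 2))) \<longlonglongrightarrow> complex_of_real (exp (- (v * s) / 2))"
    by (intro tendsto_intros s) simp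
  ultimately have "(\<lambda>n. (\<Prod>i<n. \<phi> (a n i))) \<longlonglongrightarrow> 0 + complex_of_real (exp (- (v * s) / 2))"
    by (auto dest: tendsto_add)
  then show ?thesis unfolding prod by simp
qed

text \<open>Only a first moment is assumed, which is what the squared errors of the regression have. The first-order
  expansion of the characteristic function has an error of smaller order than \<open>1 / n\<close> at \<open>t / n\<close>.\<close>

theorem weak_law_char:
  fixes Y :: "nat \<Rightarrow> 'a \<Rightarrow> real"
  assumes M: "prob_space M" and indep: "prob_space.indep_vars M (\<lambda>_. borel) Y UNIV"
    and ident: "\<And>i. distr M borel (Y i) = distr M borel (Y 0)"
    and int: "integrable M (Y 0)" and mean: "(\<integral>\<omega>. Y 0 \<omega> \<partial>M) = c"
  shows "(\<lambda>n. CLINT \<omega>|M. iexp (t * ((\<Sum>i<n. Y i \<omega>) / real n))) \<longlonglongrightarrow> iexp (t * c)"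
proof -
  interpret prob_space M by fact
  have rv[measurable]: "Y i \<in> borel_measurable M" for i
    using indep unfolding indep_vars_def2 by simp
  define \<phi> where "\<phi> = char (distr M borel (Y 0))"
  define G where "G t = (\<integral>\<omega>. min (4 * \<bar>Y 0 \<omega>\<bar>) (\<bar>t\<bar> * \<bar>Y 0 \<omega>\<bar>\<^sup>2) \<partial>M)" for t
  interpret D: real_distribution "distr M borel (Y 0)" by (rule real_distribution_distr) simp
  have \<phi>1: "norm (\<phi> u) \<le> 1" for u unfolding \<phi>_def by (rule D.cmod_char_le_1)
  have prod: "(CLINT \<omega>|M. iexp (t * ((\<Sum>i<n. Y i \<omega>) / real n))) = \<phi> (t / n) ^ n" for n
  proof -
    have "(CLINT \<omega>|M. iexp (t * ((\<Sum>i<n. Y i \<omega>) / real n))) = char (distr M borel (\<lambda>\<omega>. \<Sum>i<n. Y i \<omega>)) (t / n)"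
      by (simp add: char_def integral_distr)
    also have "\<dots> = (\<Prod>i<n. char (distr M borel (Y i)) (t / n))"
      by (rule char_distr_sum) (rule indep_vars_subset[OF indep], simp)
    also have "\<dots> = (\<Prod>i<n. \<phi> (t / n))"
      unfolding \<phi>_def by (intro prod.cong refl arg_cong2[where f=char] ident)
    also have "\<dots> = \<phi> (t / n) ^ n" by simp
    finally show ?thesis .
  qed
  have approx: "norm (\<phi> u - iexp (u * c)) \<le> \<bar>u\<bar> / 2 * G u + (u * c)\<^sup>2 / 2" for u
  proof -
    have moments: "integrable (distr M borel (Y 0)) (\<lambda>x. x ^ k)" if "k \<le> 1" for k
      using that int by (cases k) (auto simp: integrable_distr_eq)
    have "norm (\<phi> u - (\<Sum>k\<le>1. ((\<i> * u) ^ k / fact k) * D.expectation (\<lambda>x. x ^ k))) \<le>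
        (\<bar>u\<bar> ^ 1 / fact (Suc 1)) * D.expectation (\<lambda>x. min (2 * \<bar>x\<bar> ^ 1 * real (Suc 1)) (\<bar>u\<bar> * \<bar>x\<bar> ^ Suc 1))"
      unfolding \<phi>_def by (rule D.char_approx2[OF moments])
    also have "D.expectation (\<lambda>x. min (2 * \<bar>x\<bar> ^ 1 * real (Suc 1)) (\<bar>u\<bar> * \<bar>x\<bar> ^ Suc 1)) = G u"
      by (subst integral_distr) (auto simp: G_def power2_eq_square mult.commute)
    also have "(\<Sum>k\<le>1. ((\<i> * u) ^ k / fact k) * complex_of_real (D.expectation (\<lambda>x. x ^ k))) = 1 + \<i> * u * c"
      using mean prob_space by (simp add: integral_distr)
    finally have 1: "norm (\<phi> u - (1 + \<i> * u * c)) \<le> \<bar>u\<bar> / 2 * G u" by simp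
    have 2: "norm (iexp (u * c) - (1 + \<i> * u * c)) \<le> (u * c)\<^sup>2 / 2"
      using iexp_approx1[of "u * c" 1] by (simp add: numeral_2_eq_2[symmetric] mult.assoc)
    show ?thesis using norm_triangle_ineq4[of "\<phi> u - (1 + \<i> * u * c)" "iexp (u * c) - (1 + \<i> * u * c)"] 1 2
      by (simp del: of_real_mult)
  qed
  have G0: "(\<lambda>n. G (t / real n)) \<longlonglongrightarrow> 0"
  proof -
    have "(\<lambda>n. G (t / real n)) \<longlonglongrightarrow> (\<integral>\<omega>. 0 \<partial>M)"
      unfolding G_def
    proof (rule integral_dominated_convergence[where w="\<lambda>\<omega>. 4 * \<bar>Y 0 \<omega>\<bar>"])
      show "AE \<omega> in M. (\<lambda>n. min (4 * \<bar>Y 0 \<omega>\<bar>) (\<bar>t / real n\<bar> * \<bar>Y 0 \<omega>\<bar>\<^sup>2)) \<longlonglongrightarrow> 0"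
      proof (rule AE_I2)
        fix \<omega>
        have "(\<lambda>n. min (4 * \<bar>Y 0 \<omega>\<bar>) (\<bar>t / real n\<bar> * \<bar>Y 0 \<omega>\<bar>\<^sup>2)) \<longlonglongrightarrow> min (4 * \<bar>Y 0 \<omega>\<bar>) (\<bar>0\<bar> * \<bar>Y 0 \<omega>\<bar>\<^sup>2)"
          by (intro tendsto_min tendsto_mult tendsto_rabs tendsto_const lim_const_over_n)
        then show "(\<lambda>n. min (4 * \<bar>Y 0 \<omega>\<bar>) (\<bar>t / real n\<bar> * \<bar>Y 0 \<omega>\<bar>\<^sup>2)) \<longlonglongrightarrow> 0"
          by (simp add: min_absorb2)
      qed
    qed (use int in auto)
    then show ?thesis by simp
  qed
  have "(\<lambda>n. \<phi> (t / n) ^ n - iexp (t * c)) \<longlonglongrightarrow> 0"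
  proof (rule Lim_null_comparison)
    show "(\<lambda>n. \<bar>t\<bar> / 2 * G (t / n) + (t * c)\<^sup>2 / 2 / real n) \<longlonglongrightarrow> 0"
      using tendsto_add[OF tendsto_mult_right_zero[OF G0, of "\<bar>t\<bar> / 2"] lim_const_over_n[of "(t * c)\<^sup>2 / 2"]] by simp
    show "\<forall>\<^sub>F n in sequentially. norm (\<phi> (t / n) ^ n - iexp (t * c)) \<le> \<bar>t\<bar> / 2 * G (t / n) + (t * c)\<^sup>2 / 2 / real n"
      using eventually_gt_at_top[of 0]
    proof eventually_elim
      case (elim n)
      have "iexp (t * c) = iexp (t / n * c) ^ n"
        using elim by (simp add: exp_of_nat_mult[symmetric])
      then have "norm (\<phi> (t / n) ^ n - iexp (t * c)) = norm (\<phi> (t / n) ^ n - iexp (t / n * c) ^ n)" by simp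
      also have "\<dots> \<le> n * norm (\<phi> (t / n) - iexp (t / n * c))"
        by (rule norm_power_diff) (simp_all add: \<phi>1 del: of_real_mult of_real_divide)
      also have "\<dots> \<le> n * (\<bar>t / n\<bar> / 2 * G (t / n) + (t / n * c)\<^sup>2 / 2)"
        by (intro mult_left_mono approx) simp
      also have "\<dots> = \<bar>t\<bar> / 2 * G (t / n) + (t * c)\<^sup>2 / 2 / real n"
        using elim by (simp add: field_simps power2_eq_square)
      finally show ?case .
    qed
  qed
  then show ?thesis unfolding prod by (rule LIM_zero_cancel)
qed

text \<open>Replacing \<open>Q n\<close> by the constant \<open>c\<close> changes a bounded Lipschitz function of the pair by at most
  \<open>min (2 B) (K \<bar>Q n - c\<bar>)\<close>, whose expectation tends to zero.\<close>

theorem slutsky_pair: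
  fixes X :: "nat \<Rightarrow> 'a \<Rightarrow> 'c::euclidean_space" and Q :: "nat \<Rightarrow> 'a \<Rightarrow> real"
  assumes M: "prob_space M" and N: "prob_space N"
    and X: "converges_in_distribution M X N Z"
    and Q: "converges_in_distribution M Q N (\<lambda>_. c)"
  shows "converges_in_distribution M (\<lambda>n \<omega>. (X n \<omega>, Q n \<omega>)) N (\<lambda>\<omega>. (Z \<omega>, c))"
proof (rule converges_in_distributionI_lipschitz[OF M N])
  interpret M: prob_space M by fact
  interpret N: prob_space N by fact
  have Xm: "\<forall>\<^sub>F n in sequentially. X n \<in> borel_measurable M" and Qm: "\<forall>\<^sub>F n in sequentially. Q n \<in> borel_measurable M"
    and Zm: "Z \<in> borel_measurable N"
    using X Q by (auto simp: converges_in_distribution_def)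
  show "\<forall>\<^sub>F n in sequentially. (\<lambda>\<omega>. (X n \<omega>, Q n \<omega>)) \<in> borel_measurable M"
    using Xm Qm by eventually_elim (rule borel_measurable_Pair)
  show "(\<lambda>\<omega>. (Z \<omega>, c)) \<in> borel_measurable N" using Zm by (intro borel_measurable_Pair) auto
  fix f :: "'c \<times> real \<Rightarrow> real" and K assume f: "K-lipschitz_on UNIV f" and "bounded (range f)"
  then obtain B where B: "\<And>y. \<bar>f y\<bar> \<le> B" by (auto simp: bounded_iff)
  have K: "K \<ge> 0" using f by (rule lipschitz_on_nonneg)
  have fc: "continuous_on UNIV f" by (rule lipschitz_on_continuous_on[OF f])
  have fm: "f \<in> borel_measurable borel" by (rule borel_measurable_continuous_onI[OF fc])
  let ?g = "\<lambda>q. min (2 * B) (K * \<bar>q - c\<bar>)"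
  have B0: "B \<ge> 0" using B[of 0] by linarith
  have gB: "\<bar>?g q\<bar> \<le> 2 * B" for q using B0 K by (simp add: abs_le_iff)
  have gm: "?g \<in> borel_measurable borel" by measurable
  have "(\<lambda>n. \<integral>\<omega>. ?g (Q n \<omega>) \<partial>M) \<longlonglongrightarrow> (\<integral>\<omega>. ?g c \<partial>N)"
    using Q gB unfolding converges_in_distribution_def
    by (elim conjE allE[of _ ?g] impE) (auto intro!: continuous_intros boundedI[of _ "2 * B"])
  then have g0: "(\<lambda>n. \<integral>\<omega>. ?g (Q n \<omega>) \<partial>M) \<longlonglongrightarrow> 0" using B0 by simp
  have "continuous_on UNIV (\<lambda>x. f (x, c))"
    by (rule continuous_on_compose2[OF fc]) (auto intro!: continuous_intros)
  then have lim: "(\<lambda>n. \<integral>\<omega>. f (X n \<omega>, c) \<partial>M) \<longlonglongrightarrow> (\<integral>\<omega>. f (Z \<omega>, c) \<partial>N)"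
    using X B unfolding converges_in_distribution_def
    by (elim conjE allE[of _ "\<lambda>x. f (x, c)"] impE) (auto intro!: boundedI[of _ B])
  have "(\<lambda>n. (\<integral>\<omega>. f (X n \<omega>, Q n \<omega>) \<partial>M) - (\<integral>\<omega>. f (X n \<omega>, c) \<partial>M)) \<longlonglongrightarrow> 0"
  proof (rule Lim_null_comparison[OF _ g0])
    show "\<forall>\<^sub>F n in sequentially. norm ((\<integral>\<omega>. f (X n \<omega>, Q n \<omega>) \<partial>M) - (\<integral>\<omega>. f (X n \<omega>, c) \<partial>M)) \<le> (\<integral>\<omega>. ?g (Q n \<omega>) \<partial>M)"
      using Xm Qm
    proof eventually_elim
      case (elim n)
      note [measurable] = elim fm
      have i1: "integrable M (\<lambda>\<omega>. f (X n \<omega>, Q n \<omega>))"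
        by (rule bounded_integrable[where B=B, OF M]) (use B in auto)
      have i2: "integrable M (\<lambda>\<omega>. f (X n \<omega>, c))"
        by (rule bounded_integrable[where B=B, OF M]) (use B in auto)
      have i3: "integrable M (\<lambda>\<omega>. ?g (Q n \<omega>))"
        by (rule bounded_integrable[where B="2 * B", OF M _ gB]) measurable
      note i = i1 i2 i3
      have le: "\<bar>f (x, q) - f (x, c)\<bar> \<le> ?g q" for x q
        using lipschitz_onD[OF f, of "(x, q)" "(x, c)"] B[of "(x, q)"] B[of "(x, c)"]
        by (simp add: dist_Pair_Pair dist_real_def)
      have "norm ((\<integral>\<omega>. f (X n \<omega>, Q n \<omega>) \<partial>M) - (\<integral>\<omega>. f (X n \<omega>, c) \<partial>M)) = \<bar>\<integral>\<omega>. f (X n \<omega>, Q n \<omega>) - f (X n \<omega>, c) \<partial>M\<bar>"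
        using i by simp
      also have "\<dots> \<le> (\<integral>\<omega>. \<bar>f (X n \<omega>, Q n \<omega>) - f (X n \<omega>, c)\<bar> \<partial>M)" by (rule integral_abs_bound)
      also have "\<dots> \<le> (\<integral>\<omega>. ?g (Q n \<omega>) \<partial>M)"
        by (rule integral_mono) (use i le in auto)
      finally show ?case .
    qed
  qed
  from tendsto_add[OF this lim] show "(\<lambda>n. \<integral>\<omega>. f (X n \<omega>, Q n \<omega>) \<partial>M) \<longlonglongrightarrow> (\<integral>\<omega>. f (Z \<omega>, c) \<partial>N)" by simp
qed

section \<open>Lebesgue measure under linear maps\<close>

text \<open>Conjugation with \<open>r\<close> matches the permutations of the two index types and preserves signs.\<close>

lemma det_reindex:
  fixes A :: "'a::comm_ring_1^'n^'n" and r :: "'m::finite \<Rightarrow> 'n"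
  assumes r: "bij r"
  shows "det (\<chi> i j. A $ r i $ r j) = det A"
proof -
  have bij: "bij_betw (\<lambda>p. r \<circ> p \<circ> inv r) {p. p permutes (UNIV :: 'm set)} {p. p permutes (UNIV :: 'n set)}"
    using bij_betw_permutations[OF r] by (simp add: comp_def)
  have "det A = (\<Sum>p | p permutes (UNIV :: 'm set). of_int (sign (r \<circ> p \<circ> inv r)) * (\<Prod>i\<in>UNIV. A $ i $ (r \<circ> p \<circ> inv r) i))"
    unfolding det_def by (rule sum.reindex_bij_betw[OF bij, symmetric])
  also have "\<dots> = det (\<chi> i j. A $ r i $ r j)"
    unfolding det_def
  proof (intro sum.cong refl arg_cong2[where f="(*)"])
    fix p assume "p \<in> {p. p permutes (UNIV :: 'm set)}"
    then have p: "p permutes UNIV" by simp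
    have "r \<circ> p \<circ> inv r = map_permutation UNIV r p"
      using bij_is_surj[OF r] by (auto simp: map_permutation_def restrict_id_def fun_eq_iff)
    then show "of_int (sign (r \<circ> p \<circ> inv r)) = (of_int (sign p) :: 'a)"
      using sign_map_permutation[OF bij_is_inj[OF r] p] by simp
    have "(\<Prod>i\<in>UNIV. A $ i $ (r \<circ> p \<circ> inv r) i) = (\<Prod>j\<in>UNIV. A $ r j $ (r \<circ> p \<circ> inv r) (r j))"
      by (rule prod.reindex_bij_betw[OF r, symmetric])
    then show "(\<Prod>i\<in>UNIV. A $ i $ (r \<circ> p \<circ> inv r) i) = (\<Prod>i\<in>UNIV. (\<chi> i j. A $ r i $ r j) $ i $ p i)"
      by (simp add: inv_f_f[OF bij_is_inj[OF r]])
  qed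
  finally show ?thesis by simp
qed

text \<open>
  The determinant formula for the measure of linear images rests on elimination, for which the index type is
  linearly ordered. A finite type has no canonical order; this copy is ordered through an arbitrary
  injection into the natural numbers.\<close>

typedef 'n well_ordered = "UNIV :: 'n set" by simp

lemma bij_Rep_well_ordered: "bij (Rep_well_ordered :: 'n well_ordered \<Rightarrow> 'n)"
proof (rule bijI)
  show "inj (Rep_well_ordered :: 'n well_ordered \<Rightarrow> 'n)" by (simp add: inj_def Rep_well_ordered_inject)
  show "surj (Rep_well_ordered :: 'n well_ordered \<Rightarrow> 'n)" by (rule surjI[of _ Abs_well_ordered]) (simp add: Abs_well_ordered_inverse)
qed

definition well_ordered_index :: "'n::finite well_ordered \<Rightarrow> nat" where
  "well_ordered_index = (SOME f. inj f)"

instance well_ordered :: (finite) finite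
proof
  show "finite (UNIV :: 'a well_ordered set)"
    by (rule bij_betw_finite[OF bij_Rep_well_ordered, THEN iffD2]) simp
qed

lemma inj_well_ordered_index: "inj (well_ordered_index :: 'n::finite well_ordered \<Rightarrow> nat)"
proof -
  have "\<exists>f :: 'n well_ordered \<Rightarrow> nat. inj f"
    using finite_imp_inj_to_nat_seg[OF finite[of "UNIV :: 'n well_ordered set"]] by blast
  then show ?thesis unfolding well_ordered_index_def by (rule someI_ex)
qed

instantiation well_ordered :: (finite) wellorder
begin
definition less_eq_well_ordered :: "'a well_ordered \<Rightarrow> 'a well_ordered \<Rightarrow> bool" where
  "x \<le> y \<longleftrightarrow> well_ordered_index x \<le> well_ordered_index y"
definition less_well_ordered :: "'a well_ordered \<Rightarrow> 'a well_ordered \<Rightarrow> bool" where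
  "x < y \<longleftrightarrow> well_ordered_index x < well_ordered_index y"
instance
proof
  fix P :: "'a well_ordered \<Rightarrow> bool" and a
  assume "\<And>x. (\<And>y. y < x \<Longrightarrow> P y) \<Longrightarrow> P x"
  then show "P a"
    unfolding less_well_ordered_def by (rule measure_induct_rule)
next
  fix x y :: "'a well_ordered"
  assume "x \<le> y" "y \<le> x"
  then show "x = y"
    unfolding less_eq_well_ordered_def by (intro injD[OF inj_well_ordered_index]) simp
qed (auto simp: less_eq_well_ordered_def less_well_ordered_def)
end

lemma matrix_inv_inverse:
  fixes A :: "real^'n^'n"
  assumes "invertible A"
  shows "A ** matrix_inv A = mat 1" "matrix_inv A ** A = mat 1"
proof -
  have "A ** matrix_inv A = mat 1 \<and> matrix_inv A ** A = mat 1"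
    unfolding matrix_inv_def using assms unfolding invertible_def by (rule someI_ex)
  then show "A ** matrix_inv A = mat 1" "matrix_inv A ** A = mat 1" by auto
qed

lemma matrix_inv_apply [simp]:
  fixes A :: "real^'n^'n"
  assumes "invertible A"
  shows "A *v (matrix_inv A *v z) = z" "matrix_inv A *v (A *v z) = z"
  by (simp_all add: matrix_vector_mul_assoc matrix_inv_inverse[OF assms])

lemma matrix_inv_unique:
  fixes A B :: "real^'n^'n"
  assumes "A ** B = mat 1"
  shows "matrix_inv A = B"
proof -
  have A: "invertible A" using assms by (metis invertible_right_inverse)
  have "matrix_inv A = matrix_inv A ** (A ** B)" by (simp add: assms)
  also have "\<dots> = B" by (simp add: matrix_mul_assoc matrix_inv_inverse[OF A])
  finally show ?thesis .
qed

lemma invertible_matrix_inv: "invertible (A :: real^'n^'n) \<Longrightarrow> invertible (matrix_inv A)"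
  unfolding invertible_def using matrix_inv_inverse[of A] by (auto simp: invertible_def)

lemma inner_transpose: "(A *v u) \<bullet> w = u \<bullet> (transpose A *v w)" for A :: "real^'n^'m"
  by (metis dot_lmul_matrix vector_transpose_matrix inner_commute)

lemma borel_measurable_matrix_vector_mult [measurable]: "(\<lambda>z. A *v z) \<in> borel_measurable borel"
  for A :: "real^'n^'m"
  by (intro borel_measurable_continuous_onI linear_continuous_on matrix_vector_mul_bounded_linear)

lemma prod_Basis_cart: "(\<Prod>b\<in>Basis. z \<bullet> b) = (\<Prod>i\<in>UNIV. z $ i)" for z :: "real^'n"
proof -
  have B: "(Basis :: (real^'n) set) = (\<lambda>i. axis i 1) ` UNIV" by (auto simp: Basis_vec_def)
  have "inj (\<lambda>i::'n. axis i (1::real))" by (auto simp: inj_def axis_eq_axis)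
  then show ?thesis unfolding B by (subst prod.reindex) (simp_all add: inner_axis)
qed

text \<open>It suffices to compare boxes: the preimage of a box under \<open>A\<close> is its image under the inverse matrix.\<close>

lemma lborel_linear_wellorder:
  fixes A :: "real^'n::{finite,wellorder}^'n::_"
  assumes A: "invertible A"
  shows "lborel = density (distr lborel borel ((*v) A)) (\<lambda>_. ennreal \<bar>det A\<bar>)"
proof (rule lborel_eqI)
  let ?B = "matrix_inv A"
  fix l u :: "real^'n::_" assume lu: "\<And>b. b \<in> Basis \<Longrightarrow> l \<bullet> b \<le> u \<bullet> b"
  have vim: "(*v) A -` box l u = (*v) ?B ` box l u"
    using A by (auto simp: image_iff) (metis matrix_inv_apply(2))
  have bm: "(*v) A -` box l u \<in> sets borel"
    using measurable_sets[OF borel_measurable_matrix_vector_mult[of A], of "box l u"] by simp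
  have lm: "(*v) ?B ` box l u \<in> lmeasurable" and "measure lebesgue ((*v) ?B ` box l u) = \<bar>det ?B\<bar> * measure lebesgue (box l u)"
    using measurable_linear_image[of "(*v) ?B" "box l u"] measure_linear_image[of "(*v) ?B" "box l u"] by auto
  moreover have "emeasure lborel ((*v) ?B ` box l u) = ennreal (measure lebesgue ((*v) ?B ` box l u))"
    using emeasure_eq_measure2[OF lm] bm unfolding vim by simp
  ultimately have em: "emeasure lborel ((*v) A -` box l u) = ennreal (\<bar>det ?B\<bar> * measure lebesgue (box l u))"
    unfolding vim by simp
  then have "emeasure (density (distr lborel borel ((*v) A)) (\<lambda>_. ennreal \<bar>det A\<bar>)) (box l u) =
      ennreal \<bar>det A\<bar> * ennreal (\<bar>det ?B\<bar> * measure lebesgue (box l u))"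
    by (simp add: emeasure_density_const emeasure_distr em)
  also have "\<dots> = ennreal (\<bar>det (A ** ?B)\<bar> * measure lebesgue (box l u))"
    by (simp add: det_mul abs_mult mult.assoc flip: ennreal_mult)
  also have "\<dots> = (\<Prod>b\<in>Basis. (u - l) \<bullet> b)"
    using lu by (simp add: matrix_inv_inverse[OF A] measure_lborel_box_eq)
  finally show "emeasure (density (distr lborel borel ((*v) A)) (\<lambda>_. ennreal \<bar>det A\<bar>)) (box l u) = (\<Prod>b\<in>Basis. (u - l) \<bullet> b)" .
qed simp

lemma lborel_relabel:
  fixes r :: "'m::finite \<Rightarrow> 'n::finite"
  assumes r: "bij r"
  shows "distr lborel borel (\<lambda>z :: real^'m. \<chi> i. z $ inv r i) = (lborel :: (real^'n) measure)"
proof (rule lborel_eqI[symmetric])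
  let ?T = "\<lambda>z :: real^'m. \<chi> i. z $ inv r i"
  have Tm: "?T \<in> borel_measurable borel"
    by (intro borel_measurable_continuous_onI continuous_intros)
  fix l u :: "real^'n" assume lu: "\<And>b. b \<in> Basis \<Longrightarrow> l \<bullet> b \<le> u \<bullet> b"
  then have lu': "l $ i \<le> u $ i" for i
    using lu[of "axis i 1"] by (simp add: cart_eq_inner_axis axis_in_Basis_iff)
  let ?l = "\<chi> j. l $ r j" and ?u = "\<chi> j. u $ r j"
  have vim: "?T -` box l u = box ?l ?u"
  proof (rule set_eqI)
    fix z :: "real^'m"
    have "z \<in> ?T -` box l u \<longleftrightarrow> (\<forall>i. l $ i < z $ inv r i \<and> z $ inv r i < u $ i)"
      by (simp add: mem_box_cart)
    also have "\<dots> \<longleftrightarrow> (\<forall>j. l $ r j < z $ inv r (r j) \<and> z $ inv r (r j) < u $ r j)"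
      using bij_is_surj[OF r] by (metis surj_f_inv_f)
    also have "\<dots> \<longleftrightarrow> z \<in> box ?l ?u"
      by (simp add: mem_box_cart inv_f_f[OF bij_is_inj[OF r]])
    finally show "z \<in> ?T -` box l u \<longleftrightarrow> z \<in> box ?l ?u" .
  qed
  have "emeasure (distr lborel borel ?T) (box l u) = emeasure lborel (box ?l ?u)"
    using Tm by (simp add: emeasure_distr vim)
  also have "\<dots> = ennreal (\<Prod>j\<in>UNIV. u $ r j - l $ r j)"
    using lu' by (subst emeasure_lborel_box) (auto simp: prod_Basis_cart, auto simp: Basis_vec_def inner_axis)
  also have "(\<Prod>j\<in>UNIV. u $ r j - l $ r j) = (\<Prod>i\<in>UNIV. u $ i - l $ i)"
    by (rule prod.reindex_bij_betw[OF r])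
  also have "\<dots> = (\<Prod>b\<in>Basis. (u - l) \<bullet> b)"
    by (simp add: prod_Basis_cart)
  finally show "emeasure (distr lborel borel ?T) (box l u) = (\<Prod>b\<in>Basis. (u - l) \<bullet> b)" .
qed simp

text \<open>Transported from the well-ordered copy of the index type along the relabelling of coordinates, under
  which Lebesgue measure and the determinant are invariant.\<close>

lemma lborel_linear:
  fixes A :: "real^'n^'n"
  assumes A: "invertible A"
  shows "lborel = density (distr lborel borel ((*v) A)) (\<lambda>_. ennreal \<bar>det A\<bar>)"
proof -
  let ?r = "Rep_well_ordered :: 'n well_ordered \<Rightarrow> 'n"
  let ?T = "\<lambda>z :: real^'n well_ordered. \<chi> i. z $ inv ?r i"
  let ?A = "(\<chi> i j. A $ ?r i $ ?r j) :: real^'n well_ordered^'n well_ordered"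
  note r = bij_Rep_well_ordered[where 'n='n]
  have [measurable]: "?T \<in> borel_measurable borel"
    by (intro borel_measurable_continuous_onI continuous_intros)
  have det: "det ?A = det A" by (rule det_reindex[OF r])
  then have inv: "invertible ?A" using A by (simp add: invertible_det_nz)
  have comm: "A *v (?T z) = ?T (?A *v z)" for z
  proof (rule vec_eq_iff[THEN iffD2], rule allI)
    fix i
    have "(\<Sum>k\<in>UNIV. A $ i $ k * z $ inv ?r k) = (\<Sum>j\<in>UNIV. A $ i $ ?r j * z $ inv ?r (?r j))"
      by (rule sum.reindex_bij_betw[OF r, symmetric])
    then show "(A *v ?T z) $ i = ?T (?A *v z) $ i"
      by (simp add: matrix_vector_mult_def inv_f_f[OF bij_is_inj[OF r]] surj_f_inv_f[OF bij_is_surj[OF r]])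
  qed
  have "density (distr lborel borel ((*v) A)) (\<lambda>_. ennreal \<bar>det A\<bar>) =
      density (distr (distr lborel borel ?T) borel ((*v) A)) (\<lambda>_. ennreal \<bar>det A\<bar>)"
    by (simp add: lborel_relabel[OF r])
  also have "\<dots> = density (distr (distr lborel borel ((*v) ?A)) borel ?T) (\<lambda>_. ennreal \<bar>det ?A\<bar>)"
    by (simp add: distr_distr comp_def comm det)
  also have "\<dots> = distr (density (distr lborel borel ((*v) ?A)) (\<lambda>_. ennreal \<bar>det ?A\<bar>)) borel ?T"
    by (rule density_distr) auto
  also have "\<dots> = distr lborel borel ?T"
    by (simp add: lborel_linear_wellorder[OF inv, symmetric])
  also have "\<dots> = lborel" by (rule lborel_relabel[OF r])
  finally show ?thesis by simp
qed

lemma distr_lborel_affine: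
  fixes A :: "real^'n^'n"
  assumes A: "invertible A"
  shows "distr lborel borel (\<lambda>z. mu + A *v z) = density lborel (\<lambda>_. ennreal (1 / \<bar>det A\<bar>))"
proof -
  let ?D = "distr lborel borel ((*v) A)"
  have d: "\<bar>det A\<bar> > 0" using A by (simp add: invertible_det_nz)
  have "density lborel (\<lambda>_. ennreal (1 / \<bar>det A\<bar>)) = density (density ?D (\<lambda>_. ennreal \<bar>det A\<bar>)) (\<lambda>_. ennreal (1 / \<bar>det A\<bar>))"
    by (simp add: lborel_linear[OF A, symmetric])
  also have "\<dots> = density ?D (\<lambda>_. ennreal \<bar>det A\<bar> * ennreal (1 / \<bar>det A\<bar>))"
    by (rule density_density_eq) auto
  also have "\<dots> = ?D" using d by (simp add: density_1 flip: ennreal_mult)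
  finally have D: "?D = density lborel (\<lambda>_. ennreal (1 / \<bar>det A\<bar>))" by simp
  have "distr lborel borel (\<lambda>z. mu + A *v z) = distr ?D borel ((+) mu)"
    by (simp add: distr_distr comp_def)
  also have "\<dots> = density (distr lborel borel ((+) mu)) (\<lambda>_. ennreal (1 / \<bar>det A\<bar>))"
    unfolding D by (subst density_distr) auto
  finally show ?thesis by (simp add: lborel_distr_plus)
qed

lemma matrix_inv_mult_transpose:
  fixes A :: "real^'n^'n"
  assumes A: "invertible A"
  shows "z \<bullet> (matrix_inv (A ** transpose A) *v z) = (norm (matrix_inv A *v z))\<^sup>2"
proof -
  let ?B = "matrix_inv A"
  have "(A ** transpose A) ** (transpose ?B ** ?B) = A ** (transpose (?B ** A)) ** ?B"
    by (simp add: matrix_transpose_mul matrix_mul_assoc)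
  also have "\<dots> = mat 1" by (simp add: matrix_inv_inverse[OF A] transpose_mat)
  finally have "matrix_inv (A ** transpose A) = transpose ?B ** ?B" by (rule matrix_inv_unique)
  then show ?thesis
    by (simp add: power2_norm_eq_inner inner_transpose matrix_vector_mul_assoc[symmetric])
qed

text \<open>The normal law is the image of the standard Gaussian under an affine map. In particular it is a
  probability measure, and its characteristic function follows from that of the standard Gaussian.\<close>

lemma mvn_eq_distr_gauss:
  fixes A :: "real^'n^'n"
  assumes A: "invertible A"
  shows "mvn mu (A ** transpose A) = distr (density lborel (\<lambda>z. ennreal (gauss_density z))) borel (\<lambda>z. mu + A *v z)"
proof -
  let ?g = "\<lambda>z. mu + A *v z" and ?d = "\<lambda>y. gauss_density (matrix_inv A *v (y - mu))"
  have [measurable]: "?d \<in> borel_measurable borel"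
    by (rule measurable_compose[OF measurable_compose[OF _ borel_measurable_matrix_vector_mult] gauss_density_measurable]) measurable
  have dg: "?d (?g z) = gauss_density z" for z by (simp only: add_diff_cancel_left' matrix_inv_apply[OF A])
  have "distr (density lborel (\<lambda>z. ennreal (gauss_density z))) borel ?g = density (distr lborel borel ?g) (\<lambda>y. ennreal (?d y))"
    by (subst density_distr) (auto simp: dg A)
  also have "\<dots> = density lborel (\<lambda>y. ennreal (1 / \<bar>det A\<bar>) * ennreal (?d y))"
    unfolding distr_lborel_affine[OF A] by (subst density_density_eq) auto
  also have "\<dots> = mvn mu (A ** transpose A)"
    unfolding mvn_def
  proof (rule arg_cong[where f="density lborel"], rule ext)
    fix y
    have "mvn_density mu (A ** transpose A) y = 1 / \<bar>det A\<bar> * ?d y"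
      unfolding mvn_density_def matrix_inv_mult_transpose[OF A] gauss_density_eq
      by (simp add: det_mul det_transpose real_sqrt_mult real_sqrt_power power_one_over power_mult_distrib)
    then show "ennreal (1 / \<bar>det A\<bar>) * ennreal (?d y) = ennreal (mvn_density mu (A ** transpose A) y)"
      by (simp add: gauss_density_nonneg flip: ennreal_mult)
  qed
  finally show ?thesis by simp
qed

lemma prob_space_gauss: "prob_space (density lborel (\<lambda>z::'a::euclidean_space. ennreal (gauss_density z)))"
proof
  have "emeasure (density lborel (\<lambda>z::'a. ennreal (gauss_density z))) UNIV = (\<integral>\<^sup>+ z. ennreal (gauss_density (z::'a)) \<partial>lborel)"
    by (simp add: emeasure_density)
  also have "\<dots> = 1"
    by (subst nn_integral_eq_integral) (auto simp: gauss_density_integral gauss_density_nonneg)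
  finally show "emeasure (density lborel (\<lambda>z::'a. ennreal (gauss_density z))) (space (density lborel (\<lambda>z. ennreal (gauss_density z)))) = 1"
    by simp
qed

section \<open>Positive definite matrices\<close>

lemma pos_def_invertible: "pos_def A \<Longrightarrow> invertible A" for A :: "real^'n^'n"
proof -
  assume A: "pos_def A"
  have "u = 0" if "A *v u = 0" for u
    using A that unfolding pos_def_def by force
  then have "\<exists>B. B ** A = mat 1" by (simp add: matrix_left_invertible_ker)
  then show "invertible A" by (simp add: invertible_left_inverse)
qed

lemma pos_def_matrix_inv: "pos_def A \<Longrightarrow> pos_def (matrix_inv A)" for A :: "real^'n^'n"
proof -
  assume A: "pos_def A"
  then have t: "transpose A = A" and inv: "invertible A" by (auto simp: pos_def_def pos_def_invertible)
  have "A ** transpose (matrix_inv A) = transpose (matrix_inv A ** A)"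
    by (simp add: matrix_transpose_mul t)
  also have "\<dots> = mat 1" by (simp add: matrix_inv_inverse[OF inv] transpose_mat)
  finally have "transpose (matrix_inv A) = matrix_inv A" using matrix_inv_unique by metis
  moreover have "0 < u \<bullet> (matrix_inv A *v u)" if "u \<noteq> 0" for u
  proof -
    have "matrix_inv A *v u \<noteq> 0"
      using that matrix_inv_apply(1)[OF inv, of u] by force
    with A have "0 < (matrix_inv A *v u) \<bullet> (A *v (matrix_inv A *v u))" by (auto simp: pos_def_def)
    then show ?thesis by (simp add: inv inner_commute)
  qed
  ultimately show "pos_def (matrix_inv A)" by (simp add: pos_def_def)
qed

lemma pos_def_scaleR: "pos_def A \<Longrightarrow> c > 0 \<Longrightarrow> pos_def (c *\<^sub>R A)" for A :: "real^'n^'n"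
  by (auto simp: pos_def_def transpose_def vec_eq_iff scaleR_matrix_vector_assoc[symmetric])

text \<open>A matrix \<open>H\<close> of full row rank has an injective transpose.\<close>

lemma pos_def_restriction:
  fixes A :: "real^'p^'p" and H :: "real^'p^'q"
  assumes A: "pos_def A" and H: "rank H = CARD('q)"
  shows "pos_def (H ** matrix_inv A ** transpose H)"
proof -
  have B: "pos_def (matrix_inv A)" by (rule pos_def_matrix_inv[OF A])
  have "inj ((*v) (transpose H))" using H by (simp add: full_rank_injective[symmetric] rank_transpose)
  then have nz: "transpose H *v u \<noteq> 0" if "u \<noteq> 0" for u
    using that injD[of "(*v) (transpose H)" u 0] by auto
  have "transpose (H ** matrix_inv A ** transpose H) = H ** transpose (matrix_inv A) ** transpose H"
    by (simp add: matrix_transpose_mul matrix_mul_assoc)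
  moreover have "0 < u \<bullet> ((H ** matrix_inv A ** transpose H) *v u)" if "u \<noteq> 0" for u
  proof -
    have "0 < (transpose H *v u) \<bullet> (matrix_inv A *v (transpose H *v u))"
      using B nz[OF that] by (simp add: pos_def_def)
    then show ?thesis
      by (simp add: dot_lmul_matrix matrix_vector_mul_assoc[symmetric])
  qed
  ultimately show ?thesis using B by (simp add: pos_def_def)
qed

text \<open>Gram--Schmidt for the inner product of \<open>S\<close>: while fewer than \<open>CARD('n)\<close> vectors are given, some nonzero vector
  is orthogonal to their images under \<open>S\<close>.\<close>

lemma pos_def_orthonormal_family:
  fixes S :: "real^'n^'n"
  assumes S: "pos_def S"
  shows "k \<le> CARD('n) \<Longrightarrow> \<exists>f :: nat \<Rightarrow> real^'n. \<forall>i<k. \<forall>j<k. f i \<bullet> (S *v f j) = (if i = j then 1 else 0)"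
proof (induction k)
  case (Suc k)
  then obtain f :: "nat \<Rightarrow> real^'n" where f: "\<And>i j. i < k \<Longrightarrow> j < k \<Longrightarrow> f i \<bullet> (S *v f j) = (if i = j then 1 else 0)"
    by auto
  have sym: "u \<bullet> (S *v w) = w \<bullet> (S *v u)" for u w
    using S inner_transpose[of S u w] by (simp add: pos_def_def inner_commute)
  let ?V = "(\<lambda>i. S *v f i) ` {..<k}"
  have "dim ?V \<le> card ?V" by (rule dim_le_card) (auto intro: span_base)
  also have "\<dots> \<le> k" using card_image_le[of "{..<k}" "\<lambda>i. S *v f i"] by simp
  finally have "dim ?V < DIM(real^'n)" using Suc.prems by simp
  from orthogonal_to_subspace_exists[OF this] obtain w where w: "w \<noteq> 0" "\<And>y. y \<in> span ?V \<Longrightarrow> orthogonal w y" by blast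
  have w0: "w \<bullet> (S *v f i) = 0" if "i < k" for i
    using w(2)[of "S *v f i"] that by (auto simp: orthogonal_def intro: span_base)
  have pos: "w \<bullet> (S *v w) > 0" using S w(1) by (simp add: pos_def_def)
  (* w is S-orthogonal to the family; e is its S-normalisation *)
  define e where "e = (1 / sqrt (w \<bullet> (S *v w))) *\<^sub>R w"
  have ee: "e \<bullet> (S *v e) = 1"
    using pos by (simp add: e_def matrix_vector_mult_scaleR field_simps)
  have e0: "e \<bullet> (S *v f i) = 0" if "i < k" for i using w0[OF that] by (simp add: e_def)
  show ?case
    by (rule exI[of _ "f(k := e)"]) (use f ee e0 sym in \<open>auto simp: less_Suc_eq\<close>)
qed simp

text \<open>If the columns of \<open>P\<close> are orthonormal for the inner product of \<open>S\<close>, then \<open>P\<^sup>T S P = 1\<close>, and \<open>A\<close> is the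
  inverse of \<open>P\<^sup>T\<close>.\<close>

lemma pos_def_factor:
  fixes S :: "real^'n^'n"
  assumes S: "pos_def S"
  obtains A :: "real^'n^'n" where "invertible A" "S = A ** transpose A"
proof -
  obtain f :: "nat \<Rightarrow> real^'n" where f: "\<And>i j. i < CARD('n) \<Longrightarrow> j < CARD('n) \<Longrightarrow> f i \<bullet> (S *v f j) = (if i = j then 1 else 0)"
    using pos_def_orthonormal_family[OF S, of "CARD('n)"] by auto
  obtain g :: "'n \<Rightarrow> nat" where g: "bij_betw g UNIV {0..<CARD('n)}"
    using ex_bij_betw_finite_nat[OF finite[of "UNIV :: 'n set"]] by auto
  then have g': "g i < CARD('n)" "g i = g j \<longleftrightarrow> i = j" for i j
    by (auto simp: bij_betw_def inj_eq)
  define P :: "real^'n^'n" where "P = (\<chi> i j. f (g j) $ i)"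
  have col: "P *v axis j 1 = f (g j)" for j
    by (simp add: matrix_vector_mult_basis column_def P_def)
  have PSP: "transpose P ** S ** P = mat 1"
  proof -
    have "(transpose P ** S ** P) $ i $ j = axis i 1 \<bullet> ((transpose P ** S ** P) *v axis j 1)" for i j
      by (simp add: matrix_vector_mult_basis column_def inner_axis' )
    also have "\<dots> i j = f (g i) \<bullet> (S *v f (g j))" for i j
      by (simp only: matrix_vector_mul_assoc[symmetric] col[symmetric] inner_transpose)
    finally show ?thesis
      by (simp add: vec_eq_iff mat_def f g')
  qed
  then have P: "invertible P" by (metis invertible_left_inverse)
  let ?Q = "matrix_inv P"
  have "S = transpose (P ** ?Q) ** S ** (P ** ?Q)"
    by (simp add: matrix_inv_inverse[OF P] transpose_mat)
  also have "\<dots> = transpose ?Q ** (transpose P ** S ** P) ** ?Q"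
    by (simp add: matrix_transpose_mul matrix_mul_assoc)
  also have "\<dots> = transpose ?Q ** transpose (transpose ?Q)"
    by (simp add: PSP)
  finally have "S = transpose ?Q ** transpose (transpose ?Q)" .
  moreover have "invertible (transpose ?Q)"
    by (intro transpose_invertible invertible_matrix_inv P)
  ultimately show ?thesis by (rule that[rotated])
qed

section \<open>The multivariate normal distribution\<close>

lemma prob_space_mvn: "pos_def S \<Longrightarrow> prob_space (mvn mu S)"
proof -
  assume "pos_def S"
  then obtain A :: "real^'a^'a" where A: "invertible A" "S = A ** transpose A" by (rule pos_def_factor)
  interpret prob_space "density lborel (\<lambda>z::real^'a. ennreal (gauss_density z))" by (rule prob_space_gauss)
  show ?thesis unfolding A(2) mvn_eq_distr_gauss[OF A(1)]
    by (rule prob_space_distr) simp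
qed

lemma sets_mvn [measurable_cong, simp]: "sets (mvn mu S) = sets borel" by (simp add: mvn_def)
lemma space_mvn [simp]: "space (mvn mu S) = UNIV" by (simp add: mvn_def)

lemma char_fun_mvn:
  fixes S :: "real^'n^'n"
  assumes "pos_def S"
  shows "char_fun (mvn mu S) (\<lambda>z. z) t = iexp (t \<bullet> mu) * complex_of_real (exp (- (t \<bullet> (S *v t)) / 2))"
proof -
  from assms obtain A :: "real^'n^'n" where A: "invertible A" "S = A ** transpose A" by (rule pos_def_factor)
  have "char_fun (mvn mu S) (\<lambda>z. z) t = (\<integral>z. gauss_density z *\<^sub>R iexp (t \<bullet> (mu + A *v z)) \<partial>lborel)"
    unfolding A(2) mvn_eq_distr_gauss[OF A(1)] char_fun_def
    by (simp add: integral_distr integral_density gauss_density_nonneg)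
  also have "\<dots> = (\<integral>z. iexp (t \<bullet> mu) * (gauss_density z *\<^sub>R iexp ((transpose A *v t) \<bullet> z)) \<partial>lborel)"
    by (intro Bochner_Integration.integral_cong refl)
       (simp add: inner_add_right exp_add distrib_left dot_lmul_matrix)
  also have "\<dots> = iexp (t \<bullet> mu) * complex_of_real (exp (- (norm (transpose A *v t))\<^sup>2 / 2))"
    by (simp only: integral_mult_right_zero gauss_fourier(2))
  also have "(norm (transpose A *v t))\<^sup>2 = t \<bullet> (S *v t)"
    by (simp only: A(2) power2_norm_eq_inner inner_transpose matrix_vector_mul_assoc transpose_transpose)
  finally show ?thesis .
qed

lemma scaleR_matrix_mult: "(c *\<^sub>R A) ** B = c *\<^sub>R (A ** B)" "A ** (c *\<^sub>R B) = c *\<^sub>R (A ** B)"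
  for A :: "real^'n^'m" and B :: "real^'k^'n"
  by (simp_all add: matrix_matrix_mult_def vec_eq_iff sum_distrib_left mult_ac)

lemma char_fun_distr: "X \<in> borel_measurable N \<Longrightarrow> char_fun (distr N borel X) (\<lambda>z. z) t = char_fun N X t"
  by (simp add: char_fun_def integral_distr)

lemma char_fun_affine:
  fixes B :: "real^'p^'q"
  shows "char_fun N (\<lambda>\<omega>. B *v X \<omega> + c) t = iexp (t \<bullet> c) * char_fun N X (transpose B *v t)"
proof -
  have "iexp (t \<bullet> (B *v X \<omega> + c)) = iexp (t \<bullet> c) * iexp ((transpose B *v t) \<bullet> X \<omega>)" for \<omega>
    by (simp add: inner_add_right dot_lmul_matrix exp_add[symmetric] distrib_left add.commute)
  then show ?thesis unfolding char_fun_def by (simp only: integral_mult_right_zero)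
qed

text \<open>Comparing characteristic functions covers rectangular \<open>B\<close>, for which a change of variables in the
  density is not available.\<close>

lemma mvn_affine:
  fixes B :: "real^'p^'q" and X :: "'b \<Rightarrow> real^'p"
  assumes N: "prob_space N" and X[measurable]: "X \<in> borel_measurable N" and law: "distr N borel X = mvn mu S"
    and S: "pos_def S" and S': "pos_def S'" "S' = B ** S ** transpose B"
  shows "distr N borel (\<lambda>\<omega>. B *v X \<omega> + c) = mvn (B *v mu + c) S'"
proof -
  have "distr N borel (\<lambda>\<omega>. B *v X \<omega> + c) = distr (mvn (B *v mu + c) S') borel (\<lambda>z. z)"
  proof (rule char_fun_unique[OF N prob_space_mvn[OF S'(1)]])
    have "(\<lambda>\<omega>. B *v X \<omega>) \<in> borel_measurable N"
      by (rule measurable_compose[OF X borel_measurable_matrix_vector_mult])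
    then show "(\<lambda>\<omega>. B *v X \<omega> + c) \<in> borel_measurable N" by measurable
    fix t
    have "char_fun N X (transpose B *v t) = char_fun (mvn mu S) (\<lambda>z. z) (transpose B *v t)"
      by (simp add: char_fun_distr[OF X, symmetric] law)
    also have "\<dots> = iexp ((transpose B *v t) \<bullet> mu) * complex_of_real (exp (- (t \<bullet> (S' *v t)) / 2))"
    proof -
      have "(transpose B *v t) \<bullet> (S *v (transpose B *v t)) = t \<bullet> (S' *v t)"
        by (simp only: S'(2) matrix_vector_mul_assoc[symmetric] inner_transpose transpose_transpose)
      then show ?thesis by (simp only: char_fun_mvn[OF S])
    qed
    also have "(transpose B *v t) \<bullet> mu = t \<bullet> (B *v mu)" by (simp only: inner_transpose transpose_transpose)
    finally show "char_fun N (\<lambda>\<omega>. B *v X \<omega> + c) t = char_fun (mvn (B *v mu + c) S') (\<lambda>z. z) t"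
      unfolding char_fun_affine char_fun_mvn[OF S'(1)]
      by (simp add: inner_add_right exp_add distrib_left mult_ac)
  qed simp
  also have "\<dots> = mvn (B *v mu + c) S'" by (intro distr_id2) simp
  finally show ?thesis .
qed

section \<open>Noncentral chi-squared laws and critical values\<close>

lemma pos_def_mat1: "pos_def (mat 1 :: real^'n^'n)"
  by (auto simp: pos_def_def transpose_mat)

text \<open>Some orthogonal map takes \<open>mu\<close> to \<open>mu'\<close>; it preserves norms and the identity covariance.\<close>

lemma noncentral_chi_square_cong:
  fixes mu mu' :: "real^'n"
  assumes "norm mu = norm mu'"
  shows "noncentral_chi_square mu = noncentral_chi_square mu'"
proof -
  obtain f where f: "orthogonal_transformation f" "f mu = mu'"
    using orthogonal_transformation_exists[OF assms] by metis
  let ?Q = "matrix f"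
  have Q: "?Q *v z = f z" for z
    using f(1) by (simp add: orthogonal_transformation_def linear_linear matrix_works)
  have oQ: "orthogonal_matrix ?Q" using f(1) by (simp add: orthogonal_transformation_matrix)
  have "distr (mvn mu (mat 1)) borel (\<lambda>z. ?Q *v z + 0) = mvn (?Q *v mu + 0) (mat 1)"
    by (rule mvn_affine[OF prob_space_mvn[OF pos_def_mat1]])
       (use oQ in \<open>auto simp: distr_id2 pos_def_mat1 orthogonal_matrix_def\<close>)
  then have "mvn mu' (mat 1) = distr (mvn mu (mat 1)) borel (\<lambda>z. ?Q *v z)" by (simp add: Q f)
  moreover have "norm (?Q *v z) = norm z" for z
    using f(1) by (simp add: Q orthogonal_transformation)
  ultimately show ?thesis
    by (simp add: noncentral_chi_square_def distr_distr comp_def)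
qed

text \<open>Write \<open>H C\<^sup>-\<^sup>1 H\<^sup>T = F F\<^sup>T\<close>. The quadratic form of the inverse is the squared norm after applying
  \<open>F\<^sup>-\<^sup>1\<close>, and \<open>F\<^sup>-\<^sup>1 (H C\<^sup>-\<^sup>1 W + \<xi>) / s\<close> is normal with identity covariance. By rotation invariance any mean of
  the right norm describes the law.\<close>

lemma restriction_form_law:
  fixes C :: "real^'p^'p" and H :: "real^'p^'q" and W :: "'b \<Rightarrow> real^'p" and mu :: "real^'q"
  assumes N: "prob_space N" and W[measurable]: "W \<in> borel_measurable N"
    and C: "pos_def C" and H: "rank H = CARD('q)" and s: "s > 0"
    and law: "distr N borel W = mvn 0 (s\<^sup>2 *\<^sub>R C)"
    and mu: "(norm mu)\<^sup>2 = restriction_form C H xi / s\<^sup>2"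
  shows "distr N borel (\<lambda>\<omega>. restriction_form C H (H *v (matrix_inv C *v W \<omega>) + xi) / s\<^sup>2) = noncentral_chi_square mu"
proof -
  let ?D = "matrix_inv C"
  let ?G = "H ** ?D ** transpose H"
  have G: "pos_def ?G" by (rule pos_def_restriction[OF C H])
  obtain F :: "real^'q^'q" where F: "invertible F" "?G = F ** transpose F" by (rule pos_def_factor[OF G])
  let ?R = "matrix_inv F"
  have form: "restriction_form C H y / s\<^sup>2 = (norm ((1 / s) *\<^sub>R (?R *v y)))\<^sup>2" for y
    using s unfolding restriction_form_def F(2) matrix_inv_mult_transpose[OF F(1)]
    by (simp add: power_divide)
  define B where "B = (1 / s) *\<^sub>R (?R ** H ** ?D)"
  have DT: "transpose ?D = ?D" using pos_def_matrix_inv[OF C] by (simp add: pos_def_def)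
  have tr: "transpose (c *\<^sub>R X) = c *\<^sub>R transpose X" for c and X :: "real^'p^'q"
    by (simp add: transpose_def vec_eq_iff)
  have "B ** (s\<^sup>2 *\<^sub>R C) ** transpose B = (?R ** H ** ?D) ** C ** transpose (?R ** H ** ?D)"
    using s by (simp add: B_def scaleR_matrix_mult tr power2_eq_square)
  also have "\<dots> = ?R ** H ** (?D ** C) ** ?D ** transpose H ** transpose ?R"
    by (simp add: matrix_transpose_mul DT matrix_mul_assoc)
  also have "\<dots> = ?R ** ?G ** transpose ?R"
    by (simp add: matrix_inv_inverse pos_def_invertible[OF C] matrix_mul_assoc)
  also have "\<dots> = (?R ** F) ** transpose (?R ** F)"
    unfolding F(2) by (simp add: matrix_transpose_mul matrix_mul_assoc)
  also have "\<dots> = mat 1" by (simp add: matrix_inv_inverse[OF F(1)] transpose_mat)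
  finally have BB: "mat 1 = B ** (s\<^sup>2 *\<^sub>R C) ** transpose B" by simp
  (* B whitens W: B (s^2 C) B^T = 1, and the quadratic form is the squared norm of B W + ?c *)
  let ?c = "(1 / s) *\<^sub>R (?R *v xi)"
  have lawZ: "distr N borel (\<lambda>\<omega>. B *v W \<omega> + ?c) = mvn ?c (mat 1)"
    using mvn_affine[OF N W law pos_def_scaleR[OF C] pos_def_mat1 BB, of ?c] s by simp
  have Zm: "(\<lambda>\<omega>. B *v W \<omega> + ?c) \<in> borel_measurable N"
    using measurable_compose[OF W borel_measurable_matrix_vector_mult[of B]] by measurable
  have eq: "(1 / s) *\<^sub>R (?R *v (H *v (?D *v W \<omega>) + xi)) = B *v W \<omega> + ?c" for \<omega>
    by (simp add: B_def matrix_vector_right_distrib scaleR_add_right scaleR_matrix_vector_assoc[symmetric] matrix_vector_mul_assoc matrix_mul_assoc)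
  have "distr N borel (\<lambda>\<omega>. restriction_form C H (H *v (?D *v W \<omega>) + xi) / s\<^sup>2) = distr N borel (\<lambda>\<omega>. (norm (B *v W \<omega> + ?c))\<^sup>2)"
    by (simp only: form eq)
  also have "\<dots> = distr (distr N borel (\<lambda>\<omega>. B *v W \<omega> + ?c)) borel (\<lambda>z. (norm z)\<^sup>2)"
    by (subst distr_distr) (auto simp: comp_def Zm)
  also have "\<dots> = noncentral_chi_square ?c" by (simp add: lawZ noncentral_chi_square_def)
  also have "\<dots> = noncentral_chi_square mu"
  proof (rule noncentral_chi_square_cong)
    have "(norm ?c)\<^sup>2 = (norm mu)\<^sup>2" using form[of xi] mu by simp
    then show "norm ?c = norm mu" by simp
  qed
  finally show ?thesis .
qed

lemma real_distribution_noncentral: "real_distribution (noncentral_chi_square (mu :: real^'n))"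
proof -
  interpret prob_space "mvn mu (mat 1)" by (rule prob_space_mvn[OF pos_def_mat1])
  show ?thesis unfolding noncentral_chi_square_def by (rule real_distribution_distr) simp
qed

text \<open>The normal density is positive everywhere, so Gaussian and Lebesgue null sets agree.\<close>

lemma mvn_mat1_null_iff:
  fixes mu :: "real^'n"
  assumes [measurable]: "S \<in> sets borel"
  shows "measure (mvn mu (mat 1)) S = 0 \<longleftrightarrow> S \<in> null_sets lborel"
proof -
  interpret prob_space "mvn mu (mat 1)" by (rule prob_space_mvn[OF pos_def_mat1])
  have [measurable]: "mvn_density mu (mat 1) \<in> borel_measurable borel"
    unfolding mvn_density_def[abs_def] matrix_inv_unique[of "mat 1" "mat 1", simplified] by simp
  have pos: "mvn_density mu (mat 1) z > 0" for z by (simp add: mvn_density_def)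
  have "measure (mvn mu (mat 1)) S = 0 \<longleftrightarrow> emeasure (mvn mu (mat 1)) S = 0"
    by (simp add: emeasure_eq_measure)
  also have "\<dots> \<longleftrightarrow> (AE z in lborel. z \<in> S \<longrightarrow> ennreal (mvn_density mu (mat 1) z) = 0)"
    using null_sets_density_iff[of "\<lambda>z. ennreal (mvn_density mu (mat 1) z)" lborel S]
    by (auto simp: mvn_def null_sets_def)
  also have "\<dots> \<longleftrightarrow> (AE z in lborel. z \<notin> S)"
    using pos by (simp add: ennreal_eq_0_iff not_le less_imp_neq[symmetric] flip: not_less)
  also have "\<dots> \<longleftrightarrow> S \<in> null_sets lborel"
    by (subst AE_iff_null_sets) auto
  finally show ?thesis .
qed

text \<open>An atom would be the Gaussian measure of a sphere.\<close>

lemma noncentral_chi_square_atomless: "measure (noncentral_chi_square (mu :: real^'n)) {t} = 0"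
proof -
  have "measure (noncentral_chi_square mu) {t} = measure (mvn mu (mat 1)) {z. (norm z)\<^sup>2 = t}"
    unfolding noncentral_chi_square_def by (subst measure_distr) (auto simp: vimage_def)
  also have "\<dots> = 0"
  proof (subst mvn_mat1_null_iff)
    show "{z :: real^'n. (norm z)\<^sup>2 = t} \<in> sets borel" by measurable
    have "{z :: real^'n. (norm z)\<^sup>2 = t} \<subseteq> sphere 0 (sqrt t)"
      by auto
    then have "negligible {z :: real^'n. (norm z)\<^sup>2 = t}"
      by (rule negligible_subset[OF negligible_sphere])
    then show "{z :: real^'n. (norm z)\<^sup>2 = t} \<in> null_sets lborel"
      by (simp add: negligible_iff_null_sets null_sets_completion_iff)
  qed
  finally show ?thesis .
qed

text \<open>The open shell between the radii \<open>\<surd>a\<close> and \<open>\<surd>c\<close> is nonempty, hence not a null set.\<close>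

lemma noncentral_chi_square_cdf_less:
  fixes mu :: "real^'n"
  assumes "0 \<le> a" "a < c"
  shows "cdf (noncentral_chi_square mu) a < cdf (noncentral_chi_square mu) c"
proof -
  interpret real_distribution "noncentral_chi_square mu" by (rule real_distribution_noncentral)
  let ?S = "{z :: real^'n. a < (norm z)\<^sup>2 \<and> (norm z)\<^sup>2 < c}"
  have S: "open ?S" by (intro open_Collect_conj open_Collect_less continuous_intros)
  have "sqrt ((a + c) / 2) *\<^sub>R axis undefined 1 \<in> ?S"
    using assms by (simp add: norm_axis_1)
  then have "?S \<noteq> {}" by blast
  then have "\<not> negligible ?S" using S open_not_negligible by blast
  then have "?S \<notin> null_sets lborel" using S
    by (simp add: negligible_iff_null_sets null_sets_completion_iff)
  then have "0 < measure (mvn mu (mat 1)) ?S"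
    using mvn_mat1_null_iff[of ?S mu] S by (simp add: zero_less_measure_iff)
  also have "\<dots> \<le> measure (mvn mu (mat 1)) {z. a < (norm z)\<^sup>2 \<and> (norm z)\<^sup>2 \<le> c}"
  proof -
    interpret P: prob_space "mvn mu (mat 1)" by (rule prob_space_mvn[OF pos_def_mat1])
    show ?thesis by (intro P.finite_measure_mono) (auto, measurable)
  qed
  also have "\<dots> = measure (noncentral_chi_square mu) {a<..c}"
    unfolding noncentral_chi_square_def by (subst measure_distr) (auto simp: vimage_def intro!: arg_cong[where f="measure _"])
  also have "\<dots> = cdf (noncentral_chi_square mu) c - cdf (noncentral_chi_square mu) a"
    using assms by (simp add: cdf_diff_eq)
  finally show ?thesis by simp
qed

lemma noncentral_chi_square_cdf_neg: "t < 0 \<Longrightarrow> cdf (noncentral_chi_square (mu :: real^'n)) t = 0"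
proof -
  assume t: "t < 0"
  have "cdf (noncentral_chi_square mu) t = measure (mvn mu (mat 1)) {z. (norm z)\<^sup>2 \<le> t}"
    unfolding noncentral_chi_square_def cdf_def by (subst measure_distr) (auto simp: vimage_def)
  also have "{z :: real^'n. (norm z)\<^sup>2 \<le> t} = {}"
    using t by (auto simp: not_le intro: less_le_trans)
  finally show ?thesis by simp
qed

lemma measure_greaterThan_cdf: "real_distribution D \<Longrightarrow> measure D {t<..} = 1 - cdf D t"
proof -
  assume "real_distribution D"
  then interpret real_distribution D .
  have "prob (space D - {..t}) = 1 - prob {..t}" by (rule prob_compl) simp
  moreover have "space D - {..t} = {t<..}" by auto
  ultimately show ?thesis by (simp add: cdf_def)
qed

text \<open>Strict monotonicity of the limiting distribution function separates its values from \<open>1 - alpha\<close> on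
  both sides of the critical value, so pointwise convergence traps the critical values of \<open>D n\<close>.\<close>

lemma upper_critical_value_tendsto:
  fixes D :: "nat \<Rightarrow> real measure"
  assumes D: "\<forall>\<^sub>F n in sequentially. real_distribution (D n)" and E: "real_distribution E"
    and lim: "\<And>t. (\<lambda>n. cdf (D n) t) \<longlonglongrightarrow> cdf E t"
    and neg: "\<And>t. t < 0 \<Longrightarrow> cdf E t = 0"
    and strict: "\<And>a c. 0 \<le> a \<Longrightarrow> a < c \<Longrightarrow> cdf E a < cdf E c"
    and alpha: "0 < alpha" "alpha < 1"
  shows "(\<lambda>n. upper_critical_value alpha (D n)) \<longlonglongrightarrow> upper_critical_value alpha E"
proof -
  interpret E: real_distribution E by fact
  let ?S = "\<lambda>D. {t. measure D {t<..} \<le> alpha}"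
  have S: "t \<in> ?S F \<longleftrightarrow> 1 - alpha \<le> cdf F t" if "real_distribution F" for F t
    by (auto simp: measure_greaterThan_cdf[OF that])
  let ?L = "upper_critical_value alpha E"
  have nonneg: "0 \<le> t" if "t \<in> ?S E" for t
    using that[unfolded S[OF E]] neg[of t] alpha by (cases "t < 0") auto
  then have bdd: "bdd_below (?S E)" by (rule bdd_belowI)
  have "\<forall>\<^sub>F t in at_top. 1 - alpha < cdf E t"
    using order_tendstoD(1)[OF E.cdf_lim_at_top_prob] alpha by simp
  then obtain t0 where "1 - alpha < cdf E t0" by (auto simp: eventually_at_top_linorder)
  then have ne: "?S E \<noteq> {}" using S[OF E, of t0] by auto
  have below: "cdf E t < 1 - alpha" if "t < ?L" for t
  proof (rule ccontr)
    assume "\<not> cdf E t < 1 - alpha"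
    then have "t \<in> ?S E" unfolding S[OF E] by simp
    then have "?L \<le> t" unfolding upper_critical_value_def by (rule cInf_lower[OF _ bdd])
    with that show False by simp
  qed
  have above: "1 - alpha < cdf E t" if t: "?L < t" for t
  proof -
    obtain t' where "t' \<in> ?S E" "t' < t"
      using t unfolding upper_critical_value_def by (auto dest: cInf_lessD[OF ne])
    with strict[OF nonneg, of t' t] S[OF E, of t'] show ?thesis by auto
  qed
  show ?thesis
  proof (rule order_tendstoI)
    fix a assume "a < ?L"
    then obtain t where t: "a < t" "t < ?L" using dense by blast
    have ev_t: "\<forall>\<^sub>F n in sequentially. cdf (D n) t < 1 - alpha"
      by (rule order_tendstoD(2)[OF lim below[OF t(2)]])
    (* guards against an empty set, whose infimum is unspecified *)
    have ev_u: "\<forall>\<^sub>F n in sequentially. 1 - alpha < cdf (D n) (?L + 1)"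
      by (rule order_tendstoD(1)[OF lim above]) simp
    show "\<forall>\<^sub>F n in sequentially. a < upper_critical_value alpha (D n)"
      using D ev_t ev_u
    proof eventually_elim
      case (elim n)
      interpret Dn: real_distribution "D n" by fact
      have "t \<le> upper_critical_value alpha (D n)"
        unfolding upper_critical_value_def
      proof (rule cInf_greatest)
        show "?S (D n) \<noteq> {}" using S[OF elim(1), of "?L + 1"] elim(3) by auto
        fix s assume "s \<in> ?S (D n)"
        then have "1 - alpha \<le> cdf (D n) s" unfolding S[OF elim(1)] .
        with elim(2) show "t \<le> s" using Dn.cdf_nondecreasing[of s t] by (cases "t \<le> s") auto
      qed
      with t(1) show ?case by simp
    qed
  next
    fix a assume "?L < a"
    then obtain t where t: "?L < t" "t < a" using dense by blast
    have ev_t: "\<forall>\<^sub>F n in sequentially. 1 - alpha < cdf (D n) t"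
      by (rule order_tendstoD(1)[OF lim above[OF t(1)]])
    (* guards against a set without lower bound *)
    have ev_u: "\<forall>\<^sub>F n in sequentially. cdf (D n) (?L - 1) < 1 - alpha"
      by (rule order_tendstoD(2)[OF lim below]) simp
    show "\<forall>\<^sub>F n in sequentially. upper_critical_value alpha (D n) < a"
      using D ev_t ev_u
    proof eventually_elim
      case (elim n)
      interpret Dn: real_distribution "D n" by fact
      have "bdd_below (?S (D n))"
      proof (rule bdd_belowI)
        fix s assume "s \<in> ?S (D n)"
        then have "1 - alpha \<le> cdf (D n) s" unfolding S[OF elim(1)] .
        with elim(3) show "?L - 1 \<le> s" using Dn.cdf_nondecreasing[of s "?L - 1"] by (cases "?L - 1 \<le> s") auto
      qed
      moreover have "t \<in> ?S (D n)" unfolding S[OF elim(1)] using elim(2) by simp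
      ultimately have "upper_critical_value alpha (D n) \<le> t"
        unfolding upper_critical_value_def by (rule cInf_lower[rotated])
      with t(2) show ?case by simp
    qed
  qed
qed

section \<open>Continuity of matrix operations\<close>

lemma tendsto_matrix_vector_mult:
  fixes A :: "'x \<Rightarrow> real^'n^'m"
  assumes "(A \<longlongrightarrow> A0) F" "(u \<longlongrightarrow> u0) F"
  shows "((\<lambda>x. A x *v u x) \<longlongrightarrow> A0 *v u0) F"
  unfolding matrix_vector_mult_def
  by (intro tendsto_vec_lambda tendsto_sum tendsto_mult tendsto_vec_nth assms)

lemma tendsto_matrix_mult:
  fixes A :: "'x \<Rightarrow> real^'n^'m" and B :: "'x \<Rightarrow> real^'k^'n"
  assumes "(A \<longlongrightarrow> A0) F" "(B \<longlongrightarrow> B0) F"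
  shows "((\<lambda>x. A x ** B x) \<longlongrightarrow> A0 ** B0) F"
  unfolding matrix_matrix_mult_def
  by (intro tendsto_vec_lambda tendsto_sum tendsto_mult tendsto_vec_nth assms)

lemma tendsto_det:
  fixes A :: "'x \<Rightarrow> real^'n^'n"
  assumes "(A \<longlongrightarrow> A0) F"
  shows "((\<lambda>x. det (A x)) \<longlongrightarrow> det A0) F"
  unfolding det_def
  by (intro tendsto_sum tendsto_mult tendsto_const tendsto_prod tendsto_vec_nth assms)

text \<open>Cramer's rule; it makes continuity of the inverse a consequence of continuity of the determinant.\<close>

lemma matrix_inv_entry:
  fixes A :: "real^'n^'n"
  assumes "det A \<noteq> 0"
  shows "matrix_inv A $ j $ k = det (\<chi> i l. if l = j then axis k 1 $ i else A $ i $ l) / det A"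
proof -
  have "A *v (matrix_inv A *v axis k 1) = axis k 1" using assms by (simp add: invertible_det_nz)
  then have "matrix_inv A *v axis k 1 = (\<chi> j. det (\<chi> i l. if l = j then axis k 1 $ i else A $ i $ l) / det A)"
    using cramer[OF assms] by blast
  then show ?thesis by (simp add: matrix_vector_mult_basis column_def vec_eq_iff)
qed

lemma tendsto_matrix_inv:
  fixes A :: "'x \<Rightarrow> real^'n^'n"
  assumes A: "(A \<longlongrightarrow> A0) F" and A0: "invertible A0"
  shows "((\<lambda>x. matrix_inv (A x)) \<longlongrightarrow> matrix_inv A0) F"
proof -
  have d0: "det A0 \<noteq> 0" using A0 by (simp add: invertible_det_nz)
  have d: "((\<lambda>x. det (A x)) \<longlongrightarrow> det A0) F" by (rule tendsto_det[OF A])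
  have nz: "\<forall>\<^sub>F x in F. det (A x) \<noteq> 0" by (rule tendsto_imp_eventually_ne[OF d d0])
  show ?thesis
  proof (intro vec_tendstoI)
    fix j k
    let ?c = "\<lambda>A. (\<chi> i l. if l = j then axis k 1 $ i else A $ i $ l) :: real^'n^'n"
    have "((\<lambda>x. ?c (A x)) \<longlongrightarrow> ?c A0) F"
      by (intro tendsto_vec_lambda) (auto intro!: tendsto_vec_nth A)
    then have "((\<lambda>x. det (?c (A x)) / det (A x)) \<longlongrightarrow> det (?c A0) / det A0) F"
      by (intro tendsto_divide tendsto_det d d0)
    moreover have "\<forall>\<^sub>F x in F. matrix_inv (A x) $ j $ k = det (?c (A x)) / det (A x)"
      using nz by eventually_elim (rule matrix_inv_entry)
    ultimately show "((\<lambda>x. matrix_inv (A x) $ j $ k) \<longlongrightarrow> matrix_inv A0 $ j $ k) F"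
      unfolding matrix_inv_entry[OF d0] by (simp add: tendsto_cong)
  qed
qed

lemma quadratic_form_bound: "\<bar>u \<bullet> (A *v u)\<bar> \<le> (\<Sum>i\<in>UNIV. \<Sum>j\<in>UNIV. \<bar>A $ i $ j\<bar>) * (norm u)\<^sup>2"
  for A :: "real^'n^'n"
proof -
  have "\<bar>u \<bullet> (A *v u)\<bar> = \<bar>\<Sum>i\<in>UNIV. \<Sum>j\<in>UNIV. u $ i * (A $ i $ j * u $ j)\<bar>"
    by (simp add: inner_vec_def matrix_vector_mult_def sum_distrib_left)
  also have "\<dots> \<le> (\<Sum>i\<in>UNIV. \<Sum>j\<in>UNIV. \<bar>u $ i * (A $ i $ j * u $ j)\<bar>)"
    by (intro order_trans[OF sum_abs] sum_mono sum_abs)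
  also have "\<dots> \<le> (\<Sum>i\<in>UNIV. \<Sum>j\<in>UNIV. \<bar>A $ i $ j\<bar> * (norm u)\<^sup>2)"
  proof (intro sum_mono)
    fix i j
    have "\<bar>u $ i\<bar> * \<bar>u $ j\<bar> \<le> norm u * norm u"
      by (intro mult_mono component_le_norm_cart) auto
    then have "\<bar>A $ i $ j\<bar> * (\<bar>u $ i\<bar> * \<bar>u $ j\<bar>) \<le> \<bar>A $ i $ j\<bar> * (norm u)\<^sup>2"
      by (intro mult_left_mono) (auto simp: power2_eq_square)
    then show "\<bar>u $ i * (A $ i $ j * u $ j)\<bar> \<le> \<bar>A $ i $ j\<bar> * (norm u)\<^sup>2"
      by (simp add: abs_mult mult_ac)
  qed
  finally show ?thesis by (simp add: sum_distrib_right)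
qed

text \<open>A quantitative form of positive definiteness that survives small perturbations and bounds minimisers.\<close>

definition coercive :: "real \<Rightarrow> real^'n^'n \<Rightarrow> bool" where
  "coercive m A \<longleftrightarrow> (\<forall>u. m * (norm u)\<^sup>2 \<le> u \<bullet> (A *v u))"

text \<open>The constant is the minimum of the quadratic form on the unit sphere.\<close>

lemma pos_def_coercive:
  fixes C :: "real^'n^'n"
  assumes "pos_def C"
  obtains m where "m > 0" "coercive m C"
proof -
  have "\<exists>z\<in>sphere 0 1. \<forall>u\<in>sphere (0::real^'n) 1. z \<bullet> (C *v z) \<le> u \<bullet> (C *v u)"
    by (intro continuous_attains_inf compact_sphere continuous_intros
        linear_continuous_on matrix_vector_mul_bounded_linear)
       (auto simp: sphere_eq_empty)
  then obtain z where z: "norm z = 1" "\<And>u. norm u = 1 \<Longrightarrow> z \<bullet> (C *v z) \<le> u \<bullet> (C *v u)" by auto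
  let ?m = "z \<bullet> (C *v z)"
  have "coercive ?m C"
    unfolding coercive_def
  proof
    fix u
    show "?m * (norm u)\<^sup>2 \<le> u \<bullet> (C *v u)"
    proof (cases "u = 0")
      case False
      have "norm ((1 / norm u) *\<^sub>R u) = 1" using False by simp
      from z(2)[OF this] have "?m \<le> (u \<bullet> (C *v u)) / (norm u)\<^sup>2"
        by (simp add: matrix_vector_mult_scaleR power2_eq_square)
      then show ?thesis using False by (simp add: field_simps)
    qed simp
  qed
  moreover have "z \<noteq> 0" using z(1) by auto
  then have "?m > 0" using assms by (simp add: pos_def_def)
  ultimately show ?thesis by (rule that[rotated])
qed

lemma eventually_coercive:
  fixes A :: "'x \<Rightarrow> real^'n^'n"
  assumes A: "(A \<longlongrightarrow> C) F" and C: "coercive m C" and m: "m > 0"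
  shows "\<forall>\<^sub>F x in F. coercive (m / 2) (A x)"
proof -
  have "((\<lambda>x. \<Sum>i\<in>UNIV. \<Sum>j\<in>UNIV. \<bar>(A x - C) $ i $ j\<bar>) \<longlongrightarrow> (\<Sum>i\<in>(UNIV::'n set). \<Sum>j\<in>(UNIV::'n set). \<bar>(C - C) $ i $ j\<bar>)) F"
    by (intro tendsto_intros A)
  then have "\<forall>\<^sub>F x in F. (\<Sum>i\<in>UNIV. \<Sum>j\<in>UNIV. \<bar>(A x - C) $ i $ j\<bar>) < m / 2"
    using m by (intro order_tendstoD) auto
  then show ?thesis
  proof eventually_elim
    case (elim x)
    show ?case unfolding coercive_def
    proof
      fix u
      have "\<bar>u \<bullet> ((A x - C) *v u)\<bar> \<le> m / 2 * (norm u)\<^sup>2"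
        by (rule order_trans[OF quadratic_form_bound mult_right_mono]) (use elim in auto)
      moreover have "u \<bullet> (A x *v u) = u \<bullet> (C *v u) + u \<bullet> ((A x - C) *v u)"
        by (simp add: matrix_vector_mult_diff_rdistrib inner_diff_right)
      moreover have "m * (norm u)\<^sup>2 \<le> u \<bullet> (C *v u)" using C by (simp add: coercive_def)
      ultimately show "m / 2 * (norm u)\<^sup>2 \<le> u \<bullet> (A x *v u)" by (simp add: abs_le_iff)
    qed
  qed
qed

section \<open>Minimisers of penalized quadratic forms\<close>

definition penalized_quadratic :: "real^'n^'n \<Rightarrow> (real^'n \<Rightarrow> real) \<Rightarrow> real^'n \<Rightarrow> real^'n \<Rightarrow> real" where
  "penalized_quadratic A P w u = - 2 * (u \<bullet> w) + u \<bullet> (A *v u) + P u"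

text \<open>Convexity enters the arguments below only through midpoints. The growth bound gives \<open>P 0 = 0\<close> and
  makes the quadratic part dominate at infinity.\<close>

definition admissible_penalty :: "real \<Rightarrow> (real^'n \<Rightarrow> real) \<Rightarrow> bool" where
  "admissible_penalty K P \<longleftrightarrow> continuous_on UNIV P \<and> (\<forall>u. \<bar>P u\<bar> \<le> K * norm u) \<and>
     (\<forall>u v. P ((1 / 2) *\<^sub>R (u + v)) \<le> (P u + P v) / 2)"

lemma penalized_quadratic_lower:
  assumes "coercive m A" "admissible_penalty K P"
  shows "m * (norm u)\<^sup>2 - (2 * norm w + K) * norm u \<le> penalized_quadratic A P w u"
proof -
  have "m * (norm u)\<^sup>2 \<le> u \<bullet> (A *v u)" using assms by (simp add: coercive_def)
  moreover have "- (K * norm u) \<le> P u" using assms by (auto simp: admissible_penalty_def abs_le_iff minus_le_iff)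
  moreover have "u \<bullet> w \<le> norm u * norm w" by (rule norm_cauchy_schwarz)
  ultimately show ?thesis by (simp add: penalized_quadratic_def algebra_simps)
qed

lemma penalized_quadratic_0: "admissible_penalty K P \<Longrightarrow> penalized_quadratic A P w 0 = 0"
  by (auto simp: penalized_quadratic_def admissible_penalty_def dest: spec[of _ 0])

lemma penalized_quadratic_exists_min:
  assumes A: "coercive m A" "m > 0" and P: "admissible_penalty K P"
  shows "\<exists>a. \<forall>u. penalized_quadratic A P w a \<le> penalized_quadratic A P w u"
proof -
  (* outside the ball of radius ?R the quadratic part dominates and the criterion is nonnegative *)
  let ?f = "penalized_quadratic A P w" and ?R = "\<bar>(2 * norm w + K) / m\<bar>"
  have "\<exists>a\<in>cball 0 ?R. \<forall>u\<in>cball 0 ?R. ?f a \<le> ?f u"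
  proof (rule continuous_attains_inf)
    show "continuous_on (cball 0 ?R) ?f"
    proof -
      have "continuous_on (cball 0 ?R) P"
        using P by (auto simp: admissible_penalty_def intro: continuous_on_subset)
      moreover have "continuous_on (cball 0 ?R) ((*v) A)"
        by (intro linear_continuous_on matrix_vector_mul_bounded_linear)
      ultimately show ?thesis
        unfolding penalized_quadratic_def[abs_def] by (intro continuous_intros)
    qed
  qed (auto simp del: abs_divide)
  then obtain a where "\<forall>u\<in>cball 0 ?R. ?f a \<le> ?f u" by blast
  then have a: "?f a \<le> ?f u" if "norm u \<le> ?R" for u using that by (simp del: abs_divide)
  have "?f a \<le> ?f u" for u
  proof (cases "norm u \<le> ?R")
    case False
    then have "2 * norm w + K \<le> m * norm u" using A(2) by (simp add: field_simps abs_if split: if_splits)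
    then have "(2 * norm w + K) * norm u \<le> m * norm u * norm u" by (intro mult_right_mono) auto
    then have "0 \<le> ?f u" using penalized_quadratic_lower[OF A(1) P, of u w] by (simp add: power2_eq_square)
    moreover have "?f a \<le> ?f 0" by (rule a) simp
    ultimately show ?thesis by (simp add: penalized_quadratic_0[OF P])
  qed (rule a)
  then show ?thesis by blast
qed

text \<open>Strong convexity at a minimiser \<open>a\<close>: compare the value at \<open>a\<close> with the value at the midpoint of \<open>a\<close> and
  \<open>u\<close>, where the quadratic form is smaller than the mean by a quarter of its value at \<open>u - a\<close>.\<close>

lemma penalized_quadratic_gap:
  assumes A: "coercive m A" and P: "admissible_penalty K P"
    and a: "\<And>u. penalized_quadratic A P w a \<le> penalized_quadratic A P w u"
  shows "penalized_quadratic A P w a + m / 2 * (norm (u - a))\<^sup>2 \<le> penalized_quadratic A P w u"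
proof -
  let ?f = "penalized_quadratic A P w" and ?z = "(1 / 2) *\<^sub>R (u + a)"
  have "?z \<bullet> (A *v ?z) = (u \<bullet> (A *v u) + a \<bullet> (A *v a)) / 2 - ((u - a) \<bullet> (A *v (u - a))) / 4"
    by (simp add: matrix_vector_mult_scaleR matrix_vector_right_distrib matrix_vector_mult_diff_distrib
        inner_add_left inner_add_right inner_diff_left inner_diff_right field_simps)
  moreover have "m * (norm (u - a))\<^sup>2 \<le> (u - a) \<bullet> (A *v (u - a))" using A by (simp add: coercive_def)
  moreover have "P ?z \<le> (P u + P a) / 2" using P by (auto simp: admissible_penalty_def)
  moreover have "?z \<bullet> w = (u \<bullet> w + a \<bullet> w) / 2" by (simp add: inner_add_left)
  ultimately have "?f ?z \<le> (?f u + ?f a) / 2 - m / 4 * (norm (u - a))\<^sup>2"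
    unfolding penalized_quadratic_def by (simp add: field_simps)
  with a[of ?z] show ?thesis by (simp add: field_simps)
qed

definition penalized_argmin :: "real^'n^'n \<Rightarrow> (real^'n \<Rightarrow> real) \<Rightarrow> real^'n \<Rightarrow> real^'n" where
  "penalized_argmin A P w = (ARG_MIN (penalized_quadratic A P w) u. True)"

lemma penalized_argmin_min:
  assumes A: "coercive m A" "m > 0" and P: "admissible_penalty K P"
  shows "penalized_quadratic A P w (penalized_argmin A P w) \<le> penalized_quadratic A P w u"
proof -
  have "\<exists>a. is_arg_min (penalized_quadratic A P w) (\<lambda>_. True) a"
    using penalized_quadratic_exists_min[OF assms] by (simp add: is_arg_min_linorder)
  then have "is_arg_min (penalized_quadratic A P w) (\<lambda>_. True) (penalized_argmin A P w)"
    unfolding penalized_argmin_def arg_min_def by (rule someI_ex)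
  then show ?thesis by (simp add: is_arg_min_linorder)
qed

lemma penalized_argmin_unique:
  assumes A: "coercive m A" "m > 0" and P: "admissible_penalty K P"
    and a: "\<And>u. penalized_quadratic A P w a \<le> penalized_quadratic A P w u"
  shows "a = penalized_argmin A P w"
proof -
  have "m / 2 * (norm (penalized_argmin A P w - a))\<^sup>2 \<le> 0"
    using penalized_quadratic_gap[OF A(1) P a, of "penalized_argmin A P w"] penalized_argmin_min[OF assms(1-3), of w a]
    by linarith
  then show ?thesis using A(2) by (simp add: mult_le_0_iff)
qed

lemma penalized_argmin_norm:
  assumes A: "coercive m A" "m > 0" and P: "admissible_penalty K P" and K: "K \<ge> 0"
  shows "norm (penalized_argmin A P w) \<le> (2 * norm w + K) / m"
proof -
  let ?a = "penalized_argmin A P w"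
  have "m * (norm ?a)\<^sup>2 - (2 * norm w + K) * norm ?a \<le> 0"
    using penalized_quadratic_lower[OF A(1) P, of ?a w] penalized_argmin_min[OF assms(1-3), of w 0]
    by (simp add: penalized_quadratic_0[OF P])
  then have "norm ?a * (m * norm ?a) \<le> norm ?a * (2 * norm w + K)"
    by (simp add: power2_eq_square algebra_simps)
  then have "m * norm ?a \<le> 2 * norm w + K"
    using K by (cases "?a = 0") auto
  then show ?thesis using A(2) by (simp add: field_simps)
qed

text \<open>Each minimiser has a gap to the other one in its own criterion; in the sum of the two inequalities only the
  difference of the linear terms remains. This yields measurability of the lasso in the errors.\<close>

lemma penalized_argmin_lipschitz:
  assumes A: "coercive m A" "m > 0" and P: "admissible_penalty K P"
  shows "norm (penalized_argmin A P w - penalized_argmin A P w') \<le> 2 / m * norm (w - w')"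
proof -
  let ?a = "penalized_argmin A P w" and ?b = "penalized_argmin A P w'"
  let ?d = "norm (?a - ?b)"
  have "penalized_quadratic A P w ?a + m / 2 * ?d\<^sup>2 \<le> penalized_quadratic A P w ?b"
    using penalized_quadratic_gap[OF A(1) P penalized_argmin_min[OF assms], of w ?b] by (simp add: norm_minus_commute)
  moreover have "penalized_quadratic A P w' ?b + m / 2 * ?d\<^sup>2 \<le> penalized_quadratic A P w' ?a"
    by (rule penalized_quadratic_gap[OF A(1) P penalized_argmin_min[OF assms]])
  ultimately have "m * ?d\<^sup>2 \<le> 2 * ((?a - ?b) \<bullet> (w - w'))"
    by (simp add: penalized_quadratic_def inner_diff_left inner_diff_right)
  also have "\<dots> \<le> 2 * (?d * norm (w - w'))"
    using norm_cauchy_schwarz[of "?a - ?b" "w - w'"] by simp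
  finally have "?d * (m * ?d) \<le> ?d * (2 * norm (w - w'))" by (simp add: power2_eq_square mult_ac)
  then have "m * ?d \<le> 2 * norm (w - w')" by (cases "?a = ?b") auto
  then show ?thesis using A(2) by (simp add: field_simps)
qed

lemma continuous_on_penalized_argmin:
  assumes A: "coercive m A" "m > 0" and P: "admissible_penalty K P"
  shows "continuous_on UNIV (penalized_argmin A P)"
proof (rule lipschitz_on_continuous_on[where L="2 / m"], rule lipschitz_onI)
  show "dist (penalized_argmin A P w) (penalized_argmin A P w') \<le> 2 / m * dist w w'" for w w'
    unfolding dist_norm by (rule penalized_argmin_lipschitz[OF assms])
qed (use A in simp)

section \<open>The rescaled absolute-value penalty\<close>

text \<open>The difference quotient of \<open>\<bar>b + \<cdot>\<bar>\<close> at step size \<open>r\<close>, extended to \<open>r = 0\<close> by the directional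
  derivative, so that the penalties of the lasso at \<open>r = 1 / \<surd>n\<close> and of the limiting criterion at \<open>r = 0\<close>
  belong to one family.\<close>

definition abs_increment :: "real \<Rightarrow> real \<Rightarrow> real \<Rightarrow> real" where
  "abs_increment r b s =
     (if r = 0 then s * sgn b * of_bool (b \<noteq> 0) + \<bar>s\<bar> * of_bool (b = 0) else (\<bar>b + r * s\<bar> - \<bar>b\<bar>) / r)"

definition l1_penalty :: "real \<Rightarrow> real \<Rightarrow> real^'n \<Rightarrow> real^'n \<Rightarrow> real" where
  "l1_penalty l r b u = l * (\<Sum>j\<in>UNIV. abs_increment r (b $ j) (u $ j))"

lemma abs_increment_bound: "r \<ge> 0 \<Longrightarrow> \<bar>abs_increment r b s\<bar> \<le> \<bar>s\<bar>"
proof (cases "r = 0")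
  case False
  assume "r \<ge> 0"
  with False have r: "r > 0" by simp
  have "\<bar>\<bar>b + r * s\<bar> - \<bar>b\<bar>\<bar> \<le> \<bar>r * s\<bar>" by linarith
  then show ?thesis using r False by (simp add: abs_increment_def abs_mult field_simps)
qed (auto simp: abs_increment_def abs_mult abs_sgn_eq)

lemma abs_increment_midpoint:
  assumes "r \<ge> 0"
  shows "abs_increment r b ((s + s') / 2) \<le> (abs_increment r b s + abs_increment r b s') / 2"
proof (cases "r = 0")
  case True
  have "\<bar>(s + s') / 2\<bar> \<le> (\<bar>s\<bar> + \<bar>s'\<bar>) / 2" using abs_triangle_ineq[of s s'] by simp
  with True show ?thesis by (simp add: abs_increment_def field_simps)
next
  case False
  with assms have r: "r > 0" by simp
  have shift: "x - c \<le> ((y - c) + (z - c)) / 2" if "x \<le> (y + z) / 2" for x y z c :: real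
    using that by (simp add: field_simps)
  have "b + r * ((s + s') / 2) = ((b + r * s) + (b + r * s')) / 2" by (simp add: field_simps)
  then have "\<bar>b + r * ((s + s') / 2)\<bar> = \<bar>(b + r * s) + (b + r * s')\<bar> / 2"
    by (simp only: abs_divide abs_numeral)
  also have "\<dots> \<le> (\<bar>b + r * s\<bar> + \<bar>b + r * s'\<bar>) / 2"
    by (intro divide_right_mono abs_triangle_ineq) simp
  finally have "\<bar>b + r * ((s + s') / 2)\<bar> \<le> (\<bar>b + r * s\<bar> + \<bar>b + r * s'\<bar>) / 2" .
  then have "\<bar>b + r * ((s + s') / 2)\<bar> - \<bar>b\<bar> \<le> ((\<bar>b + r * s\<bar> - \<bar>b\<bar>) + (\<bar>b + r * s'\<bar> - \<bar>b\<bar>)) / 2"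
    by (rule shift)
  then have "(\<bar>b + r * ((s + s') / 2)\<bar> - \<bar>b\<bar>) / r \<le> (((\<bar>b + r * s\<bar> - \<bar>b\<bar>) + (\<bar>b + r * s'\<bar> - \<bar>b\<bar>)) / 2) / r"
    using r by (intro divide_right_mono) auto
  also have "\<dots> = ((\<bar>b + r * s\<bar> - \<bar>b\<bar>) / r + (\<bar>b + r * s'\<bar> - \<bar>b\<bar>) / r) / 2"
    by (simp only: add_divide_distrib divide_divide_eq_left mult.commute)
  finally show ?thesis unfolding abs_increment_def if_not_P[OF False] .
qed

text \<open>The absolute value is linear on each side of zero, so the difference quotient equals the directional
  derivative as soon as the step does not cross zero.\<close>

lemma abs_increment_eq_0:
  assumes "r \<ge> 0" "\<bar>s\<bar> \<le> R" "b \<noteq> 0 \<Longrightarrow> r * R < \<bar>b\<bar>"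
  shows "abs_increment r b s = abs_increment 0 b s"
proof (cases "r = 0 \<or> b = 0")
  case True
  then show ?thesis using assms(1) by (auto simp: abs_increment_def abs_mult)
next
  case False
  then have r: "r > 0" and b: "b \<noteq> 0" using assms by auto
  have "\<bar>r * s\<bar> \<le> r * R" using r assms(2) by (simp add: abs_mult)
  with assms(3)[OF b] have "\<bar>r * s\<bar> < \<bar>b\<bar>" by linarith
  then have "\<bar>b + r * s\<bar> - \<bar>b\<bar> = r * s * sgn b" by (auto simp: sgn_if abs_if split: if_splits)
  then show ?thesis using r b by (simp add: abs_increment_def)
qed

lemma l1_penalty_admissible:
  fixes l r :: real
  assumes r: "r \<ge> 0" and l: "l \<ge> 0"
  shows "admissible_penalty (l * CARD('n)) (l1_penalty l r (b :: real^'n))"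
  unfolding admissible_penalty_def
proof (intro conjI allI)
  have "continuous_on UNIV (\<lambda>u :: real^'n. abs_increment r (b $ j) (u $ j))" for j
    unfolding abs_increment_def by (cases "r = 0") (auto intro!: continuous_intros)
  then show "continuous_on UNIV (l1_penalty l r b)"
    unfolding l1_penalty_def[abs_def] by (intro continuous_intros)
  fix u v :: "real^'n"
  have "\<bar>\<Sum>j\<in>UNIV. abs_increment r (b $ j) (u $ j)\<bar> \<le> (\<Sum>j\<in>(UNIV::'n set). norm u)"
    by (intro order_trans[OF sum_abs] sum_mono order_trans[OF abs_increment_bound[OF r]] component_le_norm_cart)
  from mult_left_mono[OF this l] show "\<bar>l1_penalty l r b u\<bar> \<le> l * CARD('n) * norm u"
    using l by (simp add: l1_penalty_def abs_mult mult_ac)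
  have "(\<Sum>j\<in>UNIV. abs_increment r (b $ j) ((u $ j + v $ j) / 2)) \<le>
      (\<Sum>j\<in>UNIV. (abs_increment r (b $ j) (u $ j) + abs_increment r (b $ j) (v $ j)) / 2)"
    by (intro sum_mono abs_increment_midpoint r)
  from mult_left_mono[OF this l]
  show "l1_penalty l r b ((1 / 2) *\<^sub>R (u + v)) \<le> (l1_penalty l r b u + l1_penalty l r b v) / 2"
    by (simp add: l1_penalty_def sum.distrib sum_divide_distrib[symmetric] distrib_left add_divide_distrib)
qed

lemma limit_criterion_eq: "limit_criterion C l b w = penalized_quadratic C (l1_penalty l 0 b) w"
  by (rule ext) (simp add: limit_criterion_def penalized_quadratic_def l1_penalty_def abs_increment_def)

text \<open>Both minimisers lie in a fixed ball. Adding the gap inequalities of the two criteria bounds their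
  squared distance by twice the uniform distance of the criteria on this ball, up to a constant. That
  distance vanishes because for small \<open>r\<close> the penalties differ on the ball by the factor in front only.\<close>

theorem penalized_argmin_tendsto:
  fixes A :: "'x \<Rightarrow> real^'n^'n"
  assumes A: "(A \<longlongrightarrow> C) F" and C: "pos_def C" and w: "(w \<longlongrightarrow> w0) F"
    and r: "(r \<longlongrightarrow> 0) F" "\<forall>\<^sub>F x in F. r x \<ge> 0"
    and l: "(l \<longlongrightarrow> l0) F" "\<forall>\<^sub>F x in F. l x \<ge> 0" and l0: "l0 \<ge> 0"
  shows "((\<lambda>x. penalized_argmin (A x) (l1_penalty (l x) (r x) b) (w x)) \<longlongrightarrow> penalized_argmin C (l1_penalty l0 0 b) w0) F"
proof -
  obtain m0 where m0: "m0 > 0" "coercive m0 C" by (rule pos_def_coercive[OF C])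
  define m where "m = m0 / 2"
  have m: "m > 0" using m0 by (simp add: m_def)
  have Cm: "coercive m C"
    unfolding coercive_def
  proof
    fix u
    have "m0 * (norm u)\<^sup>2 \<le> u \<bullet> (C *v u)" using m0 by (simp add: coercive_def)
    moreover have "m * (norm u)\<^sup>2 \<le> m0 * (norm u)\<^sup>2" using m0 by (intro mult_right_mono) (auto simp: m_def)
    ultimately show "m * (norm u)\<^sup>2 \<le> u \<bullet> (C *v u)" by linarith
  qed
  (* R bounds all minimisers with parameters near the limit *)
  define R where "R = (2 * (norm w0 + 1) + (l0 + 1) * CARD('n)) / m"
  define a where "a x = penalized_argmin (A x) (l1_penalty (l x) (r x) b) (w x)" for x
  define a0 where "a0 = penalized_argmin C (l1_penalty l0 0 b) w0"
  (* \<delta> bounds the distance of the two criteria on the ball of radius R *)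
  define \<delta> where "\<delta> x = 2 * R * norm (w x - w0) + (\<Sum>i\<in>UNIV. \<Sum>j\<in>UNIV. \<bar>(A x - C) $ i $ j\<bar>) * R\<^sup>2 + \<bar>l x - l0\<bar> * (CARD('n) * R)" for x
  have R0: "R \<ge> 0" using m l0 by (simp add: R_def)
  have P0: "admissible_penalty (l0 * CARD('n)) (l1_penalty l0 0 b)" by (rule l1_penalty_admissible) (use l0 in auto)
  have "l0 * real CARD('n) \<le> (l0 + 1) * real CARD('n)" by (intro mult_right_mono) auto
  then have a0R: "norm a0 \<le> R"
    unfolding a0_def R_def
    by (intro order_trans[OF penalized_argmin_norm[OF Cm m P0]] divide_right_mono add_mono) (use l0 m in auto)
  have ev_small: "\<forall>\<^sub>F x in F. \<forall>j. b $ j \<noteq> 0 \<longrightarrow> r x * R < \<bar>b $ j\<bar>"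
  proof (rule eventually_all_finite)
    fix j
    have "((\<lambda>x. r x * R) \<longlongrightarrow> 0 * R) F" by (intro tendsto_intros r)
    then have "\<forall>\<^sub>F x in F. r x * R < \<bar>b $ j\<bar>" if "b $ j \<noteq> 0"
      using that by (intro order_tendstoD(2)) auto
    then show "\<forall>\<^sub>F x in F. b $ j \<noteq> 0 \<longrightarrow> r x * R < \<bar>b $ j\<bar>" by (cases "b $ j = 0") auto
  qed
  have ev_w: "\<forall>\<^sub>F x in F. norm (w x) < norm w0 + 1"
    by (rule order_tendstoD(2)[OF tendsto_norm[OF w]]) simp
  have ev_l: "\<forall>\<^sub>F x in F. l x < l0 + 1" by (rule order_tendstoD(2)[OF l(1)]) simp
  have ev_A: "\<forall>\<^sub>F x in F. coercive m (A x)"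
    unfolding m_def by (rule eventually_coercive[OF A m0(2,1)])
  have bound: "\<forall>\<^sub>F x in F. m * (norm (a x - a0))\<^sup>2 \<le> 2 * \<delta> x"
    using ev_small ev_w ev_l ev_A r(2) l(2)
  proof eventually_elim
    case (elim x)
    have P: "admissible_penalty (l x * CARD('n)) (l1_penalty (l x) (r x) b)"
      by (rule l1_penalty_admissible) (use elim in auto)
    have "l x * real CARD('n) \<le> (l0 + 1) * real CARD('n)" using elim by (intro mult_right_mono) auto
    then have aR: "norm (a x) \<le> R"
      unfolding a_def R_def
      by (intro order_trans[OF penalized_argmin_norm[OF elim(4) m P]] divide_right_mono add_mono) (use elim m in auto)
    let ?F = "penalized_quadratic (A x) (l1_penalty (l x) (r x) b) (w x)"
    let ?G = "penalized_quadratic C (l1_penalty l0 0 b) w0"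
    have close: "\<bar>?F u - ?G u\<bar> \<le> \<delta> x" if u: "norm u \<le> R" for u
    proof -
      let ?s = "\<Sum>j\<in>UNIV. abs_increment 0 (b $ j) (u $ j)"
      have "abs_increment (r x) (b $ j) (u $ j) = abs_increment 0 (b $ j) (u $ j)" for j
        by (rule abs_increment_eq_0[where R=R]) (use elim u component_le_norm_cart[of u j] in auto)
      then have pen: "l1_penalty (l x) (r x) b u - l1_penalty l0 0 b u = (l x - l0) * ?s"
        by (simp add: l1_penalty_def left_diff_distrib)
      have "\<bar>?s\<bar> \<le> (\<Sum>j\<in>(UNIV::'n set). R)"
        by (intro order_trans[OF sum_abs] sum_mono order_trans[OF abs_increment_bound]
            order_trans[OF component_le_norm_cart] u) simp
      then have 3: "\<bar>(l x - l0) * ?s\<bar> \<le> \<bar>l x - l0\<bar> * (CARD('n) * R)"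
        unfolding abs_mult by (intro mult_left_mono) auto
      have "\<bar>u \<bullet> (w x - w0)\<bar> \<le> norm u * norm (w x - w0)" by (rule Cauchy_Schwarz_ineq2)
      also have "\<dots> \<le> R * norm (w x - w0)" using u by (intro mult_right_mono) auto
      finally have 1: "\<bar>u \<bullet> (w x - w0)\<bar> \<le> R * norm (w x - w0)" .
      have 2: "\<bar>u \<bullet> ((A x - C) *v u)\<bar> \<le> (\<Sum>i\<in>UNIV. \<Sum>j\<in>UNIV. \<bar>(A x - C) $ i $ j\<bar>) * R\<^sup>2"
        by (rule order_trans[OF quadratic_form_bound]) (intro mult_left_mono power_mono u sum_nonneg, auto)
      have "?F u - ?G u = - 2 * (u \<bullet> (w x - w0)) + u \<bullet> ((A x - C) *v u) + (l x - l0) * ?s"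
        unfolding penalized_quadratic_def inner_diff_right matrix_vector_mult_diff_rdistrib
        by (simp only: pen[symmetric]) simp
      with 1 2 3 show ?thesis unfolding \<delta>_def by linarith
    qed
    have "?F (a x) + m / 2 * (norm (a0 - a x))\<^sup>2 \<le> ?F a0"
      unfolding a_def by (rule penalized_quadratic_gap[OF elim(4) P penalized_argmin_min[OF elim(4) m P]])
    moreover have "?G a0 + m / 2 * (norm (a x - a0))\<^sup>2 \<le> ?G (a x)"
      unfolding a0_def by (rule penalized_quadratic_gap[OF Cm P0 penalized_argmin_min[OF Cm m P0]])
    ultimately show ?case
      using close[OF aR] close[OF a0R] by (simp add: norm_minus_commute abs_le_iff)
  qed
  have "(\<delta> \<longlongrightarrow> 2 * R * norm (w0 - w0) + (\<Sum>i\<in>(UNIV::'n set). \<Sum>j\<in>(UNIV::'n set). \<bar>(C - C) $ i $ j\<bar>) * R\<^sup>2 + \<bar>l0 - l0\<bar> * (CARD('n) * R)) F"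
    unfolding \<delta>_def[abs_def] by (intro tendsto_intros w A l)
  then have "(\<delta> \<longlongrightarrow> 0) F" by simp
  then have "((\<lambda>x. 2 / m * \<delta> x) \<longlongrightarrow> 0) F" by (rule tendsto_mult_right_zero)
  moreover have "\<forall>\<^sub>F x in F. norm ((norm (a x - a0))\<^sup>2) \<le> 2 / m * \<delta> x"
    using bound by eventually_elim (use m in \<open>simp add: field_simps\<close>)
  ultimately have "((\<lambda>x. (norm (a x - a0))\<^sup>2) \<longlongrightarrow> 0) F" by (rule Lim_null_comparison[rotated])
  then have "((\<lambda>x. sqrt ((norm (a x - a0))\<^sup>2)) \<longlongrightarrow> sqrt 0) F" by (rule tendsto_real_sqrt)
  then have "((\<lambda>x. norm (a x - a0)) \<longlongrightarrow> 0) F" by simp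
  then show ?thesis unfolding a_def a0_def by (simp add: LIM_zero_iff tendsto_norm_zero_iff)
qed

section \<open>Estimators as functions of the score\<close>

lemma matrix_inv_scaleR:
  fixes A :: "real^'n^'n"
  assumes "invertible A" "c \<noteq> 0"
  shows "matrix_inv (c *\<^sub>R A) = (1 / c) *\<^sub>R matrix_inv A"
  by (rule matrix_inv_unique) (simp add: scaleR_matrix_mult matrix_inv_inverse assms)

lemma correction_scaleR:
  fixes A :: "real^'p^'p" and H :: "real^'p^'q"
  assumes "pos_def A" "c > 0" "rank H = CARD('q)"
  shows "correction (c *\<^sub>R A) H = correction A H"
  using assms pos_def_invertible[OF assms(1)] pos_def_invertible[OF pos_def_restriction[OF assms(1,3)]]
  by (simp add: correction_def matrix_inv_scaleR scaleR_matrix_mult)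

lemma restriction_form_scaleR:
  fixes A :: "real^'p^'p" and H :: "real^'p^'q"
  assumes "pos_def A" "c > 0" "rank H = CARD('q)"
  shows "restriction_form (c *\<^sub>R A) H (r *\<^sub>R y) = c * r\<^sup>2 * restriction_form A H y"
  using assms pos_def_invertible[OF assms(1)] pos_def_invertible[OF pos_def_restriction[OF assms(1,3)]]
  by (simp add: restriction_form_def matrix_inv_scaleR scaleR_matrix_mult matrix_vector_mult_scaleR
      scaleR_matrix_vector_assoc[symmetric] power2_eq_square)

lemma gram_mult: "gram n x *v u = (\<Sum>i<n. (x i \<bullet> u) *\<^sub>R x i)"
proof (rule vec_eq_iff[THEN iffD2], rule allI)
  fix j
  have "(gram n x *v u) $ j = (\<Sum>k\<in>UNIV. \<Sum>i<n. x i $ j * x i $ k * u $ k)"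
    by (simp add: gram_def matrix_vector_mult_def sum_distrib_right)
  also have "\<dots> = (\<Sum>i<n. \<Sum>k\<in>UNIV. x i $ j * x i $ k * u $ k)" by (rule sum.swap)
  also have "\<dots> = (\<Sum>i<n. (x i \<bullet> u) *\<^sub>R x i) $ j"
    by (simp add: inner_vec_def sum_distrib_left mult_ac)
  finally show "(gram n x *v u) $ j = (\<Sum>i<n. (x i \<bullet> u) *\<^sub>R x i) $ j" .
qed

lemma gram_form: "u \<bullet> (gram n x *v u) = (\<Sum>i<n. (x i \<bullet> u)\<^sup>2)"
  by (simp add: gram_mult inner_sum_right power2_eq_square inner_commute)

lemma gram_symmetric: "transpose (gram n x) = gram n x"
  by (simp add: transpose_def gram_def vec_eq_iff mult.commute)

definition scaled_gram :: "nat \<Rightarrow> (nat \<Rightarrow> real^'p) \<Rightarrow> real^'p^'p" where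
  "scaled_gram n x = (1 / real n) *\<^sub>R gram n x"

definition score :: "nat \<Rightarrow> (nat \<Rightarrow> real^'p) \<Rightarrow> (nat \<Rightarrow> real) \<Rightarrow> real^'p" where
  "score n x e = (1 / sqrt (real n)) *\<^sub>R (\<Sum>i<n. e i *\<^sub>R x i)"

lemma scaled_gram_pos_def: "coercive m (scaled_gram n x) \<Longrightarrow> m > 0 \<Longrightarrow> pos_def (scaled_gram n x)"
  unfolding pos_def_def
proof (intro conjI allI impI)
  show "transpose (scaled_gram n x) = scaled_gram n x"
    using gram_symmetric[of n x] by (simp add: scaled_gram_def transpose_def vec_eq_iff)
  fix u :: "real^'a" assume "coercive m (scaled_gram n x)" "m > 0" "u \<noteq> 0"
  then have "0 < m * (norm u)\<^sup>2" "m * (norm u)\<^sup>2 \<le> u \<bullet> (scaled_gram n x *v u)" by (auto simp: coercive_def)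
  then show "0 < u \<bullet> (scaled_gram n x *v u)" by linarith
qed

text \<open>The errors enter the increment of the residual sum of squares only through the score.\<close>

lemma rss_increment:
  assumes n: "n > 0"
  shows "rss n x (response x b e) (b + (1 / sqrt (real n)) *\<^sub>R u) =
    (\<Sum>i<n. (e i)\<^sup>2) - 2 * (u \<bullet> score n x e) + u \<bullet> (scaled_gram n x *v u)"
proof -
  let ?r = "1 / sqrt (real n)"
  have r2: "?r\<^sup>2 = 1 / real n" using n by (simp add: power_divide)
  have "rss n x (response x b e) (b + ?r *\<^sub>R u) = (\<Sum>i<n. (e i)\<^sup>2 - 2 * (?r * (e i * (x i \<bullet> u))) + ?r\<^sup>2 * (x i \<bullet> u)\<^sup>2)"
    unfolding rss_def response_def
    by (intro sum.cong refl) (simp add: inner_add_right power2_eq_square algebra_simps)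
  also have "\<dots> = (\<Sum>i<n. (e i)\<^sup>2) - 2 * (?r * (\<Sum>i<n. e i * (x i \<bullet> u))) + ?r\<^sup>2 * (\<Sum>i<n. (x i \<bullet> u)\<^sup>2)"
    by (simp only: sum.distrib sum_subtractf sum_distrib_left)
  also have "?r * (\<Sum>i<n. e i * (x i \<bullet> u)) = u \<bullet> score n x e"
    by (simp add: score_def inner_sum_right inner_commute)
  also have "?r\<^sup>2 * (\<Sum>i<n. (x i \<bullet> u)\<^sup>2) = u \<bullet> (scaled_gram n x *v u)"
    unfolding r2 by (simp add: scaled_gram_def scaleR_matrix_vector_assoc[symmetric] gram_form)
  finally show ?thesis .
qed

context
  fixes n :: nat and x :: "nat \<Rightarrow> real^'p" and e :: "nat \<Rightarrow> real" and b :: "real^'p" and m :: real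
  assumes n: "n > 0" and m: "m > 0" and coercive: "coercive m (scaled_gram n x)"
begin

lemma scaled_gram_invertible: "invertible (scaled_gram n x)" by (rule pos_def_invertible[OF scaled_gram_pos_def[OF coercive m]])
lemma gram_eq_scaled: "gram n x = real n *\<^sub>R scaled_gram n x" using n by (simp add: scaled_gram_def)

lemma ols_eq: "ols n x (response x b e) = b + (1 / sqrt (real n)) *\<^sub>R (matrix_inv (scaled_gram n x) *v (score n x e))"
proof -
  have g: "invertible (gram n x)"
    using pos_def_invertible[OF pos_def_scaleR[OF scaled_gram_pos_def[OF coercive m], of "real n"]] n by (simp add: gram_eq_scaled)
  have "(\<Sum>i<n. response x b e i *\<^sub>R x i) = gram n x *v b + (\<Sum>i<n. e i *\<^sub>R x i)"
    by (simp add: response_def gram_mult scaleR_add_left sum.distrib)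
  then have "ols n x (response x b e) = b + matrix_inv (gram n x) *v (\<Sum>i<n. e i *\<^sub>R x i)"
    using g by (simp add: ols_def matrix_vector_right_distrib)
  also have "(\<Sum>i<n. e i *\<^sub>R x i) = sqrt (real n) *\<^sub>R score n x e" using n by (simp add: score_def)
  also have "matrix_inv (gram n x) *v (sqrt (real n) *\<^sub>R score n x e) = (1 / real n * sqrt (real n)) *\<^sub>R (matrix_inv (scaled_gram n x) *v (score n x e))"
    using n by (simp add: gram_eq_scaled matrix_inv_scaleR scaled_gram_invertible matrix_vector_mult_scaleR scaleR_matrix_vector_assoc[symmetric])
  also have "1 / real n * sqrt (real n) = (1 / sqrt (real n))" using n by (simp add: field_simps)
  finally show ?thesis .
qed

lemma residual_variance_eq:
  "residual_variance n x (response x b e) =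
    ((\<Sum>i<n. (e i)\<^sup>2) - score n x e \<bullet> (matrix_inv (scaled_gram n x) *v (score n x e))) / (real n - real CARD('p))"
  unfolding residual_variance_def ols_eq rss_increment[OF n]
  by (simp add: scaled_gram_invertible inner_commute)

lemma test_statistic_eq:
  fixes H :: "real^'p^'q"
  assumes H: "rank H = CARD('q)" and h: "H *v b = h + (1 / sqrt (real n)) *\<^sub>R xi"
  shows "test_statistic n x H h (response x b e) =
    restriction_form (scaled_gram n x) H (H *v (matrix_inv (scaled_gram n x) *v (score n x e)) + xi) / residual_variance n x (response x b e)"
proof -
  have "H *v ols n x (response x b e) - h = (1 / sqrt (real n)) *\<^sub>R (H *v (matrix_inv (scaled_gram n x) *v (score n x e)) + xi)"
    unfolding ols_eq matrix_vector_right_distrib h by (simp add: matrix_vector_mult_scaleR scaleR_add_right)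
  moreover have "real n * (1 / sqrt (real n))\<^sup>2 = 1" using n by (simp add: power_divide)
  ultimately show ?thesis
    unfolding test_statistic_def gram_eq_scaled using n by (simp add: restriction_form_scaleR[OF scaled_gram_pos_def[OF coercive m] _ H])
qed

text \<open>After the substitution \<open>b + u / \<surd>n\<close> the lasso criterion is, up to a constant, a penalized quadratic
  function of \<open>u\<close>, whose minimiser is unique.\<close>

lemma lasso_eq:
  assumes lam: "lam \<ge> 0"
  shows "sqrt (real n) *\<^sub>R (lasso n x lam (response x b e) - b) = penalized_argmin (scaled_gram n x) (l1_penalty (lam / sqrt (real n)) (1 / sqrt (real n)) b) (score n x e)"
proof -
  let ?f = "\<lambda>b'. rss n x (response x b e) b' + lam * (\<Sum>j\<in>UNIV. \<bar>b' $ j\<bar>)"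
  let ?P = "l1_penalty (lam / sqrt (real n)) (1 / sqrt (real n)) b"
  let ?c = "(\<Sum>i<n. (e i)\<^sup>2) + lam * (\<Sum>j\<in>UNIV. \<bar>b $ j\<bar>)"
  have r: "(1 / sqrt (real n)) > 0" using n by simp
  have f: "?f (b + (1 / sqrt (real n)) *\<^sub>R u) = ?c + penalized_quadratic (scaled_gram n x) ?P (score n x e) u" for u
  proof -
    have "?P u = (lam * (1 / sqrt (real n))) * (\<Sum>j\<in>UNIV. (\<bar>b $ j + (1 / sqrt (real n)) * u $ j\<bar> - \<bar>b $ j\<bar>) / (1 / sqrt (real n)))"
      using r by (simp add: l1_penalty_def abs_increment_def)
    also have "\<dots> = lam * (\<Sum>j\<in>UNIV. \<bar>b $ j + (1 / sqrt (real n)) * u $ j\<bar> - \<bar>b $ j\<bar>)"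
      unfolding sum_divide_distrib[symmetric] using n by (simp add: field_simps)
    finally have "lam * (\<Sum>j\<in>UNIV. \<bar>(b + (1 / sqrt (real n)) *\<^sub>R u) $ j\<bar>) = lam * (\<Sum>j\<in>UNIV. \<bar>b $ j\<bar>) + ?P u"
      by (simp add: sum_subtractf right_diff_distrib)
    then show ?thesis unfolding rss_increment[OF n] penalized_quadratic_def by simp
  qed
  have rep: "b' = b + (1 / sqrt (real n)) *\<^sub>R (sqrt (real n) *\<^sub>R (b' - b))" for b' using n by simp
  have P: "admissible_penalty (lam / sqrt (real n) * CARD('p)) ?P"
    by (rule l1_penalty_admissible) (use lam r in auto)
  let ?a = "penalized_argmin (scaled_gram n x) ?P (score n x e)"
  have f': "?f b' = ?c + penalized_quadratic (scaled_gram n x) ?P (score n x e) (sqrt (real n) *\<^sub>R (b' - b))" for b'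
    using f[of "sqrt (real n) *\<^sub>R (b' - b)"] unfolding rep[of b', symmetric] .
  have "?f (b + (1 / sqrt (real n)) *\<^sub>R ?a) \<le> ?f b'" for b'
    unfolding f[of ?a] f'[of b'] by (intro add_left_mono penalized_argmin_min[OF coercive m P])
  then have "\<exists>a. is_arg_min ?f (\<lambda>_. True) a" unfolding is_arg_min_linorder by blast
  then have "is_arg_min ?f (\<lambda>_. True) (lasso n x lam (response x b e))"
    unfolding lasso_def arg_min_def by (rule someI_ex)
  then have min: "?f (lasso n x lam (response x b e)) \<le> ?f b'" for b'
    by (simp add: is_arg_min_linorder)
  let ?u = "sqrt (real n) *\<^sub>R (lasso n x lam (response x b e) - b)"
  have "penalized_quadratic (scaled_gram n x) ?P (score n x e) ?u \<le> penalized_quadratic (scaled_gram n x) ?P (score n x e) u" for u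
    using min[of "b + (1 / sqrt (real n)) *\<^sub>R u"] unfolding f f' using n by simp
  then show ?thesis by (rule penalized_argmin_unique[OF coercive m P])
qed

text \<open>The restriction turns \<open>H\<close> times the lasso minus \<open>h\<close> into \<open>H u + \<xi>\<close>, divided by \<open>\<surd>n\<close>, and
  the correction matrix does not change when the Gram matrix is rescaled.\<close>

lemma lasso_correction_eq:
  fixes H :: "real^'p^'q"
  assumes H: "rank H = CARD('q)" and h: "H *v b = h + (1 / sqrt (real n)) *\<^sub>R xi"
  shows "sqrt (real n) *\<^sub>R (lasso n x lam (response x b e) - restricted_lasso n x lam H h (response x b e)) =
    correction (scaled_gram n x) H *v (H *v (sqrt (real n) *\<^sub>R (lasso n x lam (response x b e) - b)) + xi)"
proof -
  have "H *v (sqrt (real n) *\<^sub>R (lasso n x lam (response x b e) - b)) + xi = sqrt (real n) *\<^sub>R (H *v lasso n x lam (response x b e) - h)"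
    using n
    by (simp add: matrix_vector_mult_scaleR matrix_vector_mult_diff_distrib h algebra_simps)
  then show ?thesis
    using n unfolding restricted_lasso_def gram_eq_scaled
    by (simp add: correction_scaleR[OF scaled_gram_pos_def[OF coercive m] _ H] matrix_vector_mult_scaleR)
qed

end

section \<open>Passage to the limit\<close>

text \<open>Away from ties the comparison is eventually constant.\<close>

lemma tendsto_of_bool_le:
  fixes f g :: "'x \<Rightarrow> real"
  assumes "(f \<longlongrightarrow> a) F" "(g \<longlongrightarrow> c) F" "a \<noteq> c"
  shows "((\<lambda>x. of_bool (f x \<le> g x) :: real) \<longlongrightarrow> of_bool (a \<le> c)) F"
proof (rule tendsto_eventually)
  have d: "((\<lambda>x. f x - g x) \<longlongrightarrow> a - c) F" by (intro tendsto_diff assms)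
  show "\<forall>\<^sub>F x in F. (of_bool (f x \<le> g x) :: real) = of_bool (a \<le> c)"
  proof (cases "a < c")
    case True
    then have "\<forall>\<^sub>F x in F. f x - g x < 0" by (intro order_tendstoD(2)[OF d]) simp
    then show ?thesis by eventually_elim (use True in simp)
  next
    case False
    with assms(3) have "\<forall>\<^sub>F x in F. 0 < f x - g x" by (intro order_tendstoD(1)[OF d]) simp
    then show ?thesis by eventually_elim (use False assms(3) in simp)
  qed
qed

lemma converges_in_distribution_cong:
  fixes X :: "nat \<Rightarrow> 'a \<Rightarrow> 'c::metric_space"
  assumes "converges_in_distribution M X N Z" and eq: "\<forall>\<^sub>F n in sequentially. \<forall>\<omega>. X' n \<omega> = X n \<omega>"
  shows "converges_in_distribution M X' N Z"
  unfolding converges_in_distribution_def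
proof (intro conjI allI impI)
  show "\<forall>\<^sub>F n in sequentially. X' n \<in> borel_measurable M"
  proof -
    have "\<forall>\<^sub>F n in sequentially. X n \<in> borel_measurable M" using assms(1) by (simp add: converges_in_distribution_def)
    with eq show ?thesis
    proof eventually_elim
      case (elim n)
      then have "X' n = X n" by auto
      with elim show ?case by simp
    qed
  qed
  show "Z \<in> borel_measurable N" using assms(1) by (simp add: converges_in_distribution_def)
  fix f :: "'c \<Rightarrow> real" assume "continuous_on UNIV f \<and> bounded (range f)"
  then have "(\<lambda>n. \<integral>\<omega>. f (X n \<omega>) \<partial>M) \<longlonglongrightarrow> (\<integral>\<omega>. f (Z \<omega>) \<partial>N)"
    using assms(1) by (simp add: converges_in_distribution_def)
  moreover have "\<forall>\<^sub>F n in sequentially. (\<integral>\<omega>. f (X' n \<omega>) \<partial>M) = (\<integral>\<omega>. f (X n \<omega>) \<partial>M)"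
    using eq by eventually_elim simp
  ultimately show "(\<lambda>n. \<integral>\<omega>. f (X' n \<omega>) \<partial>M) \<longlonglongrightarrow> (\<integral>\<omega>. f (Z \<omega>) \<partial>N)"
    by (simp add: tendsto_cong)
qed

lemma borel_measurable_matrix_vector_mult' [measurable (raw)]:
  fixes B :: "real^'n^'m"
  shows "f \<in> borel_measurable M \<Longrightarrow> (\<lambda>\<omega>. B *v f \<omega>) \<in> borel_measurable M"
  by (rule measurable_compose[OF _ borel_measurable_matrix_vector_mult])

lemma measurable_fst_borel [measurable]: "fst \<in> borel_measurable (borel :: ('a::euclidean_space \<times> 'b::euclidean_space) measure)"
  and measurable_snd_borel [measurable]: "snd \<in> borel_measurable (borel :: ('a::euclidean_space \<times> 'b::euclidean_space) measure)"
  by (auto intro!: borel_measurable_continuous_onI continuous_intros)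

lemma restriction_form_measurable [measurable (raw)]:
  "f \<in> borel_measurable M \<Longrightarrow> (\<lambda>\<omega>. restriction_form A H (f \<omega>)) \<in> borel_measurable M"
  unfolding restriction_form_def by (intro borel_measurable_inner borel_measurable_matrix_vector_mult')

lemma tendsto_restriction_form:
  fixes A :: "'x \<Rightarrow> real^'p^'p" and H :: "real^'p^'q"
  assumes A: "(A \<longlongrightarrow> C) F" and C: "pos_def C" and H: "rank H = CARD('q)" and y: "(y \<longlongrightarrow> y0) F"
  shows "((\<lambda>x. restriction_form (A x) H (y x)) \<longlongrightarrow> restriction_form C H y0) F"
  unfolding restriction_form_def
  by (intro tendsto_inner y tendsto_matrix_vector_mult tendsto_matrix_inv tendsto_matrix_mult tendsto_const A
      pos_def_invertible C pos_def_restriction H)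

lemma tendsto_correction:
  fixes A :: "'x \<Rightarrow> real^'p^'p" and H :: "real^'p^'q"
  assumes A: "(A \<longlongrightarrow> C) F" and C: "pos_def C" and H: "rank H = CARD('q)"
  shows "((\<lambda>x. correction (A x) H) \<longlongrightarrow> correction C H) F"
  unfolding correction_def
  by (intro tendsto_matrix_inv tendsto_matrix_mult tendsto_const A pos_def_invertible C pos_def_restriction H)

text \<open>The test statistic as a function of \<open>y = (w, q)\<close>, with \<open>w\<close> the score and \<open>q\<close> the mean of the squared errors;
  the denominator is the residual variance.\<close>

definition scaled_statistic :: "nat \<Rightarrow> real^'p^'p \<Rightarrow> real^'p^'q \<Rightarrow> real^'q \<Rightarrow> (real^'p) \<times> real \<Rightarrow> real" where
  "scaled_statistic n A H xi y =
     restriction_form A H (H *v (matrix_inv A *v fst y) + xi) /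
     ((real n * snd y - fst y \<bullet> (matrix_inv A *v fst y)) / (real n - real CARD('p)))"

lemma scaled_statistic_measurable [measurable]: "scaled_statistic n A H xi \<in> borel_measurable borel"
  unfolding scaled_statistic_def[abs_def]
  by (intro borel_measurable_divide borel_measurable_diff borel_measurable_times borel_measurable_inner
      borel_measurable_add restriction_form_measurable borel_measurable_matrix_vector_mult'
      measurable_fst_borel measurable_snd_borel borel_measurable_const)

lemma filterlim_real_minus_const: "filterlim (\<lambda>n. real n - c) at_top sequentially"
  using filterlim_tendsto_add_at_top[OF tendsto_const[of "- c"] filterlim_real_sequentially] by simp

lemma ratio_tendsto_1: "(\<lambda>n. (real n - c) / (real n - d)) \<longlonglongrightarrow> 1"
proof -
  have "(\<lambda>n. 1 + (d - c) / (real n - d)) \<longlonglongrightarrow> 1 + 0"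
    by (intro tendsto_add tendsto_const tendsto_divide_0[OF tendsto_const] filterlim_at_top_imp_at_infinity filterlim_real_minus_const)
  moreover have "\<forall>\<^sub>F n in sequentially. (real n - c) / (real n - d) = 1 + (d - c) / (real n - d)"
    using eventually_gt_at_top[of "nat \<lceil>\<bar>d\<bar>\<rceil>"]
  proof eventually_elim
    case (elim n)
    then have "real n > d" by linarith
    then show ?case by (simp add: field_simps)
  qed
  ultimately show ?thesis by (simp add: tendsto_cong)
qed


text \<open>The part of the model that does not concern penalty and restriction.\<close>

locale regression_asymptotics =
  fixes M :: "'a measure" and N :: "'b measure"
    and x :: "nat \<Rightarrow> nat \<Rightarrow> real^'p" and eps :: "nat \<Rightarrow> 'a \<Rightarrow> real" and sigma :: real and C :: "real^'p^'p"
    and W :: "'b \<Rightarrow> real^'p"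
  assumes M: "prob_space M" and N: "prob_space N"
    and A1: "(\<lambda>n. Max ((\<lambda>i. x n i \<bullet> (matrix_inv (gram n (x n)) *v x n i)) ` {..<n})) \<longlonglongrightarrow> 0"
    and A2: "(\<lambda>n. scaled_gram n (x n)) \<longlonglongrightarrow> C" and C: "pos_def C"
    and indep: "prob_space.indep_vars M (\<lambda>_. borel) eps UNIV"
    and ident: "\<And>i. distr M borel (eps i) = distr M borel (eps 0)"
    and int: "integrable M (eps 0)" and mean: "(\<integral>\<omega>. eps 0 \<omega> \<partial>M) = 0"
    and sigma: "sigma > 0"
    and int2: "integrable M (\<lambda>\<omega>. (eps 0 \<omega>)\<^sup>2)" and var: "(\<integral>\<omega>. (eps 0 \<omega>)\<^sup>2 \<partial>M) = sigma\<^sup>2"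
    and W [measurable]: "W \<in> borel_measurable N" and W_law: "distr N borel W = mvn 0 (sigma\<^sup>2 *\<^sub>R C)"
begin

sublocale M: prob_space M by (rule M)
sublocale N: prob_space N by (rule N)

lemma eps_measurable [measurable]: "eps i \<in> borel_measurable M"
  using indep unfolding M.indep_vars_def2 by simp

lemma eventually_coercive_gram:
  obtains m where "m > 0" "\<forall>\<^sub>F n in sequentially. coercive m (scaled_gram n (x n))"
proof -
  obtain m where "m > 0" "coercive m C" by (rule pos_def_coercive[OF C])
  then show ?thesis using eventually_coercive[OF A2, of m] that[of "m / 2"] by simp
qed

text \<open>\<open>t \<bullet> w\<close> is a weighted sum of the errors with squared weights adding up to \<open>t \<bullet> A t\<close>. By
  Cauchy--Schwarz, \<open>(t \<bullet> x\<^sub>i)\<^sup>2\<close> is at most \<open>t \<bullet> G t\<close> times the leverage of \<open>x\<^sub>i\<close>, with \<open>G\<close> the Gram matrix, so that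
  vanishing leverages make the largest weight vanish.\<close>

lemma score_char_fun_tendsto:
  "(\<lambda>n. char_fun M (\<lambda>\<omega>. score n (x n) (\<lambda>i. eps i \<omega>)) t) \<longlonglongrightarrow> char_fun N W t"
proof -
  define a where "a n i = (t \<bullet> x n i) / sqrt (real n)" for n i
  let ?q = "\<lambda>n. t \<bullet> (scaled_gram n (x n) *v t)"
  let ?max = "\<lambda>n. Max ((\<lambda>i. x n i \<bullet> (matrix_inv (gram n (x n)) *v x n i)) ` {..<n})"
  have q: "?q \<longlonglongrightarrow> t \<bullet> (C *v t)"
    by (intro tendsto_inner tendsto_const tendsto_matrix_vector_mult A2)
  have sq: "(\<Sum>i<n. (a n i)\<^sup>2) = ?q n" for n
    by (simp add: a_def scaled_gram_def scaleR_matrix_vector_assoc[symmetric] gram_form power_divide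
        sum_divide_distrib[symmetric] inner_commute)
  obtain m where m: "m > 0" and ev: "\<forall>\<^sub>F n in sequentially. coercive m (scaled_gram n (x n))"
    by (rule eventually_coercive_gram)
  have bound: "\<forall>\<^sub>F n in sequentially. \<forall>i<n. \<bar>a n i\<bar> \<le> sqrt (?q n * ?max n)"
    using ev eventually_gt_at_top[of 0]
  proof eventually_elim
    case (elim n)
    show ?case
    proof (intro allI impI)
      fix i assume i: "i < n"
      have G: "pos_def (gram n (x n))"
        using pos_def_scaleR[OF scaled_gram_pos_def[OF elim(1) m], of "real n"] elim(2) by (simp add: scaled_gram_def)
      (* the factor B turns Cauchy-Schwarz for the Gram form into the Euclidean one *)
      obtain B :: "real^'p^'p" where B: "invertible B" "gram n (x n) = B ** transpose B" by (rule pos_def_factor[OF G])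
      have "t \<bullet> x n i = (transpose B *v t) \<bullet> (matrix_inv B *v x n i)"
        by (simp only: inner_transpose transpose_transpose matrix_inv_apply[OF B(1)])
      then have "(t \<bullet> x n i)\<^sup>2 \<le> (norm (transpose B *v t))\<^sup>2 * (norm (matrix_inv B *v x n i))\<^sup>2"
        using Cauchy_Schwarz_ineq[of "transpose B *v t" "matrix_inv B *v x n i"] by (simp add: power2_norm_eq_inner)
      also have "(norm (transpose B *v t))\<^sup>2 = t \<bullet> (gram n (x n) *v t)"
        by (simp only: B(2) power2_norm_eq_inner inner_transpose transpose_transpose matrix_vector_mul_assoc)
      also have "(norm (matrix_inv B *v x n i))\<^sup>2 = x n i \<bullet> (matrix_inv (gram n (x n)) *v x n i)"
        by (simp only: B(2) matrix_inv_mult_transpose[OF B(1)])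
      also have "t \<bullet> (gram n (x n) *v t) * \<dots> \<le> t \<bullet> (gram n (x n) *v t) * ?max n"
        using i by (intro mult_left_mono Max_ge) (auto simp: gram_form intro: sum_nonneg)
      finally have "(a n i)\<^sup>2 \<le> ?q n * ?max n"
        using elim(2) by (simp add: a_def power_divide scaled_gram_def scaleR_matrix_vector_assoc[symmetric] divide_right_mono)
      then show "\<bar>a n i\<bar> \<le> sqrt (?q n * ?max n)" by (metis real_sqrt_abs real_sqrt_le_iff)
    qed
  qed
  have m0: "(\<lambda>n. sqrt (?q n * ?max n)) \<longlonglongrightarrow> 0"
    using tendsto_real_sqrt[OF tendsto_mult[OF q A1]] by simp
  have "(\<lambda>n. CLINT \<omega>|M. iexp (\<Sum>i<n. a n i * eps i \<omega>)) \<longlonglongrightarrow> complex_of_real (exp (- (sigma\<^sup>2 * (t \<bullet> (C *v t))) / 2))"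
    by (rule weighted_sum_clt[OF M indep ident int mean int2 var _ m0 bound]) (simp add: sq q)
  moreover have "char_fun M (\<lambda>\<omega>. score n (x n) (\<lambda>i. eps i \<omega>)) t = (CLINT \<omega>|M. iexp (\<Sum>i<n. a n i * eps i \<omega>))" for n
  proof -
    have "t \<bullet> score n (x n) (\<lambda>i. eps i \<omega>) = (\<Sum>i<n. a n i * eps i \<omega>)" for \<omega>
      by (simp add: score_def a_def inner_sum_right sum_divide_distrib mult.commute)
    then show ?thesis by (simp only: char_fun_def)
  qed
  moreover have "char_fun N W t = complex_of_real (exp (- (sigma\<^sup>2 * (t \<bullet> (C *v t))) / 2))"
    using char_fun_mvn[OF pos_def_scaleR[OF C, of "sigma\<^sup>2"], of 0 t] sigma
    by (simp add: char_fun_distr[OF W, symmetric] W_law scaleR_matrix_vector_assoc[symmetric])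
  ultimately show ?thesis by simp
qed

definition score_pair :: "nat \<Rightarrow> 'a \<Rightarrow> (real^'p) \<times> real" where
  "score_pair n \<omega> = (score n (x n) (\<lambda>i. eps i \<omega>), (\<Sum>i<n. (eps i \<omega>)\<^sup>2) / real n)"

lemma score_pair_measurable [measurable]: "score_pair n \<in> borel_measurable M"
  unfolding score_pair_def[abs_def] score_def by (intro borel_measurable_Pair) measurable

text \<open>The second component obeys the law of large numbers, so its limit is constant and the joint convergence
  needs no information on the dependence of the two components.\<close>

theorem score_pair_converges:
  "converges_in_distribution M score_pair N (\<lambda>\<omega>. (W \<omega>, sigma\<^sup>2))"
  unfolding score_pair_def[abs_def]
proof (rule slutsky_pair[OF M N])
  show "converges_in_distribution M (\<lambda>n \<omega>. score n (x n) (\<lambda>i. eps i \<omega>)) N W"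
  proof (rule levy_continuity_euclidean[OF M N _ W score_char_fun_tendsto])
    show "(\<lambda>\<omega>. score n (x n) (\<lambda>i. eps i \<omega>)) \<in> borel_measurable M" for n
      unfolding score_def by measurable
  qed
  show "converges_in_distribution M (\<lambda>n \<omega>. (\<Sum>i<n. (eps i \<omega>)\<^sup>2) / real n) N (\<lambda>_. sigma\<^sup>2)"
  proof (rule levy_continuity_euclidean[OF M N])
    fix t :: real
    have "(\<lambda>n. CLINT \<omega>|M. iexp (t * ((\<Sum>i<n. (eps i \<omega>)\<^sup>2) / real n))) \<longlonglongrightarrow> iexp (t * sigma\<^sup>2)"
    proof (rule weak_law_char[OF M])
      show "M.indep_vars (\<lambda>_. borel) (\<lambda>i \<omega>. (eps i \<omega>)\<^sup>2) UNIV"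
        by (rule M.indep_vars_compose2[where X=eps, OF indep]) auto
      fix i
      have sqd: "distr M borel (\<lambda>\<omega>. (eps i \<omega>)\<^sup>2) = distr (distr M borel (eps i)) borel (\<lambda>z. z\<^sup>2)" for i
        by (simp add: distr_distr comp_def)
      show "distr M borel (\<lambda>\<omega>. (eps i \<omega>)\<^sup>2) = distr M borel (\<lambda>\<omega>. (eps 0 \<omega>)\<^sup>2)"
        unfolding sqd by (rule arg_cong[OF ident])
    qed (rule int2 var)+
    then show "(\<lambda>n. char_fun M (\<lambda>\<omega>. (\<Sum>i<n. (eps i \<omega>)\<^sup>2) / real n) t) \<longlonglongrightarrow> char_fun N (\<lambda>_. sigma\<^sup>2) t"
      by (simp only: char_fun_def inner_real_def) (simp add: N.prob_space)
  qed measurable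
qed

text \<open>Convergence along this filter is continuous convergence at the limit point \<open>(w, \<sigma>\<^sup>2)\<close> of the pair.\<close>

abbreviation at_score :: "real^'p \<Rightarrow> (nat \<times> ((real^'p) \<times> real)) filter" where
  "at_score w \<equiv> sequentially \<times>\<^sub>F nhds (w, sigma\<^sup>2)"

lemma tendsto_at_score:
  shows "f \<longlonglongrightarrow> l \<Longrightarrow> ((\<lambda>p. f (fst p)) \<longlongrightarrow> l) (at_score w)"
    and "((\<lambda>p. fst (snd p)) \<longlongrightarrow> w) (at_score w)" and "((\<lambda>p. snd (snd p)) \<longlongrightarrow> sigma\<^sup>2) (at_score w)"
proof -
  show "f \<longlonglongrightarrow> l \<Longrightarrow> ((\<lambda>p. f (fst p)) \<longlongrightarrow> l) (at_score w)"
    by (rule filterlim_compose[OF _ filterlim_fst])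
  have "((\<lambda>p. snd p) \<longlongrightarrow> (w, sigma\<^sup>2)) (at_score w)" by (rule filterlim_snd)
  from tendsto_fst[OF this] tendsto_snd[OF this]
  show "((\<lambda>p. fst (snd p)) \<longlongrightarrow> w) (at_score w)" "((\<lambda>p. snd (snd p)) \<longlongrightarrow> sigma\<^sup>2) (at_score w)" by auto
qed

lemma scaled_ols_tendsto:
  "((\<lambda>p. matrix_inv (scaled_gram (fst p) (x (fst p))) *v fst (snd p)) \<longlongrightarrow> matrix_inv C *v w) (at_score w)"
  by (intro tendsto_matrix_vector_mult tendsto_matrix_inv pos_def_invertible[OF C] tendsto_at_score(1)[OF A2] tendsto_at_score(2))

text \<open>The term \<open>w \<bullet> A\<^sup>-\<^sup>1 w\<close> by which the residual sum of squares falls short of the sum of the squared errors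
  stays bounded and disappears after division by \<open>n - p\<close>.\<close>

lemma scaled_statistic_tendsto:
  fixes H :: "real^'p^'q"
  assumes H: "rank H = CARD('q)"
  shows "((\<lambda>p. scaled_statistic (fst p) (scaled_gram (fst p) (x (fst p))) H xi (snd p)) \<longlongrightarrow>
    restriction_form C H (H *v (matrix_inv C *v w) + xi) / sigma\<^sup>2) (at_score w)"
proof -
  let ?d = "\<lambda>n. real n - real CARD('p)"
  have r: "((\<lambda>p. real (fst p) / ?d (fst p)) \<longlongrightarrow> 1) (at_score w)"
    using ratio_tendsto_1[of 0 "real CARD('p)"] by (intro tendsto_at_score(1)) simp
  have z: "((\<lambda>p. 1 / ?d (fst p)) \<longlongrightarrow> 0) (at_score w)"
    by (intro tendsto_at_score(1) tendsto_divide_0[OF tendsto_const] filterlim_at_top_imp_at_infinity filterlim_real_minus_const)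
  have "((\<lambda>p. real (fst p) / ?d (fst p) * snd (snd p) -
      (fst (snd p) \<bullet> (matrix_inv (scaled_gram (fst p) (x (fst p))) *v fst (snd p))) * (1 / ?d (fst p))) \<longlongrightarrow>
      1 * sigma\<^sup>2 - (w \<bullet> (matrix_inv C *v w)) * 0) (at_score w)"
    by (intro tendsto_diff tendsto_mult r z tendsto_at_score(2,3) tendsto_inner scaled_ols_tendsto)
  then have s: "((\<lambda>p. (real (fst p) * snd (snd p) - fst (snd p) \<bullet> (matrix_inv (scaled_gram (fst p) (x (fst p))) *v fst (snd p))) / ?d (fst p))
      \<longlongrightarrow> sigma\<^sup>2) (at_score w)"
    by (simp add: diff_divide_distrib)
  show ?thesis
    unfolding scaled_statistic_def
    by (intro tendsto_divide s tendsto_restriction_form tendsto_at_score(1)[OF A2] C H tendsto_add tendsto_const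
        tendsto_matrix_vector_mult scaled_ols_tendsto) (use sigma in simp)
qed

context
  fixes lam :: "nat \<Rightarrow> real" and lam0 :: real and beta :: "real^'p"
  assumes lam: "\<And>n. 0 \<le> lam n" "0 \<le> lam0" "(\<lambda>n. lam n / sqrt (real n)) \<longlonglongrightarrow> lam0"
begin

definition scaled_lasso :: "nat \<Rightarrow> (real^'p) \<times> real \<Rightarrow> real^'p" where
  "scaled_lasso n y = penalized_argmin (scaled_gram n (x n)) (l1_penalty (lam n / sqrt (real n)) (1 / sqrt (real n)) beta) (fst y)"

definition limit_lasso :: "real^'p \<Rightarrow> real^'p" where
  "limit_lasso w = penalized_argmin C (l1_penalty lam0 0 beta) w"

lemma scaled_lasso_tendsto: "((\<lambda>p. scaled_lasso (fst p) (snd p)) \<longlongrightarrow> limit_lasso w) (at_score w)"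
  unfolding scaled_lasso_def limit_lasso_def
proof (rule penalized_argmin_tendsto[OF tendsto_at_score(1)[OF A2] C tendsto_at_score(2)])
  have "(\<lambda>n. 1 / sqrt (real n)) \<longlonglongrightarrow> 0"
    by (intro tendsto_divide_0[OF tendsto_const] filterlim_at_top_imp_at_infinity
        filterlim_compose[OF sqrt_at_top filterlim_real_sequentially])
  then show "((\<lambda>p. 1 / sqrt (real (fst p))) \<longlongrightarrow> 0) (at_score w)" by (rule tendsto_at_score(1))
  show "((\<lambda>p. lam (fst p) / sqrt (real (fst p))) \<longlongrightarrow> lam0) (at_score w)" by (rule tendsto_at_score(1)[OF lam(3)])
qed (use lam in auto)

lemma limit_lasso_measurable [measurable]: "limit_lasso \<in> borel_measurable borel"
proof -
  obtain m where "m > 0" "coercive m C" by (rule pos_def_coercive[OF C])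
  then show ?thesis
    unfolding limit_lasso_def[abs_def]
    by (intro borel_measurable_continuous_onI continuous_on_penalized_argmin[OF _ _ l1_penalty_admissible]) (use lam in auto)
qed

lemma scaled_lasso_measurable: "\<forall>\<^sub>F n in sequentially. scaled_lasso n \<in> borel_measurable borel"
proof -
  obtain m where m: "m > 0" and ev: "\<forall>\<^sub>F n in sequentially. coercive m (scaled_gram n (x n))"
    by (rule eventually_coercive_gram)
  show ?thesis using ev
  proof eventually_elim
    case (elim n)
    have "continuous_on UNIV (penalized_argmin (scaled_gram n (x n)) (l1_penalty (lam n / sqrt (real n)) (1 / sqrt (real n)) beta))"
      by (intro continuous_on_penalized_argmin[OF elim m l1_penalty_admissible]) (use lam in auto)
    then show ?case
      unfolding scaled_lasso_def[abs_def] by (intro measurable_compose[OF measurable_fst_borel] borel_measurable_continuous_onI)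
  qed
qed

end

end

lemma integral_of_bool: "(\<integral>\<omega>. of_bool (P \<omega>) \<partial>M) = measure M {\<omega> \<in> space M. P \<omega>}"
proof -
  have "(\<integral>\<omega>. of_bool (P \<omega>) \<partial>M) = (\<integral>\<omega>. indicator {\<omega> \<in> space M. P \<omega>} \<omega> \<partial>M)"
    by (rule Bochner_Integration.integral_cong) (auto simp: indicator_def)
  also have "\<dots> = measure M ({\<omega> \<in> space M. P \<omega>} \<inter> space M)" by simp
  also have "{\<omega> \<in> space M. P \<omega>} \<inter> space M = {\<omega> \<in> space M. P \<omega>}" by auto
  finally show ?thesis .
qed

context regression_asymptotics
begin

definition limit_statistic :: "real^'p^'q \<Rightarrow> real^'q \<Rightarrow> real^'p \<Rightarrow> real" where
  "limit_statistic H xi w = restriction_form C H (H *v (matrix_inv C *v w) + xi) / sigma\<^sup>2"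

definition sample_statistic :: "real^'p^'q \<Rightarrow> real^'q \<Rightarrow> nat \<Rightarrow> (real^'p) \<times> real \<Rightarrow> real" where
  "sample_statistic H xi n = scaled_statistic n (scaled_gram n (x n)) H xi"

lemma sample_statistic_measurable [measurable]: "sample_statistic H xi n \<in> borel_measurable borel"
  unfolding sample_statistic_def by measurable

lemma limit_statistic_measurable [measurable]: "limit_statistic H xi \<in> borel_measurable borel"
  unfolding limit_statistic_def[abs_def]
  by (intro borel_measurable_divide restriction_form_measurable borel_measurable_add
      borel_measurable_matrix_vector_mult' borel_measurable_const measurable_ident_sets refl)

lemma sample_statistic_tendsto:
  "rank H = CARD('q) \<Longrightarrow>
    ((\<lambda>p. sample_statistic H xi (fst p) (snd p)) \<longlongrightarrow> limit_statistic H xi w) (at_score w)" for H :: "real^'p^'q"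
  unfolding sample_statistic_def limit_statistic_def by (rule scaled_statistic_tendsto)

lemma limit_statistic_law:
  fixes H :: "real^'p^'q" and mu :: "real^'q"
  assumes H: "rank H = CARD('q)" and mu: "(norm mu)\<^sup>2 = restriction_form C H xi / sigma\<^sup>2"
  shows "distr N borel (\<lambda>\<omega>. limit_statistic H xi (W \<omega>)) = noncentral_chi_square mu"
  unfolding limit_statistic_def by (rule restriction_form_law[OF N W C H sigma W_law mu])

lemma limit_statistic_neq:
  fixes H :: "real^'p^'q"
  assumes H: "rank H = CARD('q)"
  shows "AE \<omega> in N. limit_statistic H xi (W \<omega>) \<noteq> t"
proof -
  let ?d = "restriction_form C H xi / sigma\<^sup>2"
  have "pos_def (matrix_inv (H ** matrix_inv C ** transpose H))"
    by (intro pos_def_matrix_inv pos_def_restriction C H)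
  then have "0 \<le> restriction_form C H xi"
    unfolding restriction_form_def pos_def_def by (cases "xi = 0") (auto intro: less_imp_le)
  then have "(norm (sqrt ?d *\<^sub>R axis undefined 1 :: real^'q))\<^sup>2 = ?d"
    by (simp add: norm_axis_1)
  note law = limit_statistic_law[OF H this]
  interpret D: real_distribution "distr N borel (\<lambda>\<omega>. limit_statistic H xi (W \<omega>))"
    unfolding law by (rule real_distribution_noncentral)
  have "emeasure (distr N borel (\<lambda>\<omega>. limit_statistic H xi (W \<omega>))) {t} = 0"
    unfolding D.emeasure_eq_measure unfolding law by (simp add: noncentral_chi_square_atomless)
  then have "AE y in distr N borel (\<lambda>\<omega>. limit_statistic H xi (W \<omega>)). y \<notin> {t}"
    by (intro AE_not_in) (auto simp: null_sets_def)
  then show ?thesis by (subst (asm) AE_distr_iff) auto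
qed

lemma sample_statistic_cdf_tendsto:
  fixes H :: "real^'p^'q" and mu :: "real^'q"
  assumes H: "rank H = CARD('q)" and mu: "(norm mu)\<^sup>2 = restriction_form C H xi / sigma\<^sup>2"
  shows "(\<lambda>n. measure M {\<omega> \<in> space M. sample_statistic H xi n (score_pair n \<omega>) \<le> t}) \<longlonglongrightarrow> cdf (noncentral_chi_square mu) t"
proof -
  have "(\<lambda>n. \<integral>\<omega>. (of_bool (sample_statistic H xi n (score_pair n \<omega>) \<le> t) :: real) \<partial>M) \<longlonglongrightarrow>
      (\<integral>\<omega>. of_bool (limit_statistic H xi (fst (W \<omega>, sigma\<^sup>2)) \<le> t) \<partial>N)"
  proof (rule converges_in_distribution_expectation[where B=1 and phi="\<lambda>n y. of_bool (sample_statistic H xi n y \<le> t)"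
        and ?phi0.0="\<lambda>y. of_bool (limit_statistic H xi (fst y) \<le> t)", OF M N score_pair_converges])
    show "AE \<omega> in N. ((\<lambda>(n, y). of_bool (sample_statistic H xi n y \<le> t) :: real) \<longlongrightarrow>
        of_bool (limit_statistic H xi (fst (W \<omega>, sigma\<^sup>2)) \<le> t)) (at_score (W \<omega>))"
      using limit_statistic_neq[OF H, of xi t]
      by eventually_elim
         (simp add: case_prod_unfold tendsto_of_bool_le[OF sample_statistic_tendsto[OF H] tendsto_const])
  qed auto
  moreover have "(\<integral>\<omega>. of_bool (limit_statistic H xi (fst (W \<omega>, sigma\<^sup>2)) \<le> t) \<partial>N) = cdf (noncentral_chi_square mu) t"
  proof -
    have "(\<integral>\<omega>. of_bool (limit_statistic H xi (fst (W \<omega>, sigma\<^sup>2)) \<le> t) \<partial>N) = measure N {\<omega> \<in> space N. limit_statistic H xi (W \<omega>) \<le> t}"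
      by (simp add: integral_of_bool)
    also have "\<dots> = cdf (distr N borel (\<lambda>\<omega>. limit_statistic H xi (W \<omega>))) t"
      unfolding cdf_def by (subst measure_distr) (auto intro!: arg_cong[where f="measure N"])
    finally show ?thesis by (simp add: limit_statistic_law[OF H mu])
  qed
  ultimately show ?thesis by (simp add: integral_of_bool)
qed

text \<open>Under the null hypothesis the statistic is the one with \<open>\<xi> = 0\<close>, and its limit is the central
  chi-squared law.\<close>

lemma sample_critical_value_tendsto:
  fixes H :: "real^'p^'q"
  assumes H: "rank H = CARD('q)" and alpha: "0 < alpha" "alpha < 1"
  shows "(\<lambda>n. upper_critical_value alpha (distr M borel (\<lambda>\<omega>. sample_statistic H 0 n (score_pair n \<omega>)))) \<longlonglongrightarrow>
    upper_critical_value alpha (noncentral_chi_square (0 :: real^'q))"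
proof (rule upper_critical_value_tendsto[OF _ real_distribution_noncentral _ noncentral_chi_square_cdf_neg noncentral_chi_square_cdf_less alpha])
  show "\<forall>\<^sub>F n in sequentially. real_distribution (distr M borel (\<lambda>\<omega>. sample_statistic H 0 n (score_pair n \<omega>)))"
    by (intro always_eventually allI M.real_distribution_distr) measurable
  fix t
  have "cdf (distr M borel (\<lambda>\<omega>. sample_statistic H 0 n (score_pair n \<omega>))) t =
      measure M {\<omega> \<in> space M. sample_statistic H 0 n (score_pair n \<omega>) \<le> t}" for n
    unfolding cdf_def by (subst measure_distr) (auto intro!: arg_cong[where f="measure M"])
  then show "(\<lambda>n. cdf (distr M borel (\<lambda>\<omega>. sample_statistic H 0 n (score_pair n \<omega>))) t) \<longlonglongrightarrow> cdf (noncentral_chi_square (0 :: real^'q)) t"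
    using sample_statistic_cdf_tendsto[OF H, of 0 0 t] by (simp add: restriction_form_def)
qed

text \<open>The limit \<open>C\<^sup>-\<^sup>1 W\<close> lives on \<open>N\<close>; since only laws matter, it may be replaced by the identity under its
  normal law.\<close>

lemma scaled_ols_converges:
  "converges_in_distribution M (\<lambda>n \<omega>. matrix_inv (scaled_gram n (x n)) *v fst (score_pair n \<omega>))
     (mvn 0 (sigma\<^sup>2 *\<^sub>R matrix_inv C)) (\<lambda>z. z)"
proof -
  let ?D = "matrix_inv C"
  have c: "converges_in_distribution M (\<lambda>n \<omega>. matrix_inv (scaled_gram n (x n)) *v fst (score_pair n \<omega>)) N (\<lambda>\<omega>. ?D *v fst (W \<omega>, sigma\<^sup>2))"
  proof (rule extended_mapping_theorem[OF M N score_pair_converges,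
        where g="\<lambda>n y. matrix_inv (scaled_gram n (x n)) *v fst y" and ?g0.0="\<lambda>y. ?D *v fst y"])
    show "AE \<omega> in N. ((\<lambda>(n, y). matrix_inv (scaled_gram n (x n)) *v fst y) \<longlongrightarrow> ?D *v fst (W \<omega>, sigma\<^sup>2)) (at_score (W \<omega>))"
      using scaled_ols_tendsto by (simp add: case_prod_unfold)
    have "(\<lambda>\<omega>. fst (score_pair n \<omega>)) \<in> borel_measurable M" for n
      by (rule measurable_compose[OF score_pair_measurable measurable_fst_borel])
    then show "\<forall>\<^sub>F n in sequentially. (\<lambda>\<omega>. matrix_inv (scaled_gram n (x n)) *v fst (score_pair n \<omega>)) \<in> borel_measurable M"
      by (intro always_eventually allI borel_measurable_matrix_vector_mult')
    show "(\<lambda>\<omega>. ?D *v fst (W \<omega>, sigma\<^sup>2)) \<in> borel_measurable N"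
      by (simp add: borel_measurable_matrix_vector_mult')
  qed
  have DT: "transpose ?D = ?D" using pos_def_matrix_inv[OF C] by (simp add: pos_def_def)
  have pS: "pos_def (sigma\<^sup>2 *\<^sub>R C)" and pS': "pos_def (sigma\<^sup>2 *\<^sub>R ?D)"
    using sigma by (auto intro!: pos_def_scaleR pos_def_matrix_inv C)
  have "sigma\<^sup>2 *\<^sub>R ?D = ?D ** (sigma\<^sup>2 *\<^sub>R C) ** transpose ?D"
    by (simp add: DT scaleR_matrix_mult matrix_inv_inverse pos_def_invertible[OF C])
  from mvn_affine[OF N W W_law pS pS' this, of 0]
  have law: "distr N borel (\<lambda>\<omega>. ?D *v W \<omega>) = mvn 0 (sigma\<^sup>2 *\<^sub>R ?D)" by simp
  have DW: "(\<lambda>\<omega>. ?D *v W \<omega>) \<in> borel_measurable N" by (rule borel_measurable_matrix_vector_mult'[OF W])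
  show ?thesis
    unfolding converges_in_distribution_def
  proof (intro conjI allI impI)
    show "\<forall>\<^sub>F n in sequentially. (\<lambda>\<omega>. matrix_inv (scaled_gram n (x n)) *v fst (score_pair n \<omega>)) \<in> borel_measurable M"
      using c by (simp add: converges_in_distribution_def)
    show "(\<lambda>z. z) \<in> borel_measurable (mvn 0 (sigma\<^sup>2 *\<^sub>R ?D))" by simp
    fix f :: "real^'p \<Rightarrow> real" assume f: "continuous_on UNIV f \<and> bounded (range f)"
    then have fm: "f \<in> borel_measurable borel" by (intro borel_measurable_continuous_onI) simp
    have "(\<integral>z. f z \<partial>mvn 0 (sigma\<^sup>2 *\<^sub>R ?D)) = (\<integral>\<omega>. f (?D *v W \<omega>) \<partial>N)"
      unfolding law[symmetric] by (rule integral_distr[OF DW fm])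
    then show "(\<lambda>n. \<integral>\<omega>. f (matrix_inv (scaled_gram n (x n)) *v fst (score_pair n \<omega>)) \<partial>M) \<longlonglongrightarrow> (\<integral>z. f z \<partial>mvn 0 (sigma\<^sup>2 *\<^sub>R ?D))"
      using c f by (simp add: converges_in_distribution_def)
  qed
qed


definition sample_correction :: "(nat \<Rightarrow> real) \<Rightarrow> real^'p \<Rightarrow> real^'p^'q \<Rightarrow> real^'q \<Rightarrow> nat \<Rightarrow> (real^'p) \<times> real \<Rightarrow> real^'p" where
  "sample_correction lam beta H xi n y = correction (scaled_gram n (x n)) H *v (H *v scaled_lasso lam beta n y + xi)"

definition limit_correction :: "real \<Rightarrow> real^'p \<Rightarrow> real^'p^'q \<Rightarrow> real^'q \<Rightarrow> real^'p \<Rightarrow> real^'p" where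
  "limit_correction lam0 beta H xi w = correction C H *v (H *v limit_lasso lam0 beta w + xi)"

context
  fixes lam :: "nat \<Rightarrow> real" and lam0 :: real and beta :: "real^'p" and H :: "real^'p^'q" and xi :: "real^'q"
  assumes lam: "\<And>n. 0 \<le> lam n" "0 \<le> lam0" "(\<lambda>n. lam n / sqrt (real n)) \<longlonglongrightarrow> lam0"
    and H: "rank H = CARD('q)"
begin

lemma sample_correction_tendsto:
  "((\<lambda>p. sample_correction lam beta H xi (fst p) (snd p)) \<longlongrightarrow> limit_correction lam0 beta H xi w) (at_score w)"
  unfolding sample_correction_def limit_correction_def
  by (intro tendsto_matrix_vector_mult tendsto_correction tendsto_add tendsto_const tendsto_at_score(1)[OF A2] C H
      scaled_lasso_tendsto lam)

lemma limit_correction_measurable [measurable]: "limit_correction lam0 beta H xi \<in> borel_measurable borel"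
  unfolding limit_correction_def[abs_def]
  by (intro borel_measurable_matrix_vector_mult' borel_measurable_add borel_measurable_const
      limit_lasso_measurable[OF lam])

lemma sample_correction_measurable:
  "scaled_lasso lam beta n \<in> borel_measurable borel \<Longrightarrow> sample_correction lam beta H xi n \<in> borel_measurable borel"
  unfolding sample_correction_def[abs_def]
  by (intro borel_measurable_matrix_vector_mult' borel_measurable_add borel_measurable_const)

text \<open>The common limit theorem for estimators that move the lasso towards the restricted lasso by a
  coefficient depending on the test statistic. The coefficients have to converge continuously at almost every
  value of the limiting statistic only.\<close>

lemma shrinkage_converges:
  assumes cm: "\<And>n. c n \<in> borel_measurable borel" and cm0: "c0 \<in> borel_measurable borel"
    and c: "AE \<omega> in N. ((\<lambda>(n, s). c n s) \<longlongrightarrow> (c0 (limit_statistic H xi (W \<omega>)) :: real))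
      (sequentially \<times>\<^sub>F nhds (limit_statistic H xi (W \<omega>)))"
  shows "converges_in_distribution M
      (\<lambda>n \<omega>. scaled_lasso lam beta n (score_pair n \<omega>) -
        c n (sample_statistic H xi n (score_pair n \<omega>)) *\<^sub>R sample_correction lam beta H xi n (score_pair n \<omega>))
      N (\<lambda>\<omega>. limit_lasso lam0 beta (W \<omega>) - c0 (limit_statistic H xi (W \<omega>)) *\<^sub>R limit_correction lam0 beta H xi (W \<omega>))"
proof -
  let ?g = "\<lambda>n y. scaled_lasso lam beta n y - c n (sample_statistic H xi n y) *\<^sub>R sample_correction lam beta H xi n y"
  let ?lim = "\<lambda>y :: (real^'p) \<times> real. limit_lasso lam0 beta (fst y) - c0 (limit_statistic H xi (fst y)) *\<^sub>R limit_correction lam0 beta H xi (fst y)"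
  note [measurable] = limit_lasso_measurable[OF lam] cm cm0
  have "converges_in_distribution M (\<lambda>n \<omega>. ?g n (score_pair n \<omega>)) N (\<lambda>\<omega>. ?lim (W \<omega>, sigma\<^sup>2))"
  proof (rule extended_mapping_theorem[OF M N score_pair_converges, where g="?g" and ?g0.0="?lim"])
    show "\<forall>\<^sub>F n in sequentially. (\<lambda>\<omega>. ?g n (score_pair n \<omega>)) \<in> borel_measurable M"
      using scaled_lasso_measurable[OF lam, of beta]
    proof eventually_elim
      case (elim n)
      note [measurable] = elim sample_correction_measurable[OF elim]
      show ?case by measurable
    qed
    show "(\<lambda>\<omega>. ?lim (W \<omega>, sigma\<^sup>2)) \<in> borel_measurable N"
      unfolding fst_conv by measurable
    show "AE \<omega> in N. ((\<lambda>(n, y). ?g n y) \<longlongrightarrow> ?lim (W \<omega>, sigma\<^sup>2)) (at_score (W \<omega>))"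
      using c
    proof eventually_elim
      case (elim \<omega>)
      have "filterlim (\<lambda>p. (fst p, sample_statistic H xi (fst p) (snd p)))
          (sequentially \<times>\<^sub>F nhds (limit_statistic H xi (W \<omega>))) (at_score (W \<omega>))"
        by (intro filterlim_Pair filterlim_fst sample_statistic_tendsto[OF H])
      from filterlim_compose[OF elim this]
      have "((\<lambda>p. c (fst p) (sample_statistic H xi (fst p) (snd p))) \<longlongrightarrow> c0 (limit_statistic H xi (W \<omega>))) (at_score (W \<omega>))"
        by simp
      then show ?case
        unfolding case_prod_unfold fst_conv
        by (intro tendsto_diff tendsto_scaleR scaled_lasso_tendsto lam sample_correction_tendsto)
    qed
  qed
  then show ?thesis by simp
qed

lemma sample_correction_converges:
  "converges_in_distribution M (\<lambda>n \<omega>. sample_correction lam beta H xi n (score_pair n \<omega>)) N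
    (\<lambda>\<omega>. limit_correction lam0 beta H xi (W \<omega>))"
proof -
  have "converges_in_distribution M (\<lambda>n \<omega>. sample_correction lam beta H xi n (score_pair n \<omega>)) N
    (\<lambda>\<omega>. limit_correction lam0 beta H xi (fst (W \<omega>, sigma\<^sup>2)))"
  proof (rule extended_mapping_theorem[OF M N score_pair_converges,
        where g="sample_correction lam beta H xi" and ?g0.0="\<lambda>y. limit_correction lam0 beta H xi (fst y)"])
    show "\<forall>\<^sub>F n in sequentially. (\<lambda>\<omega>. sample_correction lam beta H xi n (score_pair n \<omega>)) \<in> borel_measurable M"
      using scaled_lasso_measurable[OF lam, of beta]
      by eventually_elim (rule measurable_compose[OF score_pair_measurable sample_correction_measurable])
    show "(\<lambda>\<omega>. limit_correction lam0 beta H xi (fst (W \<omega>, sigma\<^sup>2))) \<in> borel_measurable N"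
      unfolding fst_conv by measurable
    show "AE \<omega> in N. ((\<lambda>(n, y). sample_correction lam beta H xi n y) \<longlongrightarrow> limit_correction lam0 beta H xi (fst (W \<omega>, sigma\<^sup>2))) (at_score (W \<omega>))"
      using sample_correction_tendsto by (simp add: case_prod_unfold)
  qed
  then show ?thesis by simp
qed

end

end

lemma shrinkage_const_tendsto: "(\<lambda>n. shrinkage_const n p q) \<longlonglongrightarrow> real q - 2"
proof -
  have "(\<lambda>n. (real q - 2) * ((real n - real p) / (real n - (real p - 2)))) \<longlonglongrightarrow> (real q - 2) * 1"
    by (intro tendsto_mult tendsto_const ratio_tendsto_1)
  then show ?thesis by (simp add: shrinkage_const_def[abs_def] algebra_simps)
qed

text \<open>This is the coefficient of the positive-rule estimator, regarded as a shrinkage of the lasso towards the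
  restricted lasso. The limit is \<open>k / L\<close> if \<open>L > k\<close> and \<open>1\<close> if \<open>L < k\<close>.\<close>

lemma positive_part_tendsto:
  fixes K :: "nat \<Rightarrow> real"
  assumes K: "K \<longlonglongrightarrow> k" and L: "L \<noteq> 0" "L \<noteq> k"
  shows "((\<lambda>(n, s). 1 - (1 - K n / s) * of_bool (s > K n)) \<longlongrightarrow> k / L + (1 - k / L) * of_bool (L < k)) (sequentially \<times>\<^sub>F nhds L)"
proof -
  have Kn: "((\<lambda>p. K (fst p)) \<longlongrightarrow> k) (sequentially \<times>\<^sub>F nhds L)"
    by (rule filterlim_compose[OF K filterlim_fst])
  have s: "((\<lambda>p. snd p) \<longlongrightarrow> L) (sequentially \<times>\<^sub>F nhds L)" by (rule filterlim_snd)
  have "((\<lambda>p. 1 - (1 - K (fst p) / snd p) * (1 - of_bool (snd p \<le> K (fst p)))) \<longlongrightarrow> 1 - (1 - k / L) * (1 - of_bool (L \<le> k)))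
      (sequentially \<times>\<^sub>F nhds L)"
    by (intro tendsto_diff tendsto_mult tendsto_const tendsto_divide Kn s L tendsto_of_bool_le)
  moreover have "1 - (of_bool (s \<le> c) :: real) = of_bool (s > c)" for s c :: real by auto
  moreover have "1 - (1 - k / L) * of_bool (L > k) = k / L + (1 - k / L) * of_bool (L < k)" using L by auto
  ultimately show ?thesis by (simp add: case_prod_unfold)
qed

theorem theorem2:
  fixes M :: "'a measure" and N :: "'b measure"
    and x :: "nat \<Rightarrow> nat \<Rightarrow> real^'p" and beta :: "real^'p" and eps :: "nat \<Rightarrow> 'a \<Rightarrow> real"
    and sigma :: real and C :: "real^'p^'p"
    and H :: "real^'p^'q" and h :: "nat \<Rightarrow> real^'q" and xi :: "real^'q"
    and lam :: "nat \<Rightarrow> real" and lam0 :: real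
    and alpha :: real and beta0 :: "nat \<Rightarrow> real^'p" and crit :: "nat \<Rightarrow> real"
    and Y :: "nat \<Rightarrow> 'a \<Rightarrow> nat \<Rightarrow> real" and T :: "nat \<Rightarrow> 'a \<Rightarrow> real"
    and bL bRL bPTL bSSL bPRSSL :: "nat \<Rightarrow> 'a \<Rightarrow> real^'p"
    and W v D :: "'b \<Rightarrow> real^'p" and L :: "'b \<Rightarrow> real" and L_alpha k Delta2 :: real
  assumes "prob_space M" and "prob_space N"
    and design_rank: "\<forall>n>CARD('p). dim (x n ` {..<n}) = CARD('p)"
    and A1: "(\<lambda>n. Max ((\<lambda>i. x n i \<bullet> (matrix_inv (gram n (x n)) *v x n i)) ` {..<n})) \<longlonglongrightarrow> 0"
    and A2: "(\<lambda>n. (1 / real n) *\<^sub>R gram n (x n)) \<longlonglongrightarrow> C" "pos_def C"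
    and C_nonsingular: "invertible C"
    and errors_indep: "prob_space.indep_vars M (\<lambda>_. borel) eps UNIV"
    and errors_ident: "\<forall>i. distr M borel (eps i) = distr M borel (eps 0)"
    and errors_mean: "\<forall>i. integrable M (eps i) \<and> (\<integral>\<omega>. eps i \<omega> \<partial>M) = 0"
    and errors_var: "sigma > 0"
      "\<forall>i. integrable M (\<lambda>\<omega>. (eps i \<omega>)\<^sup>2) \<and> (\<integral>\<omega>. (eps i \<omega>)\<^sup>2 \<partial>M) = sigma\<^sup>2"
    and H_rank: "rank H = CARD('q)" "CARD('q) \<le> CARD('p)"
    and local_alternatives: "\<forall>n>CARD('p). H *v beta = h n + (1 / sqrt (real n)) *\<^sub>R xi"
    and penalty: "\<forall>n. 0 \<le> lam n" "0 \<le> lam0" "(\<lambda>n. lam n / sqrt (real n)) \<longlonglongrightarrow> lam0"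
    and level: "0 < alpha" "alpha < 1"
    and null_parameter: "\<forall>n>CARD('p). H *v beta0 n = h n"
    and crit: "\<forall>n>CARD('p). crit n = upper_critical_value alpha (distr M borel
      (\<lambda>\<omega>. test_statistic n (x n) H (h n) (response (x n) (beta0 n) (\<lambda>i. eps i \<omega>))))"
    and Y: "\<forall>n \<omega>. Y n \<omega> = response (x n) beta (\<lambda>i. eps i \<omega>)"
    and T: "\<forall>n \<omega>. T n \<omega> = test_statistic n (x n) H (h n) (Y n \<omega>)"
    and bL: "\<forall>n \<omega>. bL n \<omega> = lasso n (x n) (lam n) (Y n \<omega>)"
    and bRL: "\<forall>n \<omega>. bRL n \<omega> = restricted_lasso n (x n) (lam n) H (h n) (Y n \<omega>)"
    and bPTL: "\<forall>n \<omega>. bPTL n \<omega> = pt_lasso n (x n) (lam n) H (h n) (crit n) (Y n \<omega>)"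
    and bSSL: "\<forall>n \<omega>. bSSL n \<omega> = stein_lasso n (x n) (lam n) H (h n) (Y n \<omega>)"
    and bPRSSL: "\<forall>n \<omega>. bPRSSL n \<omega> = positive_stein_lasso n (x n) (lam n) H (h n) (Y n \<omega>)"
    and W: "distributed N lborel W (mvn_density 0 (sigma\<^sup>2 *\<^sub>R C))"
    and v: "\<forall>\<omega>. v \<omega> = (ARG_MIN (limit_criterion C lam0 beta (W \<omega>)) u. True)"
    and D: "\<forall>\<omega>. D \<omega> = correction C H *v (H *v v \<omega> + xi)"
    and L: "\<forall>\<omega>. L \<omega> = restriction_form C H (H *v (matrix_inv C *v W \<omega>) + xi) / sigma\<^sup>2"
    and L_alpha: "L_alpha = upper_critical_value alpha (noncentral_chi_square (0 :: real^'q))"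
    and k: "k = real CARD('q) - 2"
    and Delta2: "Delta2 = restriction_form C H xi / sigma\<^sup>2"
  shows
    "converges_in_distribution M (\<lambda>n \<omega>. sqrt (real n) *\<^sub>R (ols n (x n) (Y n \<omega>) - beta))
       (mvn 0 (sigma\<^sup>2 *\<^sub>R matrix_inv C)) (\<lambda>z. z) \<and>
     converges_in_distribution M (\<lambda>n \<omega>. sqrt (real n) *\<^sub>R (bL n \<omega> - beta)) N v \<and>
     converges_in_distribution M (\<lambda>n \<omega>. sqrt (real n) *\<^sub>R (bRL n \<omega> - beta))
       N (\<lambda>\<omega>. v \<omega> - D \<omega>) \<and>
     converges_in_distribution M (\<lambda>n \<omega>. sqrt (real n) *\<^sub>R (bL n \<omega> - bRL n \<omega>)) N D \<and>
     (\<forall>mu :: real^'q. (norm mu)\<^sup>2 = Delta2 \<longrightarrow>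
       (\<forall>t. (\<lambda>n. measure M {\<omega> \<in> space M. T n \<omega> \<le> t}) \<longlonglongrightarrow> cdf (noncentral_chi_square mu) t)) \<and>
     converges_in_distribution M (\<lambda>n \<omega>. sqrt (real n) *\<^sub>R (bPTL n \<omega> - beta))
       N (\<lambda>\<omega>. v \<omega> - of_bool (L \<omega> \<le> L_alpha) *\<^sub>R D \<omega>) \<and>
     converges_in_distribution M (\<lambda>n \<omega>. sqrt (real n) *\<^sub>R (bSSL n \<omega> - beta))
       N (\<lambda>\<omega>. v \<omega> - (k / L \<omega>) *\<^sub>R D \<omega>) \<and>
     converges_in_distribution M (\<lambda>n \<omega>. sqrt (real n) *\<^sub>R (bPRSSL n \<omega> - beta))
       N (\<lambda>\<omega>. v \<omega> - (k / L \<omega> + (1 - k / L \<omega>) * of_bool (L \<omega> < k)) *\<^sub>R D \<omega>)"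
proof -
  interpret N: prob_space N by fact
  have law: "distr N borel W = mvn 0 (sigma\<^sup>2 *\<^sub>R C)"
  proof -
    have "distr N borel W = distr N lborel W" by (rule distr_cong) auto
    then show ?thesis using distributed_distr_eq_density[OF W] by (simp add: mvn_def)
  qed
  interpret regression_asymptotics M N x eps sigma C W
  proof (rule regression_asymptotics.intro)
    show "prob_space M" "prob_space N" by fact+
    show "(\<lambda>n. Max ((\<lambda>i. x n i \<bullet> (matrix_inv (gram n (x n)) *v x n i)) ` {..<n})) \<longlonglongrightarrow> 0" by (rule A1)
    show "(\<lambda>n. scaled_gram n (x n)) \<longlonglongrightarrow> C" using A2(1) by (simp add: scaled_gram_def)
    show "pos_def C" "sigma > 0" by fact+
    show "prob_space.indep_vars M (\<lambda>_. borel) eps UNIV" by (rule errors_indep)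
    show "distr M borel (eps i) = distr M borel (eps 0)" for i using errors_ident by blast
    show "integrable M (eps 0)" "(\<integral>\<omega>. eps 0 \<omega> \<partial>M) = 0" using errors_mean by auto
    show "integrable M (\<lambda>\<omega>. (eps 0 \<omega>)\<^sup>2)" "(\<integral>\<omega>. (eps 0 \<omega>)\<^sup>2 \<partial>M) = sigma\<^sup>2" using errors_var(2) by auto
    show "W \<in> borel_measurable N" using distributed_measurable[OF W] by simp
    show "distr N borel W = mvn 0 (sigma\<^sup>2 *\<^sub>R C)" by (rule law)
  qed
  note lam = penalty(1)[rule_format] penalty(2,3)
  note Hr = H_rank(1)
  let ?Z = score_pair and ?T = "sample_statistic H xi"
  let ?V = "scaled_lasso lam beta" and ?D = "sample_correction lam beta H xi"
  obtain m where m: "m > 0" and ev: "\<forall>\<^sub>F n in sequentially. coercive m (scaled_gram n (x n))"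
    by (rule eventually_coercive_gram)
  have ev': "\<forall>\<^sub>F n in sequentially. n > CARD('p) \<and> n > 0 \<and> coercive m (scaled_gram n (x n))"
    using ev eventually_gt_at_top[of "CARD('p)"] by eventually_elim auto

  (* used with zeta = xi for the local alternatives and with zeta = 0 for the null hypothesis *)
  have stat: "test_statistic n (x n) H (h n) (response (x n) b (\<lambda>i. eps i \<omega>)) = sample_statistic H zeta n (?Z n \<omega>)"
    if n: "n > 0" "coercive m (scaled_gram n (x n))" and b: "H *v b = h n + (1 / sqrt (real n)) *\<^sub>R zeta" for n b zeta \<omega>
    unfolding test_statistic_eq[OF n(1) m n(2) Hr b] residual_variance_eq[OF n(1) m n(2)]
    using n(1) by (simp add: sample_statistic_def scaled_statistic_def score_pair_def)
  have T_eq: "T n \<omega> = ?T n (?Z n \<omega>)" if "n > CARD('p)" "n > 0" "coercive m (scaled_gram n (x n))" for n \<omega>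
    using that local_alternatives by (simp add: T Y stat)
  have crit_eq: "crit n = upper_critical_value alpha (distr M borel (\<lambda>\<omega>. sample_statistic H 0 n (?Z n \<omega>)))"
    if n: "n > CARD('p)" "n > 0" "coercive m (scaled_gram n (x n))" for n
    using n null_parameter stat[OF n(2,3), of "beta0 n" 0] by (simp add: crit)
  have V_eq: "sqrt (real n) *\<^sub>R (bL n \<omega> - beta) = ?V n (?Z n \<omega>)"
    if n: "n > CARD('p)" "n > 0" "coercive m (scaled_gram n (x n))" for n \<omega>
    unfolding bL[rule_format] Y[rule_format] lasso_eq[OF n(2) m n(3) lam(1)]
    by (simp add: scaled_lasso_def[OF lam] score_pair_def)
  have D_eq: "sqrt (real n) *\<^sub>R (bL n \<omega> - bRL n \<omega>) = ?D n (?Z n \<omega>)"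
    if n: "n > CARD('p)" "n > 0" "coercive m (scaled_gram n (x n))" for n \<omega>
    using lasso_correction_eq[OF n(2) m n(3) Hr, of beta "h n" xi "lam n" "\<lambda>i. eps i \<omega>"] local_alternatives n(1) V_eq[OF n, of \<omega>]
    by (simp add: bL bRL Y sample_correction_def)
  have crit_lim: "crit \<longlonglongrightarrow> L_alpha"
  proof -
    have "\<forall>\<^sub>F n in sequentially. crit n = upper_critical_value alpha (distr M borel (\<lambda>\<omega>. sample_statistic H 0 n (?Z n \<omega>)))"
      using ev' by eventually_elim (simp add: crit_eq)
    then show ?thesis
      using sample_critical_value_tendsto[OF Hr level] unfolding L_alpha by (simp add: tendsto_cong)
  qed

  have v_eq: "v \<omega> = limit_lasso lam0 beta (W \<omega>)" for \<omega>
    by (simp add: v limit_lasso_def[OF lam] penalized_argmin_def limit_criterion_eq)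
  have Dl_eq: "D \<omega> = limit_correction lam0 beta H xi (W \<omega>)" for \<omega>
    by (simp add: D v_eq limit_correction_def)
  have L_eq: "L \<omega> = limit_statistic H xi (W \<omega>)" for \<omega>
    by (simp add: L limit_statistic_def)
  (* the common form of all lasso-type estimators; t is a value of L, besides 0, at which
     the coefficient may be discontinuous *)
  have estimator: "converges_in_distribution M (\<lambda>n \<omega>. sqrt (real n) *\<^sub>R (b n \<omega> - beta)) N (\<lambda>\<omega>. v \<omega> - limcoef (L \<omega>) *\<^sub>R D \<omega>)"
    if cm: "\<And>n. coef n \<in> borel_measurable borel" and cm0: "limcoef \<in> borel_measurable borel"
      and c: "\<And>\<omega>. L \<omega> \<noteq> t \<Longrightarrow> L \<omega> \<noteq> 0 \<Longrightarrow> ((\<lambda>(n, s). coef n s) \<longlongrightarrow> limcoef (L \<omega>)) (sequentially \<times>\<^sub>F nhds (L \<omega>))"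
      and b: "\<And>n \<omega>. b n \<omega> = bL n \<omega> - coef n (T n \<omega>) *\<^sub>R (bL n \<omega> - bRL n \<omega>)"
    for b :: "nat \<Rightarrow> 'a \<Rightarrow> real^'p" and coef :: "nat \<Rightarrow> real \<Rightarrow> real" and limcoef :: "real \<Rightarrow> real" and t
  proof (rule converges_in_distribution_cong)
    have "AE \<omega> in N. ((\<lambda>(n, s). coef n s) \<longlongrightarrow> limcoef (limit_statistic H xi (W \<omega>))) (sequentially \<times>\<^sub>F nhds (limit_statistic H xi (W \<omega>)))"
      using limit_statistic_neq[OF Hr, of xi t] limit_statistic_neq[OF Hr, of xi 0]
      by eventually_elim (use c in \<open>simp add: L_eq\<close>)
    from shrinkage_converges[OF lam Hr cm cm0 this, of beta]
    show "converges_in_distribution M (\<lambda>n \<omega>. ?V n (?Z n \<omega>) - coef n (?T n (?Z n \<omega>)) *\<^sub>R ?D n (?Z n \<omega>)) N (\<lambda>\<omega>. v \<omega> - limcoef (L \<omega>) *\<^sub>R D \<omega>)"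
      by (simp add: v_eq Dl_eq L_eq)
    show "\<forall>\<^sub>F n in sequentially. \<forall>\<omega>. sqrt (real n) *\<^sub>R (b n \<omega> - beta) = ?V n (?Z n \<omega>) - coef n (?T n (?Z n \<omega>)) *\<^sub>R ?D n (?Z n \<omega>)"
      using ev'
    proof eventually_elim
      case (elim n)
      have "sqrt (real n) *\<^sub>R (b n \<omega> - beta) = sqrt (real n) *\<^sub>R (bL n \<omega> - beta) - coef n (T n \<omega>) *\<^sub>R (sqrt (real n) *\<^sub>R (bL n \<omega> - bRL n \<omega>))" for \<omega>
        by (simp add: b algebra_simps)
      then show ?case using elim by (simp add: V_eq D_eq T_eq)
    qed
  qed

  have 1: "converges_in_distribution M (\<lambda>n \<omega>. sqrt (real n) *\<^sub>R (ols n (x n) (Y n \<omega>) - beta))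
       (mvn 0 (sigma\<^sup>2 *\<^sub>R matrix_inv C)) (\<lambda>z. z)"
  proof (rule converges_in_distribution_cong[OF scaled_ols_converges])
    show "\<forall>\<^sub>F n in sequentially. \<forall>\<omega>. sqrt (real n) *\<^sub>R (ols n (x n) (Y n \<omega>) - beta) =
        matrix_inv (scaled_gram n (x n)) *v fst (?Z n \<omega>)"
      using ev' by eventually_elim (simp add: Y ols_eq[OF _ m] score_pair_def)
  qed
  have 2: "converges_in_distribution M (\<lambda>n \<omega>. sqrt (real n) *\<^sub>R (bL n \<omega> - beta)) N v"
    using estimator[of "\<lambda>_ _. 0" "\<lambda>_. 0" 0 bL] by (simp add: case_prod_unfold)
  have 3: "converges_in_distribution M (\<lambda>n \<omega>. sqrt (real n) *\<^sub>R (bRL n \<omega> - beta)) N (\<lambda>\<omega>. v \<omega> - D \<omega>)"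
    using estimator[of "\<lambda>_ _. 1" "\<lambda>_. 1" 0 bRL] by (simp add: case_prod_unfold)
  have 4: "converges_in_distribution M (\<lambda>n \<omega>. sqrt (real n) *\<^sub>R (bL n \<omega> - bRL n \<omega>)) N D"
  proof (rule converges_in_distribution_cong)
    show "converges_in_distribution M (\<lambda>n \<omega>. ?D n (?Z n \<omega>)) N D"
      using sample_correction_converges[OF lam Hr, of beta xi] by (simp add: Dl_eq[abs_def, symmetric] flip: Dl_eq)
    show "\<forall>\<^sub>F n in sequentially. \<forall>\<omega>. sqrt (real n) *\<^sub>R (bL n \<omega> - bRL n \<omega>) = ?D n (?Z n \<omega>)"
      using ev' by eventually_elim (simp add: D_eq)
  qed
  have 5: "(\<lambda>n. measure M {\<omega> \<in> space M. T n \<omega> \<le> t}) \<longlonglongrightarrow> cdf (noncentral_chi_square mu) t"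
    if mu: "(norm mu)\<^sup>2 = Delta2" for mu :: "real^'q" and t
  proof -
    have "\<forall>\<^sub>F n in sequentially. measure M {\<omega> \<in> space M. T n \<omega> \<le> t} = measure M {\<omega> \<in> space M. ?T n (?Z n \<omega>) \<le> t}"
      using ev' by eventually_elim (simp add: T_eq)
    then show ?thesis
      using sample_statistic_cdf_tendsto[OF Hr mu[unfolded Delta2], of t] by (simp add: tendsto_cong)
  qed
  have 6: "converges_in_distribution M (\<lambda>n \<omega>. sqrt (real n) *\<^sub>R (bPTL n \<omega> - beta))
       N (\<lambda>\<omega>. v \<omega> - of_bool (L \<omega> \<le> L_alpha) *\<^sub>R D \<omega>)"
  proof (rule estimator[of "\<lambda>n s. of_bool (s \<le> crit n)" "\<lambda>s. of_bool (s \<le> L_alpha)" L_alpha])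
    fix \<omega> assume "L \<omega> \<noteq> L_alpha"
    then show "((\<lambda>(n, s). of_bool (s \<le> crit n) :: real) \<longlongrightarrow> of_bool (L \<omega> \<le> L_alpha)) (sequentially \<times>\<^sub>F nhds (L \<omega>))"
      unfolding case_prod_unfold
      by (intro tendsto_of_bool_le filterlim_snd filterlim_compose[OF crit_lim filterlim_fst])
  qed (auto simp: bPTL pt_lasso_def T bL bRL)
  have K: "(\<lambda>n. shrinkage_const n CARD('p) CARD('q)) \<longlonglongrightarrow> k"
    unfolding k by (rule shrinkage_const_tendsto)
  have 7: "converges_in_distribution M (\<lambda>n \<omega>. sqrt (real n) *\<^sub>R (bSSL n \<omega> - beta))
       N (\<lambda>\<omega>. v \<omega> - (k / L \<omega>) *\<^sub>R D \<omega>)"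
  proof (rule estimator[of "\<lambda>n s. shrinkage_const n CARD('p) CARD('q) / s" "\<lambda>s. k / s" 0])
    fix \<omega> assume "L \<omega> \<noteq> 0"
    then show "((\<lambda>(n, s). shrinkage_const n CARD('p) CARD('q) / s) \<longlongrightarrow> k / L \<omega>) (sequentially \<times>\<^sub>F nhds (L \<omega>))"
      unfolding case_prod_unfold
      by (intro tendsto_divide filterlim_snd filterlim_compose[OF K filterlim_fst])
  qed (auto simp: bSSL stein_lasso_def T bL bRL)
  have 8: "converges_in_distribution M (\<lambda>n \<omega>. sqrt (real n) *\<^sub>R (bPRSSL n \<omega> - beta))
       N (\<lambda>\<omega>. v \<omega> - (k / L \<omega> + (1 - k / L \<omega>) * of_bool (L \<omega> < k)) *\<^sub>R D \<omega>)"
  proof (rule estimator[of "\<lambda>n s. 1 - (1 - shrinkage_const n CARD('p) CARD('q) / s) * of_bool (s > shrinkage_const n CARD('p) CARD('q))"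
        "\<lambda>s. k / s + (1 - k / s) * of_bool (s < k)" k])
    fix \<omega> assume "L \<omega> \<noteq> k" "L \<omega> \<noteq> 0"
    then show "((\<lambda>(n, s). 1 - (1 - shrinkage_const n CARD('p) CARD('q) / s) * of_bool (s > shrinkage_const n CARD('p) CARD('q))) \<longlongrightarrow>
        k / L \<omega> + (1 - k / L \<omega>) * of_bool (L \<omega> < k)) (sequentially \<times>\<^sub>F nhds (L \<omega>))"
      by (intro positive_part_tendsto K)
  qed (auto simp: bPRSSL positive_stein_lasso_def T bL bRL algebra_simps)
  show ?thesis using 1 2 3 4 5 6 7 8 by blast
qed

end
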